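(* Consider an ellipsoid $\frac{x_1^2}{a_1}+\frac{x_2^2}{a_2}+\cdots+\frac{x_n^2}{a_n}=1$ in $\mathbb{R}^n$ with $a_1>a_2>\dots>a_n>0$, and let $\Pi$ be an $(n-1)$-dimensional parallelepiped on this ellipsoid bounded by quadrics confocal to it. Then all pairs of opposite vertices of $\Pi$ are at equal geodesic distances.
   Context: The quadrics confocal to the ellipsoid are $\frac{x_1^2}{a_1-\lambda}+\cdots+\frac{x_n^2}{a_n-\lambda}=1$. Through a generic point of the ellipsoid there pass $n-1$ other confocal quadrics, pairwise orthogonal, one of each of $n-1$ topological types (one for each interval $a_{i+1}<\lambda<a_i$). An $(n-1)$-dimensional parallelepiped on the ellipsoid bounded by confocal quadrics is a curvilinear parallelepiped (combinatorially an $(n-1)$-cube) in the ellipsoid whose facets lie on the intersections of the ellipsoid with confocal quadrics, opposite facets being cut out by quadrics of the same type and non-opposite facets by quadrics of different types. Geodesic distance refers to the intrinsic Riemannian metric of the ellipsoid; the claim is that the distance is the same for all $2^{n-2}$ pairs of opposite vertices.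
   Formalization: The parallelepiped is required to contain no point of a focal quadric (for n=3, no umbilic), where the confocal net is singular; for a merely topological cube, such as a four-sided region with a reflex corner enclosing an umbilic, the claim fails. *)

theory Defs
  imports "HOL-Analysis.Analysis"
begin

text \<open>Coordinates are indexed by a finite linearly ordered type \<open>'n\<close>, in which \<open>1, \<dots>, n\<close> are
  the elements in increasing order.\<close>

definition ellipsoid :: "real ^ 'n \<Rightarrow> (real ^ 'n) set" where
  "ellipsoid a = {x. (\<Sum>i\<in>UNIV. (x $ i)\<^sup>2 / a $ i) = 1}"

definition confocal_quadric :: "real ^ 'n \<Rightarrow> real \<Rightarrow> (real ^ 'n) set" where
  "confocal_quadric a \<mu> = {x. (\<Sum>i\<in>UNIV. (x $ i)\<^sup>2 / (a $ i - \<mu>)) = 1}"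

text \<open>The topological types of the confocal quadrics other than ellipsoids correspond to the
  non-maximal indices \<open>i\<close>; the parameters of type \<open>i\<close> form the interval between \<open>a\<^sub>i\<^sub>+\<^sub>1\<close> and \<open>a\<^sub>i\<close>.\<close>

definition type_indices :: "('n::{finite,linorder}) set" where
  "type_indices = {i. \<exists>j. i < j}"

definition type_interval :: "real ^ 'n::{finite,linorder} \<Rightarrow> 'n \<Rightarrow> real set" where
  "type_interval a i = {a $ Min {j. i < j} <..< a $ i}"

text \<open>The degenerate member \<open>\<mu> = a\<^sub>j\<close> of the confocal family is a quadric of codimension two, inside
  the hyperplane \<open>x\<^sub>j = 0\<close>. On the ellipsoid, the points of the focal quadrics are exactly those
  where the parameters of two confocal quadrics through the point coincide (for \<open>n = 3\<close>: the
  umbilics), that is, where the net of confocal quadrics is singular.\<close>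

definition focal_quadric :: "real ^ 'n \<Rightarrow> 'n \<Rightarrow> (real ^ 'n) set" where
  "focal_quadric a j =
     {x. x $ j = 0 \<and> (\<Sum>i\<in>UNIV - {j}. (x $ i)\<^sup>2 / (a $ i - a $ j)) = 1}"

text \<open>The model cube is \<open>cbox 0 1\<close> in the space with coordinates indexed by \<open>'m\<close>.\<close>

definition cube_facet :: "'m \<Rightarrow> real \<Rightarrow> (real ^ 'm) set" where
  "cube_facet k c = {t \<in> cbox 0 1. t $ k = c}"

definition cube_vertices :: "(real ^ 'm) set" where
  "cube_vertices = {v. \<forall>k. v $ k = 0 \<or> v $ k = 1}"

text \<open>A parallelepiped is given together with a homeomorphism \<open>h\<close> from the cube, which singles out
  its facets and vertices. The bijection \<open>\<sigma>\<close> assigns types to the pairs of opposite facets; it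
  forces the cube to have dimension \<open>n - 1\<close>. The two quadrics cutting out opposite facets may have
  the same parameter (e.g. two sheets of one hyperboloid), and the parallelepiped may cross
  coordinate hyperplanes. It may not contain singular points of the confocal net: a topological
  quadrilateral on a triaxial ellipsoid whose sides are lines of curvature can enclose an umbilic,
  but then it has a reflex corner, hence is not a parallelepiped of the net.\<close>

definition confocal_parallelepiped ::
    "real ^ 'n::{finite,linorder} \<Rightarrow> (real ^ 'm \<Rightarrow> real ^ 'n::{finite,linorder})
      \<Rightarrow> (real ^ 'n::{finite,linorder}) set \<Rightarrow> bool" where
  "confocal_parallelepiped a h P \<longleftrightarrow>
     P \<subseteq> ellipsoid a \<and>
     (\<exists>g. homeomorphism (cbox 0 1) P h g) \<and>
     (\<forall>j. P \<inter> focal_quadric a j = {}) \<and>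
     (\<exists>\<sigma>. bij_betw \<sigma> (UNIV :: 'm::finite set) type_indices \<and>
        (\<forall>k. \<forall>c\<in>{0, 1}. \<exists>\<mu>\<in>type_interval a (\<sigma> k).
           h ` cube_facet k c \<subseteq> confocal_quadric a \<mu>))"

text \<open>The intrinsic distance is the infimum of lengths of piecewise \<open>C\<^sup>1\<close> curves. Since \<open>valid_path\<close>
  allows the derivative to be unbounded near break points, \<open>has_integral\<close> is needed to exclude
  curves of infinite length, to which \<open>integral\<close> would assign length \<open>0\<close>.\<close>

definition geodesic_dist :: "'a::euclidean_space set \<Rightarrow> 'a \<Rightarrow> 'a \<Rightarrow> real" where
  "geodesic_dist S x y =
     Inf {L. \<exists>\<gamma>. valid_path \<gamma> \<and> path_image \<gamma> \<subseteq> S \<and> pathstart \<gamma> = x \<and> pathfinish \<gamma> = y \<and>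
               ((\<lambda>t. norm (vector_derivative \<gamma> (at t within {0..1}))) has_integral L) {0..1}}"

end

theory Submission
  imports Defs
begin

text \<open>Let \<open>d\<close> be the geodesic distance of the ellipsoid. In elliptic coordinates, passing from one
  pair of opposite vertices to another means swapping some of the coordinates of the two points.
  Fix \<open>y\<close> and let \<open>\<Psi> x\<close> be the distance of the pair obtained from \<open>(x, y)\<close> by such a swap. The
  momenta at the ends of a geodesic share the values of Jacobi's integrals, and this makes the
  gradient of \<open>\<Psi>\<close> a unit vector wherever coordinates and minimizing geodesics are regular. So
  \<open>\<Psi>\<close> is 1-Lipschitz, and \<open>\<Psi> y = 0\<close>; hence \<open>\<Psi> x \<le> d x y\<close>, and equality follows because the swap is
  an involution. No geodesic has to be constructed: chains \<open>z\<^sub>0, \<dots>, z\<^sub>N\<close> on the ellipsoid that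
  minimize \<open>N \<Sum> |z\<^sub>k\<^sub>+\<^sub>1 - z\<^sub>k|\<^sup>2\<close> conserve the integrals up to \<open>O(1/N)\<close>, and their energies tend to
  \<open>d\<^sup>2\<close>. On the coordinate hyperplanes, where the coordinates are not smooth, \<open>\<Psi>\<close> is merely
  continuous, which suffices because a generic arc meets them in finitely many points.\<close>

section \<open>Curve lengths and geodesic distance\<close>

text \<open>Separation of variables is behind the gradient claim. If t is itself a coordinate of z,
  then \<open>Phi t z v\<close> is a square, up to scale that of the momentum conjugate to this
  coordinate (\<open>Phi_on_quadric\<close>). By conservation it is the same function of t at both
  ends, so each momentum component may be taken from the end that carries the coordinate value.
  \<open>sum_Phi\<close> gives the resulting mixed covector the length of the velocity; only squares
  enter, so signs of components do not matter. Elliptic coordinates forget orthants. A pair is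
  therefore normalized to \<open>point l\<close> and \<open>reflect s (point m)\<close>, and a swap
  keeps the relative signs \<open>s\<close>. For a parallelepiped that crosses coordinate
  hyperplanes it has to be shown that all pairs of opposite vertices have the same relative signs;
  this is where focal points must be absent. Moving the ends of a minimal chain bounds nearby minima
  from above only, so the estimate is for an upper Dini derivative. The function estimated is
  \<open>sqrt (f v + c)\<close> with \<open>c\<close> of order 1/N: this keeps the root smooth at
  zero energy and absorbs the defect of conservation.\<close>

definition curve_lengths :: "'a::euclidean_space set \<Rightarrow> 'a \<Rightarrow> 'a \<Rightarrow> real set" where
  "curve_lengths S x y =
     {L. \<exists>\<gamma>. valid_path \<gamma> \<and> path_image \<gamma> \<subseteq> S \<and> pathstart \<gamma> = x \<and> pathfinish \<gamma> = y \<and>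
           ((\<lambda>t. norm (vector_derivative \<gamma> (at t within {0..1}))) has_integral L) {0..1}}"

lemma geodesic_dist_eq_Inf: "geodesic_dist S x y = Inf (curve_lengths S x y)"
  by (simp add: geodesic_dist_def curve_lengths_def)

text \<open>\<open>vector_derivative\<close> is traded for an explicit derivative \<open>D\<close>
  off a finite set \<open>T\<close>. The two agree off \<open>T\<close>, and a finite set does not
  affect the integral.\<close>

lemma curve_lengths_iff:
  "L \<in> curve_lengths S x y \<longleftrightarrow>
     (\<exists>\<gamma> D T. finite T \<and> continuous_on {0..1} \<gamma> \<and>
        (\<forall>t\<in>{0..1} - T. (\<gamma> has_vector_derivative D t) (at t)) \<and>
        continuous_on ({0..1} - T) D \<and> \<gamma> ` {0..1} \<subseteq> S \<and> \<gamma> 0 = x \<and> \<gamma> 1 = y \<and>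
        ((\<lambda>t. norm (D t)) has_integral L) {0..1})" (is "?l \<longleftrightarrow> ?r")
proof -
  have eq: "((\<lambda>t. norm (vector_derivative \<gamma> (at t within {0..1}))) has_integral L) {0..1} \<longleftrightarrow>
            ((\<lambda>t. norm (D t)) has_integral L) {0..1}"
    if "finite T" "\<forall>t\<in>{0..1} - T. (\<gamma> has_vector_derivative D t) (at t)"
    for \<gamma> :: "real \<Rightarrow> 'a" and D T
    by (rule has_integral_spike_finite_eq[OF that(1)])
      (use that(2) vector_derivative_at_within_ivl[of \<gamma> _ _ 0 1] in fastforce)
  show ?thesis
  proof
    assume ?l
    then obtain \<gamma> where g: "valid_path \<gamma>" "path_image \<gamma> \<subseteq> S" "pathstart \<gamma> = x" "pathfinish \<gamma> = y"
      "((\<lambda>t. norm (vector_derivative \<gamma> (at t within {0..1}))) has_integral L) {0..1}"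
      unfolding curve_lengths_def by blast
    then obtain T D where "finite T" "\<forall>t\<in>{0..1} - T. (\<gamma> has_vector_derivative D t) (at t)"
       "continuous_on ({0..1} - T) D" "continuous_on {0..1} \<gamma>"
      unfolding valid_path_def piecewise_C1_differentiable_on_def C1_differentiable_on_def by blast
    then show ?r
      using g eq[of T \<gamma> D] unfolding path_image_def pathstart_def pathfinish_def by blast
  next
    assume ?r
    then obtain \<gamma> D T where g: "finite T" "continuous_on {0..1} \<gamma>"
        "\<forall>t\<in>{0..1} - T. (\<gamma> has_vector_derivative D t) (at t)"
        "continuous_on ({0..1} - T) D" "\<gamma> ` {0..1} \<subseteq> S" "\<gamma> 0 = x" "\<gamma> 1 = y"
        "((\<lambda>t. norm (D t)) has_integral L) {0..1}"
      by blast
    then have "valid_path \<gamma>"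
      unfolding valid_path_def piecewise_C1_differentiable_on_def C1_differentiable_on_def by blast
    then show ?l
      using g eq[of T \<gamma> D] unfolding curve_lengths_def path_image_def pathstart_def pathfinish_def
      by blast
  qed
qed

lemma curve_lengths_nonneg: "L \<in> curve_lengths S x y \<Longrightarrow> 0 \<le> L"
  unfolding curve_lengths_def by (auto intro: has_integral_nonneg)

lemma bdd_below_curve_lengths: "bdd_below (curve_lengths S x y)"
  by (rule bdd_belowI[of _ 0]) (rule curve_lengths_nonneg)

lemma geodesic_dist_le: "L \<in> curve_lengths S x y \<Longrightarrow> geodesic_dist S x y \<le> L"
  unfolding geodesic_dist_eq_Inf by (intro cInf_lower bdd_below_curve_lengths)

lemma geodesic_dist_nonneg:
  "curve_lengths S x y \<noteq> {} \<Longrightarrow> 0 \<le> geodesic_dist S x y"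
  unfolding geodesic_dist_eq_Inf by (intro cInf_greatest) (auto dest: curve_lengths_nonneg)

lemma curve_lengths_join:
  assumes "L \<in> curve_lengths S x y" "M \<in> curve_lengths S y z"
  shows "L + M \<in> curve_lengths S x z"
proof -
  obtain \<gamma> D T where g: "finite T" "continuous_on {0..1} \<gamma>"
      "\<And>t. t \<in> {0..1} - T \<Longrightarrow> (\<gamma> has_vector_derivative D t) (at t)"
      "continuous_on ({0..1} - T) D" "\<gamma> ` {0..1} \<subseteq> S" "\<gamma> 0 = x" "\<gamma> 1 = y"
      "((\<lambda>t. norm (D t)) has_integral L) {0..1}"
    using assms(1) unfolding curve_lengths_iff by blast
  obtain \<delta> D' T' where h: "finite T'" "continuous_on {0..1} \<delta>"
      "\<And>t. t \<in> {0..1} - T' \<Longrightarrow> (\<delta> has_vector_derivative D' t) (at t)"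
      "continuous_on ({0..1} - T') D'" "\<delta> ` {0..1} \<subseteq> S" "\<delta> 0 = y" "\<delta> 1 = z"
      "((\<lambda>t. norm (D' t)) has_integral M) {0..1}"
    using assms(2) unfolding curve_lengths_iff by blast
  define U where "U = insert (1/2) ((\<lambda>t. t / 2) ` T \<union> (\<lambda>t. t / 2 + 1 / 2) ` T')"
  define E where "E t = (if t \<le> 1/2 then 2 *\<^sub>R D (2 * t) else 2 *\<^sub>R D' (2 * t - 1))" for t
  have T1: "2 * t \<in> {0..1} - T" if "t \<in> {0..1} - U" "t < 1/2" for t
  proof -
    have "2 * t \<notin> T"
    proof
      assume "2 * t \<in> T"
      then have "t \<in> (\<lambda>t. t / 2) ` T" by (intro image_eqI[of _ _ "2 * t"]) auto
      then show False using that unfolding U_def by blast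
    qed
    then show ?thesis using that by auto
  qed
  have T2: "2 * t - 1 \<in> {0..1} - T'" if "t \<in> {0..1} - U" "t > 1/2" for t
  proof -
    have "2 * t - 1 \<notin> T'"
    proof
      assume "2 * t - 1 \<in> T'"
      then have "t \<in> (\<lambda>t. t / 2 + 1/2) ` T'" by (intro image_eqI[of _ _ "2 * t - 1"]) (auto simp: field_simps)
      then show False using that unfolding U_def by blast
    qed
    then show ?thesis using that by auto
  qed
  have half: "1/2 \<in> U" by (simp add: U_def)
  show ?thesis
    unfolding curve_lengths_iff
  proof (rule exI[of _ "\<gamma> +++ \<delta>"], rule exI[of _ E], rule exI[of _ U], intro conjI ballI)
    show "finite U" using g(1) h(1) by (simp add: U_def)
    show "continuous_on {0..1} (\<gamma> +++ \<delta>)"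
      using path_join_imp[of \<gamma> \<delta>] g(2,7) h(2,6) by (simp add: path_def pathstart_def pathfinish_def)
    show "(\<gamma> +++ \<delta>) 0 = x" "(\<gamma> +++ \<delta>) 1 = z"
      using g(6) h(7) by (auto simp: joinpaths_def)
    show "(\<gamma> +++ \<delta>) ` {0..1} \<subseteq> S"
      using path_image_join_subset[of \<gamma> \<delta>] g(5) h(5) unfolding path_image_def by blast
    fix t assume t: "t \<in> {0..1} - U"
    show "(\<gamma> +++ \<delta> has_vector_derivative E t) (at t)"
    proof (cases "t < 1/2")
      case True
      have "((\<lambda>s. 2 * s) has_vector_derivative 2) (at t)"
        by (auto intro!: derivative_eq_intros)
      from vector_diff_chain_at[OF this g(3)[OF T1[OF t True]]]
      have "(\<gamma> \<circ> (\<lambda>s. 2 * s) has_vector_derivative E t) (at t)"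
        using True by (simp add: E_def)
      then show ?thesis
        by (rule has_vector_derivative_transform_within_open[of _ _ _ "{..<1/2}"])
          (use True in \<open>auto simp: joinpaths_def\<close>)
    next
      case False
      with t half have gt: "t > 1/2" by (metis DiffD2 linorder_neqE_linordered_idom)
      have "((\<lambda>s. 2 * s - 1) has_vector_derivative 2) (at t)"
        by (auto intro!: derivative_eq_intros)
      from vector_diff_chain_at[OF this h(3)[OF T2[OF t gt]]]
      have "(\<delta> \<circ> (\<lambda>s. 2 * s - 1) has_vector_derivative E t) (at t)"
        using gt by (simp add: E_def)
      then show ?thesis
        by (rule has_vector_derivative_transform_within_open[of _ _ _ "{1/2<..}"])
          (use gt in \<open>auto simp: joinpaths_def\<close>)
    qed
  next
    have e: "{0..1} - U = ({0..1} - U) \<inter> {..<1/2} \<union> ({0..1} - U) \<inter> {1/2<..}"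
    proof (intro subset_antisym subsetI)
      fix t assume t: "t \<in> {0..1} - U"
      then have "t \<noteq> 1/2" using half by blast
      then have "t < 1/2 \<or> t > 1/2" by linarith
      with t show "t \<in> ({0..1} - U) \<inter> {..<1/2} \<union> ({0..1} - U) \<inter> {1/2<..}" by auto
    qed auto
    have c1: "continuous_on (({0..1} - U) \<inter> {..<1/2}) (\<lambda>t. 2 *\<^sub>R D (2 * t))"
      by (intro continuous_intros continuous_on_compose2[OF g(4)]) (use T1 in auto)
    have c2: "continuous_on (({0..1} - U) \<inter> {1/2<..}) (\<lambda>t. 2 *\<^sub>R D' (2 * t - 1))"
      by (intro continuous_intros continuous_on_compose2[OF h(4)]) (use T2 in auto)
    have "continuous_on (({0..1} - U) \<inter> {..<1/2}) E" "continuous_on (({0..1} - U) \<inter> {1/2<..}) E"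
      by (auto intro: continuous_on_eq[OF c1] continuous_on_eq[OF c2] simp: E_def)
    then show "continuous_on ({0..1} - U) E"
      using continuous_on_Un_local_open[of "({0..1} - U) \<inter> {..<1/2}" "({0..1} - U) \<inter> {1/2<..}" E]
        openin_open_Int[of "{..<1/2}" "{0..1} - U"] openin_open_Int[of "{1/2<..}" "{0..1} - U"]
      unfolding e[symmetric] by simp
  next
    have "((\<lambda>t. norm (D (2 *\<^sub>R t + 0))) has_integral (L /\<^sub>R 2 ^ DIM(real)))
           (cbox ((0 - 0) /\<^sub>R 2) ((1 - 0) /\<^sub>R 2))"
      by (rule has_integral_affinity') (use g(8) in auto)
    from has_integral_mult_right[OF this, of 2]
    have "((\<lambda>t. 2 * norm (D (2 * t))) has_integral L) {0..1/2}" by simp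
    then have i1: "((\<lambda>t. norm (E t)) has_integral L) {0..1/2}"
      by (rule has_integral_spike_finite[rotated 2, of _ _ _ "{}"]) (auto simp: E_def)
    have "((\<lambda>t. norm (D' (2 *\<^sub>R t + - 1))) has_integral (M /\<^sub>R 2 ^ DIM(real)))
           (cbox ((0 - - 1) /\<^sub>R 2) ((1 - - 1) /\<^sub>R 2))"
      by (rule has_integral_affinity') (use h(8) in auto)
    from has_integral_mult_right[OF this, of 2]
    have "((\<lambda>t. 2 * norm (D' (2 * t - 1))) has_integral M) {1/2..1}" by simp
    then have i2: "((\<lambda>t. norm (E t)) has_integral M) {1/2..1}"
      by (rule has_integral_spike_finite[rotated 2, of _ _ _ "{1/2}"]) (auto simp: E_def)
    show "((\<lambda>t. norm (E t)) has_integral L + M) {0..1}"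
      by (rule has_integral_combine[OF _ _ i1 i2]) auto
  qed
qed

lemma geodesic_dist_triangle:
  assumes "curve_lengths S x y \<noteq> {}" "curve_lengths S y z \<noteq> {}"
  shows "geodesic_dist S x z \<le> geodesic_dist S x y + geodesic_dist S y z"
proof -
  have "geodesic_dist S x z - M \<le> Inf (curve_lengths S x y)" if "M \<in> curve_lengths S y z" for M
    using assms(1)
    by (intro cInf_greatest) (use geodesic_dist_le curve_lengths_join[OF _ that] in force)+
  then have "geodesic_dist S x z - Inf (curve_lengths S x y) \<le> M" if "M \<in> curve_lengths S y z" for M
    using that by force
  then have "geodesic_dist S x z - Inf (curve_lengths S x y) \<le> Inf (curve_lengths S y z)"
    using assms(2) by (intro cInf_greatest) auto
  then show ?thesis by (simp add: geodesic_dist_eq_Inf)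
qed

lemma curve_lengths_linear_isometry:
  assumes "bounded_linear R" "\<And>v. norm (R v) = norm v" "R ` S \<subseteq> S" "L \<in> curve_lengths S x y"
  shows "L \<in> curve_lengths S (R x) (R y)"
proof -
  obtain \<gamma> D T where g: "finite T" "continuous_on {0..1} \<gamma>"
      "\<And>t. t \<in> {0..1} - T \<Longrightarrow> (\<gamma> has_vector_derivative D t) (at t)"
      "continuous_on ({0..1} - T) D" "\<gamma> ` {0..1} \<subseteq> S" "\<gamma> 0 = x" "\<gamma> 1 = y"
      "((\<lambda>t. norm (D t)) has_integral L) {0..1}"
    using assms(4) unfolding curve_lengths_iff by blast
  interpret R: bounded_linear R by fact
  show ?thesis
    unfolding curve_lengths_iff
  proof (rule exI[of _ "\<lambda>t. R (\<gamma> t)"], rule exI[of _ "\<lambda>t. R (D t)"], rule exI[of _ T], intro conjI ballI)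
    show "(\<lambda>t. R (\<gamma> t)) ` {0..1} \<subseteq> S" using g(5) assms(3) by blast
    show "((\<lambda>t. R (\<gamma> t)) has_vector_derivative R (D t)) (at t)" if "t \<in> {0..1} - T" for t
      using g(3)[OF that] by (rule R.has_vector_derivative)
  qed (use g in \<open>simp_all add: R.continuous_on assms(2)\<close>)
qed

text \<open>Cutting the curve where the traversed length is \<open>k * L / N\<close> makes every
  chord at most \<open>L / N\<close>. Beyond index \<open>N\<close> the sequence is filled with
  \<open>y\<close>, so that all its terms lie in \<open>S\<close>, as \<open>chains\<close> demands
  later.\<close>

lemma curve_lengths_equal_steps:
  assumes "L \<in> curve_lengths S x y" "0 < N"
  obtains z :: "nat \<Rightarrow> 'a::euclidean_space" where "z 0 = x" "z N = y" "\<And>k. z k \<in> S"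
    "\<And>k. k < N \<Longrightarrow> norm (z (Suc k) - z k) \<le> L / N"
proof -
  obtain \<gamma> D T where g: "finite T" "continuous_on {0..1} \<gamma>"
      "\<And>t. t \<in> {0..1} - T \<Longrightarrow> (\<gamma> has_vector_derivative D t) (at t)"
      "\<gamma> ` {0..1} \<subseteq> S" "\<gamma> 0 = x" "\<gamma> 1 = y"
      "((\<lambda>t. norm (D t)) has_integral L) {0..1}"
    using assms(1) unfolding curve_lengths_iff by blast
  define len where "len t = integral {0..t} (\<lambda>t. norm (D t))" for t
  have int: "(\<lambda>t. norm (D t)) integrable_on {0..1}" using g(7) by blast
  have cont: "continuous_on {0..1} len"
    unfolding len_def by (rule indefinite_integral_continuous_1[OF int])
  have le: "norm (\<gamma> t - \<gamma> s) \<le> len t - len s" if "0 \<le> s" "s \<le> t" "t \<le> 1" for s t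
  proof -
    have D: "(D has_integral (\<gamma> t - \<gamma> s)) {s..t}"
      using that g(1-3)
      by (intro fundamental_theorem_of_calculus_interior_strong[of T])
        (auto intro: continuous_on_subset)
    have "(\<lambda>t. norm (D t)) integrable_on {s..t}"
      using int that by (rule_tac integrable_on_subinterval) auto
    then have "norm (integral {s..t} D) \<le> integral {s..t} (\<lambda>t. norm (D t))"
      using D by (intro integral_norm_bound_integral) auto
    moreover have "len s + integral {s..t} (\<lambda>t. norm (D t)) = len t"
      unfolding len_def using that int
      by (intro Henstock_Kurzweil_Integration.integral_combine) (auto intro: integrable_on_subinterval)
    ultimately show ?thesis using D by (auto simp: integral_unique)
  qed
  have le': "norm (\<gamma> t - \<gamma> s) \<le> \<bar>len t - len s\<bar>" if "s \<in> {0..1}" "t \<in> {0..1}" for s t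
    using le[of s t] le[of t s] that by (cases "s \<le> t") (auto simp: norm_minus_commute)
  have ends: "len 0 = 0" "len 1 = L"
    using g(7) by (auto simp: len_def integral_unique)
  have L0: "0 \<le> L" using assms(1) by (rule curve_lengths_nonneg)
  \<comment> \<open>\<open>len\<close> can be constant near an end of the interval, or everywhere if
    \<open>L = 0\<close>, so the parameters for \<open>k = 0\<close> and \<open>k = N\<close> are
    prescribed.\<close>
  have "\<exists>t\<in>{0..1}. len t = k * L / N \<and> (k = 0 \<longrightarrow> t = 0) \<and> (k = N \<longrightarrow> t = 1)" if "k \<le> N" for k :: nat
  proof -
    have k: "0 \<le> k * L / N" "k * L / N \<le> L"
      using that L0 assms(2) by (auto simp: field_simps mult_left_mono)
    obtain t where "0 \<le> t" "t \<le> 1" "len t = k * L / N"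
      using IVT'[of len 0 "k * L / N" 1] k cont ends by auto
    moreover have "N * L / N = L" using assms(2) by simp
    ultimately show ?thesis
      using ends assms(2) that
      by (cases "k = 0"; cases "k = N") (auto intro: bexI[of _ t] bexI[of _ 0] bexI[of _ 1])
  qed
  then obtain \<tau> where \<tau>: "\<And>k::nat. k \<le> N \<Longrightarrow> \<tau> k \<in> {0..1::real} \<and> len (\<tau> k) = k * L / N \<and>
      (k = 0 \<longrightarrow> \<tau> k = 0) \<and> (k = N \<longrightarrow> \<tau> k = 1)"
    by metis
  show ?thesis
  proof (rule that[of "\<lambda>k. if k \<le> N then \<gamma> (\<tau> k) else y"])
    show "(if k \<le> N then \<gamma> (\<tau> k) else y) \<in> S" for k
      using \<tau>[of k] g(4,6) by auto
    fix k assume k: "k < N"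
    have "norm (\<gamma> (\<tau> (Suc k)) - \<gamma> (\<tau> k)) \<le> \<bar>len (\<tau> (Suc k)) - len (\<tau> k)\<bar>"
      using \<tau>[of k] \<tau>[of "Suc k"] k by (intro le') auto
    also have "len (\<tau> (Suc k)) - len (\<tau> k) = L / N"
      using \<tau>[of k] \<tau>[of "Suc k"] k by (simp add: add_divide_distrib distrib_right)
    also have "\<bar>L / N\<bar> = L / N" using L0 by simp
    finally show "norm ((if Suc k \<le> N then \<gamma> (\<tau> (Suc k)) else y) - (if k \<le> N then \<gamma> (\<tau> k) else y)) \<le> L / N"
      using k by simp
  qed (use \<tau>[of 0] \<tau>[of N] g(5,6) in auto)
qed

section \<open>Elliptic coordinates\<close>

lemma monic_linear_prod:
  fixes c :: "'i \<Rightarrow> real"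
  assumes "finite I"
  shows "degree (\<Prod>j\<in>I. [:- c j, 1:]) = card I" "coeff (\<Prod>j\<in>I. [:- c j, 1:]) (card I) = 1"
proof -
  show d: "degree (\<Prod>j\<in>I. [:- c j, 1:]) = card I"
    by (subst degree_prod_eq_sum_degree) auto
  show "coeff (\<Prod>j\<in>I. [:- c j, 1:]) (card I) = 1"
    using lead_coeff_prod[of "\<lambda>j. [:- c j, 1:]" I] by (simp add: d)
qed

lemma lagrange_interpolation:
  fixes c :: "'i::finite \<Rightarrow> real"
  assumes "inj c" "degree p < CARD('i)"
  shows "p = (\<Sum>i\<in>UNIV. smult (poly p (c i) / (\<Prod>j\<in>UNIV - {i}. c i - c j))
                     (\<Prod>j\<in>UNIV - {i}. [:- c j, 1:]))" (is "p = ?q")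
proof (rule ccontr)
  assume neq: "p \<noteq> ?q"
  have "poly (?q) (c k) = poly p (c k)" for k
  proof -
    have "poly (?q) (c k) = (\<Sum>i\<in>UNIV. if i = k then poly p (c k) else 0)"
      unfolding poly_sum
    proof (intro sum.cong refl)
      fix i
      show "poly (smult (poly p (c i) / (\<Prod>j\<in>UNIV - {i}. c i - c j)) (\<Prod>j\<in>UNIV - {i}. [:- c j, 1:])) (c k)
          = (if i = k then poly p (c k) else 0)"
      proof (cases "i = k")
        case True
        moreover have "(\<Prod>j\<in>UNIV - {k}. c k - c j) \<noteq> 0"
          using assms(1) by (auto simp: inj_eq)
        ultimately show ?thesis by (simp add: poly_prod)
      next
        case False
        then have "(\<Prod>j\<in>UNIV - {i}. c k - c j) = 0"
          by (intro prod_zero) auto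
        then show ?thesis using False by (simp add: poly_prod)
      qed
    qed
    then show ?thesis by simp
  qed
  then have "range c \<subseteq> {t. poly (p - ?q) t = 0}" by auto
  then have "CARD('i) \<le> card {t. poly (p - ?q) t = 0}"
    using card_mono[OF poly_roots_finite, of "p - ?q" "range c"] neq card_image[OF assms(1)] by simp
  also have "\<dots> \<le> degree (p - ?q)"
    using neq by (intro card_poly_roots_bound) auto
  also have "\<dots> < CARD('i)"
  proof (intro degree_diff_less assms(2))
    have "degree ?q \<le> CARD('i) - 1"
      by (intro degree_sum_le order_trans[OF degree_smult_le])
        (auto simp: monic_linear_prod)
    then show "degree ?q < CARD('i)" using zero_less_card_finite[where 'a='i] by linarith
  qed
  finally show False by simp
qed

lemma lagrange_top_coeff:
  fixes c :: "'i::finite \<Rightarrow> real"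
  assumes "inj c" "degree p < CARD('i)"
  shows "(\<Sum>i\<in>UNIV. poly p (c i) / (\<Prod>j\<in>UNIV - {i}. c i - c j)) = coeff p (CARD('i) - 1)"
proof -
  have "coeff (\<Prod>j\<in>UNIV - {i}. [:- c j, 1:]) (CARD('i) - 1) = 1" for i
    using monic_linear_prod(2)[of "UNIV - {i}" c] by simp
  then show ?thesis
    by (subst (2) lagrange_interpolation[OF assms]) (simp add: coeff_sum)
qed

text \<open>The difference of two monic polynomials of the same degree n has degree below n, so it
  equals its interpolation polynomial at the points \<open>c i\<close>. For \<open>c = a\<close> the
  numerators on the left become the squared Cartesian coordinates \<open>coord_sq\<close>, and the
  left side becomes the quadratic form of the confocal family.\<close>

lemma lagrange_partial_fractions:
  fixes c l :: "'i::finite \<Rightarrow> real"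
  assumes "inj c" "\<And>i. t \<noteq> c i"
  shows "(\<Sum>i\<in>UNIV. ((\<Prod>j\<in>UNIV. c i - l j) / (\<Prod>j\<in>UNIV - {i}. c i - c j)) / (c i - t))
         = 1 - (\<Prod>j\<in>UNIV. t - l j) / (\<Prod>j\<in>UNIV. t - c j)"
proof -
  define p where "p = (\<Prod>j\<in>UNIV. [:- l j, 1:]) - (\<Prod>j\<in>UNIV. [:- c j, 1:])"
  have "coeff p CARD('i) = 0"
    using monic_linear_prod(2)[of UNIV c] monic_linear_prod(2)[of UNIV l] by (simp add: p_def)
  moreover have "degree p \<le> CARD('i)"
    unfolding p_def by (intro degree_diff_le) (auto simp: monic_linear_prod)
  ultimately have deg: "degree p < CARD('i)"
    by (metis eq_zero_or_degree_less zero_less_card_finite degree_0)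
  have pc: "poly p (c i) = (\<Prod>j\<in>UNIV. c i - l j)" for i
  proof -
    have "(\<Prod>j\<in>UNIV. c i - c j) = 0" by (intro prod_zero) auto
    then show ?thesis by (simp add: p_def poly_prod)
  qed
  have nz: "(\<Prod>j\<in>UNIV. t - c j) \<noteq> 0" using assms(2) by simp
  have split: "(\<Prod>j\<in>UNIV. t - c j) = (t - c i) * (\<Prod>j\<in>UNIV - {i}. t - c j)" for i
    by (rule prod.remove) auto
  have "(\<Prod>j\<in>UNIV. t - l j) - (\<Prod>j\<in>UNIV. t - c j) = poly p t"
    by (simp add: p_def poly_prod)
  also have "\<dots> = (\<Sum>i\<in>UNIV. (poly p (c i) / (\<Prod>j\<in>UNIV - {i}. c i - c j)) * (\<Prod>j\<in>UNIV - {i}. t - c j))"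
    by (subst lagrange_interpolation[OF assms(1) deg]) (simp add: poly_sum poly_prod)
  also have "\<dots> = (\<Sum>i\<in>UNIV. (poly p (c i) / (\<Prod>j\<in>UNIV - {i}. c i - c j)) * ((\<Prod>j\<in>UNIV. t - c j) / (t - c i)))"
  proof (intro sum.cong refl)
    fix i
    have "(\<Prod>j\<in>UNIV - {i}. t - c j) = (\<Prod>j\<in>UNIV. t - c j) / (t - c i)"
      using assms(2)[of i] split[of i] by simp
    then show "(poly p (c i) / (\<Prod>j\<in>UNIV - {i}. c i - c j)) * (\<Prod>j\<in>UNIV - {i}. t - c j)
      = (poly p (c i) / (\<Prod>j\<in>UNIV - {i}. c i - c j)) * ((\<Prod>j\<in>UNIV. t - c j) / (t - c i))"
      by simp
  qed
  also have "\<dots> = - (\<Prod>j\<in>UNIV. t - c j) * (\<Sum>i\<in>UNIV. (poly p (c i) / (\<Prod>j\<in>UNIV - {i}. c i - c j)) / (c i - t))"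
  proof -
    have "x * (y / (t - c i)) = - y * (x / (c i - t))" for x y i
      using assms(2)[of i] by (simp add: divide_simps) (simp add: algebra_simps)
    then show ?thesis unfolding sum_distrib_left by (intro sum.cong refl)
  qed
  finally have "(\<Prod>j\<in>UNIV. t - l j) - (\<Prod>j\<in>UNIV. t - c j) = - (\<Prod>j\<in>UNIV. t - c j) *
      (\<Sum>i\<in>UNIV. ((\<Prod>j\<in>UNIV. c i - l j) / (\<Prod>j\<in>UNIV - {i}. c i - c j)) / (c i - t))"
    unfolding pc .
  with nz show ?thesis by (simp add: field_simps)
qed

text \<open>The leading coefficient of the monic polynomial with roots \<open>l j\<close>,
  \<open>j \<noteq> k\<close>. It serves points of focal quadrics, where one factor of the product
  formula cancels.\<close>

lemma lagrange_drop_root: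
  fixes c l :: "'i::finite \<Rightarrow> real"
  assumes "inj c"
  shows "(\<Sum>i\<in>UNIV. (\<Prod>j\<in>UNIV - {k}. c i - l j) / (\<Prod>j\<in>UNIV - {i}. c i - c j)) = 1"
proof -
  have "degree (\<Prod>j\<in>UNIV - {k}. [:- l j, 1:]) < CARD('i)"
    using monic_linear_prod(1)[of "UNIV - {k}" l] zero_less_card_finite[where 'a='i] by simp
  from lagrange_top_coeff[OF assms this] show ?thesis
    using monic_linear_prod(2)[of "UNIV - {k}" l] by (simp add: poly_prod)
qed

section \<open>Order of the axes, confocal forms and the coordinate box\<close>

definition top_index :: "'n::{finite,linorder}" where
  "top_index = Max UNIV"

definition next_index :: "'n::{finite,linorder} \<Rightarrow> 'n" where
  "next_index i = Min {j. i < j}"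

lemma le_top_index [simp]: "i \<le> top_index"
  unfolding top_index_def by (rule Max_ge) auto

lemma less_top_index: "i \<noteq> top_index \<Longrightarrow> i < top_index"
  using le_top_index[of i] by (rule order.not_eq_order_implies_strict[rotated])

lemma type_indices_eq: "type_indices = - {top_index :: 'n::{finite,linorder}}"
  unfolding type_indices_def
  using less_top_index le_top_index by (auto simp: leD)

lemma less_next_index: "i \<noteq> top_index \<Longrightarrow> i < next_index i"
  unfolding next_index_def by (subst Min_gr_iff) (auto dest: less_top_index)

lemma next_index_le: "i < j \<Longrightarrow> next_index i \<le> j"
  unfolding next_index_def by (rule Min_le) auto

locale confocal =
  fixes a :: "real ^ 'n::{finite,linorder}"
  assumes axes_decreasing: "i < j \<Longrightarrow> a $ j < a $ i"
    and axes_pos: "0 < a $ i"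
begin

lemma axes_mono: "i \<le> j \<Longrightarrow> a $ j \<le> a $ i"
  using axes_decreasing[of i j] by (auto simp: le_less)

lemma inj_axes: "inj (($) a)"
  by (rule injI) (metis axes_decreasing less_irrefl linorder_less_linear)

lemma axes_eq_iff [simp]: "a $ i = a $ j \<longleftrightarrow> i = j"
  using inj_axes by (auto simp: inj_eq)

abbreviation amax :: real where "amax \<equiv> a $ Min UNIV"

abbreviation amin :: real where "amin \<equiv> a $ top_index"

definition Q :: "real \<Rightarrow> (real, 'n) vec \<Rightarrow> (real, 'n) vec \<Rightarrow> real" where
  "Q l x y = (\<Sum>i\<in>UNIV. x $ i * y $ i / (a $ i - l))"

abbreviation E :: "((real, 'n) vec) set" where "E \<equiv> ellipsoid a"

lemma E_iff: "x \<in> E \<longleftrightarrow> Q 0 x x = 1"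
  by (simp add: ellipsoid_def Q_def power2_eq_square)

lemma confocal_quadric_iff: "x \<in> confocal_quadric a l \<longleftrightarrow> Q l x x = 1"
  by (simp add: confocal_quadric_def Q_def power2_eq_square)

text \<open>The coordinate at the maximal index is the parameter \<open>0\<close> of the ellipsoid itself, so that all
  sums and products range over \<open>UNIV\<close>.\<close>

definition coord_box :: "((real, 'n) vec) set" where
  "coord_box = cbox (\<chi> i. if i = top_index then 0 else a $ next_index i)
                    (\<chi> i. if i = top_index then 0 else a $ i)"

definition coord_interior :: "((real, 'n) vec) set" where
  "coord_interior = {l. l $ top_index = 0 \<and>
     (\<forall>i. i \<noteq> top_index \<longrightarrow> a $ next_index i < l $ i \<and> l $ i < a $ i)}"

lemma mem_coord_box:
  "l \<in> coord_box \<longleftrightarrow> l $ top_index = 0 \<and>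
     (\<forall>i. i \<noteq> top_index \<longrightarrow> a $ next_index i \<le> l $ i \<and> l $ i \<le> a $ i)"
  unfolding coord_box_def mem_box_cart
  by (auto split: if_splits)

lemma coord_interior_subset: "coord_interior \<subseteq> coord_box"
  unfolding coord_interior_def by (auto simp: mem_coord_box less_imp_le)

lemma compact_coord_box: "compact coord_box"
  unfolding coord_box_def by simp

lemma type_interval_eq: "type_interval a i = {a $ next_index i <..< a $ i}"
  by (simp add: type_interval_def next_index_def)

lemma coord_box_ge: "l \<in> coord_box \<Longrightarrow> j < i \<Longrightarrow> a $ i \<le> l $ j"
  using axes_mono[OF next_index_le, of j i] mem_coord_box[of l]
  by (metis le_top_index leD order_trans)

lemma coord_box_le: "l \<in> coord_box \<Longrightarrow> i \<le> j \<Longrightarrow> l $ j \<le> a $ i"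
  using axes_mono[of i j] mem_coord_box[of l] axes_pos[of i]
  by (metis less_imp_le order_trans)

lemma coord_box_less: "l \<in> coord_box \<Longrightarrow> i < j \<Longrightarrow> l $ j < a $ i"
  using axes_decreasing[of i j] coord_box_le[of l j j] by force

lemma coord_interior_gt: "l \<in> coord_interior \<Longrightarrow> j < i \<Longrightarrow> a $ i < l $ j"
  using axes_mono[OF next_index_le, of j i] unfolding coord_interior_def
  by (metis (mono_tags, lifting) le_top_index leD order_le_less_trans mem_Collect_eq)

lemma coord_interior_less: "l \<in> coord_interior \<Longrightarrow> i \<le> j \<Longrightarrow> l $ j < a $ i"
  using axes_mono[of i j] axes_pos[of i] unfolding coord_interior_def
  by (metis (mono_tags, lifting) mem_Collect_eq order_less_le_trans)

lemma coord_interior_neq: "l \<in> coord_interior \<Longrightarrow> a $ i \<noteq> l $ j"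
  using coord_interior_gt[of l j i] coord_interior_less[of l i j] by (cases "j < i") (auto simp: not_less)

lemma coord_interior_decreasing: "l \<in> coord_interior \<Longrightarrow> i < j \<Longrightarrow> l $ j < l $ i"
  using coord_interior_gt[of l i j] coord_interior_less[of l j j] by force

lemma coord_interior_inj: "l \<in> coord_interior \<Longrightarrow> l $ i = l $ j \<Longrightarrow> i = j"
  using coord_interior_decreasing[of l i j] coord_interior_decreasing[of l j i]
  by (metis less_irrefl linorder_less_linear)

text \<open>Jacobi's formula for the square of the i-th Cartesian coordinate: the residue at
  \<open>t = a $ i\<close> of the product of all \<open>t - l $ j\<close> divided by the product of
  all \<open>t - a $ j\<close>.\<close>

definition coord_sq :: "(real, 'n) vec \<Rightarrow> 'n \<Rightarrow> real" where
  "coord_sq l i = (\<Prod>j\<in>UNIV. a $ i - l $ j) / (\<Prod>j\<in>UNIV - {i}. a $ i - a $ j)"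

text \<open>Grouped so that every factor is nonnegative on the box: for \<open>j \<noteq> i\<close>,
  the numbers \<open>l $ j\<close> and \<open>a $ j\<close> lie weakly on the same side of
  \<open>a $ i\<close>.\<close>

lemma coord_sq_eq:
  "coord_sq l i = (a $ i - l $ i) * (\<Prod>j\<in>UNIV - {i}. (a $ i - l $ j) / (a $ i - a $ j))"
proof -
  have "(\<Prod>j\<in>UNIV. a $ i - l $ j) = (a $ i - l $ i) * (\<Prod>j\<in>UNIV - {i}. a $ i - l $ j)"
    by (rule prod.remove) auto
  then show ?thesis by (simp add: coord_sq_def prod_dividef)
qed

lemma coord_ratio_nonneg: "l \<in> coord_box \<Longrightarrow> j \<noteq> i \<Longrightarrow> 0 \<le> (a $ i - l $ j) / (a $ i - a $ j)"
  using coord_box_ge[of l j i] coord_box_le[of l i j] axes_decreasing[of i j] axes_decreasing[of j i]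
  by (cases "j < i") (auto simp: divide_nonneg_pos divide_nonpos_neg)

lemma coord_sq_nonneg: "l \<in> coord_box \<Longrightarrow> 0 \<le> coord_sq l i"
  unfolding coord_sq_eq using coord_box_le[of l i i] coord_ratio_nonneg
  by (intro mult_nonneg_nonneg prod_nonneg) auto

lemma coord_sq_eq_0: "coord_sq l i = 0 \<longleftrightarrow> (\<exists>j. l $ j = a $ i)"
  unfolding coord_sq_def by auto metis

lemma coord_sq_pos: "l \<in> coord_interior \<Longrightarrow> 0 < coord_sq l i"
  using coord_sq_nonneg[of l i] coord_sq_eq_0[of l i] coord_interior_subset coord_interior_neq[of l i]
  by (metis in_mono order_le_less)

text \<open>The representative in the closed positive orthant; the other points with the same
  coordinates are its images under \<open>reflect\<close>.\<close>

definition point :: "(real, 'n) vec \<Rightarrow> (real, 'n) vec" where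
  "point l = (\<chi> i. sqrt (coord_sq l i))"

lemma point_nth [simp]: "point l $ i = sqrt (coord_sq l i)"
  by (simp add: point_def)

lemma point_square: "l \<in> coord_box \<Longrightarrow> point l $ i * point l $ i = coord_sq l i"
  by (simp add: coord_sq_nonneg)

lemma continuous_on_point: "continuous_on S point"
  unfolding point_def coord_sq_def by (intro continuous_intros) auto

lemma Q_point:
  assumes "l \<in> coord_box" "\<And>i. a $ i \<noteq> t"
  shows "Q t (point l) (point l) = 1 - (\<Prod>j\<in>UNIV. t - l $ j) / (\<Prod>j\<in>UNIV. t - a $ j)"
  using lagrange_partial_fractions[OF inj_axes, of t "($) l"] assms
  by (simp add: Q_def coord_sq_nonneg coord_sq_def[symmetric] eq_commute[of t])

lemma Q_point_eq_1_iff: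
  assumes "l \<in> coord_box" "\<And>i. a $ i \<noteq> t"
  shows "Q t (point l) (point l) = 1 \<longleftrightarrow> (\<exists>j. l $ j = t)"
  using assms(2) by (auto simp: Q_point[OF assms] eq_commute[of t])

lemma point_in_E: "l \<in> coord_box \<Longrightarrow> point l \<in> E"
  unfolding E_iff using axes_pos mem_coord_box[of l]
  by (subst Q_point_eq_1_iff) (auto simp: less_imp_neq[symmetric])

lemma Q_point_coord: "l \<in> coord_interior \<Longrightarrow> Q (l $ k) (point l) (point l) = 1"
  using coord_interior_subset coord_interior_neq[of l]
  by (subst Q_point_eq_1_iff) auto

text \<open>The point determines the polynomial \<open>P l\<close> with roots \<open>l $ j\<close>:
  its values at the \<open>a $ i\<close> are read off from \<open>coord_sq\<close>, all others from
  \<open>Q_point\<close>. The order of the roots in the box then recovers \<open>l\<close> from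
  \<open>P l\<close>.\<close>

lemma inj_on_point: "inj_on point coord_box"
proof (rule inj_onI)
  fix l m assume l: "l \<in> coord_box" and m: "m \<in> coord_box" and eq: "point l = point m"
  have csq: "coord_sq l i = coord_sq m i" for i
    using point_square[OF l, of i] point_square[OF m, of i] eq by simp
  define P where "P l = (\<Prod>j\<in>UNIV. [:- l $ j, 1:])" for l :: "(real, 'n) vec"
  have "poly (P l) t = poly (P m) t" for t
  proof (cases "\<exists>i. t = a $ i")
    case True
    then obtain i where t: "t = a $ i" by blast
    have "(\<Prod>j\<in>UNIV - {i}. a $ i - a $ j) \<noteq> 0" by auto
    then show ?thesis using csq[of i] by (simp add: coord_sq_def P_def poly_prod t)
  next
    case False
    then have ne: "\<And>i. a $ i \<noteq> t" and nz: "(\<Prod>j\<in>UNIV. t - a $ j) \<noteq> 0" by auto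
    show ?thesis
      using Q_point[OF l ne] Q_point[OF m ne] nz by (simp add: eq P_def poly_prod)
  qed
  then have "P l = P m" by (simp add: poly_eq_poly_eq_iff[symmetric] fun_eq_iff)
  have anti: "l $ j \<le> l $ i" if "l \<in> coord_box" "i < j" for l i j
    using coord_box_ge[of l i j] coord_box_le[of l j j] that by force
  \<comment> \<open>On the boundary of the box roots may be multiple, so common factors are
    cancelled instead of comparing sets of roots. At the first index \<open>i\<close> of
    disagreement, \<open>l $ i\<close> becomes a root of the remaining factor of \<open>P m\<close>,
    whose roots are all at most \<open>m $ i\<close>.\<close>
  have key: False if l: "l \<in> coord_box" and m: "m \<in> coord_box" and P: "P l = P m"
    and below: "\<And>j. j < i \<Longrightarrow> l $ j = m $ j" and less: "m $ i < l $ i" for l m :: "(real, 'n) vec" and i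
  proof -
    have split: "P l = (\<Prod>j\<in>{..<i}. [:- l $ j, 1:]) * (\<Prod>j\<in>{i..}. [:- l $ j, 1:])" for l
      unfolding P_def by (subst prod.union_disjoint[symmetric]) (auto intro!: prod.cong)
    have "(\<Prod>j\<in>{..<i}. [:- l $ j, 1:]) = (\<Prod>j\<in>{..<i}. [:- m $ j, 1:])"
      using below by (intro prod.cong) auto
    moreover have "(\<Prod>j\<in>{..<i}. [:- l $ j, 1:]) \<noteq> 0" by auto
    ultimately have "(\<Prod>j\<in>{i..}. [:- l $ j, 1:]) = (\<Prod>j\<in>{i..}. [:- m $ j, 1:])"
      using P unfolding split by simp
    then have "poly (\<Prod>j\<in>{i..}. [:- l $ j, 1:]) (l $ i) = poly (\<Prod>j\<in>{i..}. [:- m $ j, 1:]) (l $ i)"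
      by simp
    then have "(\<Prod>j\<in>{i..}. l $ i - m $ j) = (\<Prod>j\<in>{i..}. l $ i - l $ j)"
      by (simp add: poly_prod)
    also have "\<dots> = 0" by (intro prod_zero) auto
    finally obtain j where "i \<le> j" "l $ i = m $ j" by auto
    then show False using less anti[OF m, of i j] by (auto simp: le_less)
  qed
  show "l = m"
  proof (rule ccontr)
    assume "l \<noteq> m"
    then have ne: "{i. l $ i \<noteq> m $ i} \<noteq> {}" by (auto simp: vec_eq_iff)
    define i where "i = Min {i. l $ i \<noteq> m $ i}"
    have i: "l $ i \<noteq> m $ i" using Min_in[OF _ ne] by (simp add: i_def)
    have below: "l $ j = m $ j" if "j < i" for j
    proof (rule ccontr)
      assume "l $ j \<noteq> m $ j"
      then have "i \<le> j" unfolding i_def by (intro Min_le) auto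
      with that show False by simp
    qed
    show False
      using key[OF l m \<open>P l = P m\<close> below] key[OF m l \<open>P l = P m\<close>[symmetric] below[symmetric]] i
      by (meson linorder_neqE_linordered_idom)
  qed
qed

section \<open>The orthogonal frame of normals of the confocal quadrics\<close>

definition xi :: "(real, 'n) vec \<Rightarrow> real \<Rightarrow> (real, 'n) vec" where
  "xi x t = (\<chi> i. x $ i / (a $ i - t))"

text \<open>The squared length of the normal \<open>xi x t\<close>, which is half the gradient of
  \<open>Q t x x\<close> in \<open>x\<close>. It is also the derivative of \<open>Q t x x\<close> in
  \<open>t\<close>, hence the denominator in implicit differentiation of the coordinates, and
  \<open>rho / 4\<close> is the metric coefficient of an elliptic coordinate.\<close>

definition rho :: "(real, 'n) vec \<Rightarrow> real \<Rightarrow> real" where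
  "rho x t = (\<Sum>i\<in>UNIV. (x $ i / (a $ i - t))\<^sup>2)"

lemma Q_eq_inner: "Q t x v = xi x t \<bullet> v"
  by (simp add: Q_def xi_def inner_vec_def)

lemma rho_eq_norm: "rho x t = (norm (xi x t))\<^sup>2"
  by (simp add: rho_def xi_def norm_vec_def L2_set_def sum_nonneg power_divide)

lemma Q_commute: "Q t x y = Q t y x"
  by (simp add: Q_def mult.commute)

lemma E_norm_le:
  assumes "x \<in> E"
  shows "(norm x)\<^sup>2 \<le> amax"
proof -
  have "(norm x)\<^sup>2 = (\<Sum>i\<in>UNIV. x $ i * x $ i)"
    by (simp add: norm_vec_def L2_set_def sum_nonneg power2_eq_square)
  also have "\<dots> \<le> (\<Sum>i\<in>UNIV. amax * (x $ i * x $ i / (a $ i - 0)))"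
  proof (rule sum_mono)
    fix i
    have "a $ i \<le> amax" by (rule axes_mono) simp
    then have "1 * (x $ i * x $ i) \<le> (amax / a $ i) * (x $ i * x $ i)"
      using axes_pos[of i] by (intro mult_right_mono) (auto simp: field_simps)
    then show "x $ i * x $ i \<le> amax * (x $ i * x $ i / (a $ i - 0))" by simp
  qed
  also have "\<dots> = amax"
    unfolding sum_distrib_left[symmetric] using assms by (simp add: E_iff Q_def)
  finally show ?thesis .
qed

text \<open>Cauchy-Schwarz for \<open>xi x t \<bullet> x = 1\<close>, with \<open>E_norm_le\<close>
  bounding \<open>x\<close>.\<close>

lemma rho_ge:
  assumes "Q t x x = 1" "x \<in> E"
  shows "1 \<le> amax * rho x t"
proof -
  have "1 \<le> norm (xi x t) * norm x"
    using Cauchy_Schwarz_ineq2[of "xi x t" x] assms(1) by (simp add: Q_eq_inner)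
  then have "1\<^sup>2 \<le> (norm (xi x t) * norm x)\<^sup>2" by (intro power_mono) auto
  also have "\<dots> = (norm x)\<^sup>2 * rho x t" by (simp add: power_mult_distrib rho_eq_norm)
  also have "\<dots> \<le> amax * rho x t"
    by (intro mult_right_mono E_norm_le assms) (simp add: rho_eq_norm)
  finally show ?thesis by simp
qed

lemma rho_pos: "Q t x x = 1 \<Longrightarrow> 0 < rho x t"
  unfolding rho_eq_norm Q_eq_inner by (metis inner_zero_left norm_eq_zero zero_less_power2 zero_neq_one)

text \<open>Confocal quadrics meet at right angles: \<open>1 / (a $ i - s) - 1 / (a $ i - t)\<close>
  is \<open>s - t\<close> times the product of the two fractions, and both quadratic forms have the
  value 1 at \<open>x\<close>.\<close>

lemma xi_orthogonal:
  assumes "Q s x x = 1" "Q t x x = 1" "s \<noteq> t" "\<And>i. a $ i \<noteq> s" "\<And>i. a $ i \<noteq> t"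
  shows "(\<Sum>i\<in>UNIV. (x $ i / (a $ i - s)) * (x $ i / (a $ i - t))) = 0"
proof -
  have "(s - t) * (\<Sum>i\<in>UNIV. (x $ i / (a $ i - s)) * (x $ i / (a $ i - t)))
      = (\<Sum>i\<in>UNIV. x $ i * x $ i / (a $ i - s) - x $ i * x $ i / (a $ i - t))"
    unfolding sum_distrib_left using assms(4,5)
    by (intro sum.cong refl) (simp add: field_simps)
  also have "\<dots> = 0" using assms(1,2) by (simp add: Q_def sum_subtractf)
  finally show ?thesis using assms(3) by simp
qed

text \<open>The normalized normals are the rows of a square matrix \<open>M\<close> with orthonormal
  rows; hence its columns are orthonormal too.\<close>

lemma xi_complete:
  assumes l: "l \<in> coord_interior" and Q1: "\<And>k. Q (l $ k) x x = 1"
  shows "(\<Sum>k\<in>UNIV. (x $ i / (a $ i - l $ k)) * (x $ j / (a $ j - l $ k)) / rho x (l $ k)) =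
         (if i = j then 1 else 0)"
proof -
  define M :: "((real, 'n) vec, 'n) vec" where
    "M = (\<chi> k i. x $ i / (a $ i - l $ k) / sqrt (rho x (l $ k)))"
  have pos: "0 < rho x (l $ k)" for k by (rule rho_pos[OF Q1])
  have "(M ** transpose M) $ k $ m = mat 1 $ k $ m" for k m
  proof -
    have "(M ** transpose M) $ k $ m = (\<Sum>i\<in>UNIV. (x $ i / (a $ i - l $ k)) * (x $ i / (a $ i - l $ m)))
       / (sqrt (rho x (l $ k)) * sqrt (rho x (l $ m)))"
      by (simp add: M_def matrix_matrix_mult_def transpose_def sum_divide_distrib mult_ac)
    also have "\<dots> = mat 1 $ k $ m"
    proof (cases "k = m")
      case True
      then show ?thesis using pos[of m]
        by (simp add: mat_def rho_def power2_eq_square)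
    next
      case False
      then have "l $ k \<noteq> l $ m" using coord_interior_inj[OF l] by blast
      then have "(\<Sum>i\<in>UNIV. (x $ i / (a $ i - l $ k)) * (x $ i / (a $ i - l $ m))) = 0"
        by (intro xi_orthogonal Q1 coord_interior_neq[OF l]) auto
      then show ?thesis using False by (simp add: mat_def)
    qed
    finally show ?thesis .
  qed
  then have "M ** transpose M = mat 1" by (simp add: vec_eq_iff)
  then have "transpose M ** M = mat 1" by (simp add: matrix_left_right_inverse)
  then have "(transpose M ** M) $ i $ j = (if i = j then 1 else 0)" by (simp add: mat_def)
  moreover have "(transpose M ** M) $ i $ j =
      (\<Sum>k\<in>UNIV. (x $ i / (a $ i - l $ k)) * (x $ j / (a $ j - l $ k)) / rho x (l $ k))"
  proof -
    have "y / sqrt (rho x (l $ k)) * (z / sqrt (rho x (l $ k))) = y * z / rho x (l $ k)" for y z k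
      using pos[of k] by simp
    then show ?thesis unfolding M_def matrix_matrix_mult_def transpose_def by (simp only: vec_lambda_beta)
  qed
  ultimately show ?thesis by simp
qed

text \<open>The squares of the Cartesian coordinates solve a linear system with the Cauchy matrix
  \<open>1 / (a $ j - l $ k)\<close>. Its inverse is supplied by \<open>xi_complete\<close> at
  \<open>point l\<close>, a point with positive coordinates.\<close>

lemma Q_coord_unique:
  assumes l: "l \<in> coord_interior" and Q1: "\<And>k. Q (l $ k) x x = 1"
  shows "x $ i * x $ i = coord_sq l i"
proof -
  let ?point = "point l"
  note QX = Q_point_coord[OF l]
  have X2: "?point $ i * ?point $ i = coord_sq l i" for i
    using point_square coord_interior_subset l by blast
  have Xpos: "?point $ i > 0" for i using coord_sq_pos[OF l] by simp
  define D where "D j = x $ j * x $ j - ?point $ j * ?point $ j" for j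
  have D0: "(\<Sum>j\<in>UNIV. D j / (a $ j - l $ k)) = 0" for k
    using Q1[of k] QX[of k] by (simp add: D_def Q_def diff_divide_distrib sum_subtractf)
  have "(\<Sum>k\<in>UNIV. ?point $ i / (a $ i - l $ k) / rho ?point (l $ k) * (\<Sum>j\<in>UNIV. D j / (a $ j - l $ k))) = 0"
    unfolding D0 by simp
  also have "(\<Sum>k\<in>UNIV. ?point $ i / (a $ i - l $ k) / rho ?point (l $ k) * (\<Sum>j\<in>UNIV. D j / (a $ j - l $ k)))
     = (\<Sum>j\<in>UNIV. D j / ?point $ j * (\<Sum>k\<in>UNIV. (?point $ i / (a $ i - l $ k)) * (?point $ j / (a $ j - l $ k)) / rho ?point (l $ k)))"
    unfolding sum_distrib_left
    apply (subst sum.swap)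
    apply (intro sum.cong refl)
    using Xpos by (simp add: field_simps less_imp_neq[symmetric] del: point_nth)
  also have "\<dots> = (\<Sum>j\<in>UNIV. D j / ?point $ j * (if i = j then 1 else 0))"
    by (simp only: xi_complete[OF l QX])
  also have "\<dots> = D i / ?point $ i" by (simp add: if_distrib cong: if_cong)
  finally have "D i = 0" using Xpos[of i] by simp
  then show ?thesis using X2[of i] by (simp add: D_def)
qed

lemma coord_nonzero:
  assumes "l \<in> coord_interior" "\<And>k. Q (l $ k) x x = 1"
  shows "x $ i \<noteq> 0"
  using Q_coord_unique[OF assms, of i] coord_sq_pos[OF assms(1), of i] by auto

lemma xi_parseval:
  assumes l: "l \<in> coord_interior" and Q1: "\<And>k. Q (l $ k) x x = 1"
  shows "(\<Sum>k\<in>UNIV. (Q (l $ k) x v)\<^sup>2 / rho x (l $ k)) = (norm v)\<^sup>2"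
proof -
  have "(\<Sum>k\<in>UNIV. (Q (l $ k) x v)\<^sup>2 / rho x (l $ k)) =
     (\<Sum>k\<in>UNIV. \<Sum>i\<in>UNIV. \<Sum>j\<in>UNIV. v $ i * v $ j *
        ((x $ i / (a $ i - l $ k)) * (x $ j / (a $ j - l $ k)) / rho x (l $ k)))"
    by (simp add: Q_def power2_eq_square sum_product sum_divide_distrib mult_ac)
  also have "\<dots> = (\<Sum>i\<in>UNIV. \<Sum>k\<in>UNIV. \<Sum>j\<in>UNIV. v $ i * v $ j *
        ((x $ i / (a $ i - l $ k)) * (x $ j / (a $ j - l $ k)) / rho x (l $ k)))"
    by (rule sum.swap)
  also have "\<dots> = (\<Sum>i\<in>UNIV. \<Sum>j\<in>UNIV. \<Sum>k\<in>UNIV. v $ i * v $ j *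
        ((x $ i / (a $ i - l $ k)) * (x $ j / (a $ j - l $ k)) / rho x (l $ k)))"
    by (rule sum.cong[OF refl], rule sum.swap)
  also have "\<dots> = (\<Sum>i\<in>UNIV. \<Sum>j\<in>UNIV. v $ i * v $ j * (if i = j then 1 else 0))"
    by (simp only: sum_distrib_left[symmetric] xi_complete[OF l Q1])
  also have "\<dots> = (norm v)\<^sup>2"
    by (simp add: norm_vec_def L2_set_def sum_nonneg power2_eq_square if_distrib cong: if_cong)
  finally show ?thesis .
qed

text \<open>The first identity is \<open>xi_complete\<close> divided by
  \<open>x $ i * x $ j\<close>. For the second, each term is multiplied by
  \<open>Q (l $ k) x x = 1\<close>, which after expansion reduces it to the first.\<close>

lemma sum_inverse_rho:
  assumes l: "l \<in> coord_interior" and Q1: "\<And>k. Q (l $ k) x x = 1"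
  shows "(\<Sum>k\<in>UNIV. 1 / ((a $ i - l $ k) * (a $ j - l $ k)) / rho x (l $ k)) =
         (if i = j then 1 / (x $ i * x $ i) else 0)"
    and "(\<Sum>k\<in>UNIV. 1 / (a $ i - l $ k) / rho x (l $ k)) = 1"
proof -
  have nz: "x $ i \<noteq> 0" for i by (rule coord_nonzero[OF l Q1])
  have 1: "(\<Sum>k\<in>UNIV. 1 / ((a $ i - l $ k) * (a $ j - l $ k)) / rho x (l $ k)) =
         (if i = j then 1 / (x $ i * x $ i) else 0)" for i j
  proof -
    have "(\<Sum>k\<in>UNIV. 1 / ((a $ i - l $ k) * (a $ j - l $ k)) / rho x (l $ k)) =
      1 / (x $ i * x $ j) * (\<Sum>k\<in>UNIV. (x $ i / (a $ i - l $ k)) * (x $ j / (a $ j - l $ k)) / rho x (l $ k))"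
      unfolding sum_distrib_left using nz by (intro sum.cong refl) simp
    then show ?thesis by (simp only: xi_complete[OF l Q1]) simp
  qed
  show "(\<Sum>k\<in>UNIV. 1 / ((a $ i - l $ k) * (a $ j - l $ k)) / rho x (l $ k)) =
         (if i = j then 1 / (x $ i * x $ i) else 0)" by (rule 1)
  have "(\<Sum>k\<in>UNIV. 1 / (a $ i - l $ k) / rho x (l $ k)) =
     (\<Sum>k\<in>UNIV. 1 / (a $ i - l $ k) / rho x (l $ k) * Q (l $ k) x x)"
    by (simp add: Q1)
  also have "\<dots> = (\<Sum>j\<in>UNIV. x $ j * x $ j * (\<Sum>k\<in>UNIV. 1 / ((a $ i - l $ k) * (a $ j - l $ k)) / rho x (l $ k)))"
    unfolding Q_def sum_distrib_left
    by (subst sum.swap) (simp add: mult_ac)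
  also have "\<dots> = 1"
    unfolding 1 using nz by (simp add: if_distrib cong: if_cong)
  finally show "(\<Sum>k\<in>UNIV. 1 / (a $ i - l $ k) / rho x (l $ k)) = 1" .
qed

text \<open>In \<open>t\<close>, this is the generating function \<open>\<Sum> F\<^sub>i / (a\<^sub>i - t)\<close> of the Jacobi integrals \<open>F\<^sub>i\<close> of a
  geodesic through \<open>z\<close> with velocity \<open>v\<close>.\<close>

definition Phi :: "real \<Rightarrow> (real, 'n) vec \<Rightarrow> (real, 'n) vec \<Rightarrow> real" where
  "Phi t z v = Q t v v - (Q t z z * Q t v v - (Q t z v)\<^sup>2)"

lemma Phi_on_quadric: "Q t z z = 1 \<Longrightarrow> Phi t z v = (Q t z v)\<^sup>2"
  by (simp add: Phi_def)

text \<open>The point \<open>x\<close> that supplies the coordinates is unrelated to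
  \<open>z\<close> and \<open>v\<close>. This is what allows the integrals of a geodesic, known at
  one end, to be evaluated at the coordinates of a mixed point. The quartic part of
  \<open>Phi\<close> drops out because \<open>sum_inverse_rho\<close> keeps only the diagonal
  coefficients \<open>w i i\<close>, which are 0.\<close>

lemma sum_Phi:
  assumes l: "l \<in> coord_interior" and Q1: "\<And>k. Q (l $ k) x x = 1"
  shows "(\<Sum>k\<in>UNIV. Phi (l $ k) z v / rho x (l $ k)) = (norm v)\<^sup>2"
proof -
  define w where "w i j = z $ i * z $ i * (v $ j * v $ j) - z $ i * v $ i * (z $ j * v $ j)" for i j
  have "Q t z z * Q t v v - (Q t z v)\<^sup>2 = (\<Sum>i\<in>UNIV. \<Sum>j\<in>UNIV. w i j * (1 / ((a $ i - t) * (a $ j - t))))" for t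
    unfolding Q_def power2_eq_square sum_product sum_subtractf[symmetric] w_def
    by (intro sum.cong refl) (simp add: diff_divide_distrib)
  then have "(\<Sum>k\<in>UNIV. (Q (l $ k) z z * Q (l $ k) v v - (Q (l $ k) z v)\<^sup>2) / rho x (l $ k)) =
      (\<Sum>k\<in>UNIV. \<Sum>i\<in>UNIV. \<Sum>j\<in>UNIV. w i j * (1 / ((a $ i - l $ k) * (a $ j - l $ k)) / rho x (l $ k)))"
    by (simp add: sum_divide_distrib)
  also have "\<dots> = (\<Sum>i\<in>UNIV. \<Sum>k\<in>UNIV. \<Sum>j\<in>UNIV. w i j * (1 / ((a $ i - l $ k) * (a $ j - l $ k)) / rho x (l $ k)))"
    by (rule sum.swap)
  also have "\<dots> = (\<Sum>i\<in>UNIV. \<Sum>j\<in>UNIV. \<Sum>k\<in>UNIV. w i j * (1 / ((a $ i - l $ k) * (a $ j - l $ k)) / rho x (l $ k)))"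
    by (rule sum.cong[OF refl], rule sum.swap)
  also have "\<dots> = (\<Sum>i\<in>UNIV. \<Sum>j\<in>UNIV. w i j * (if i = j then 1 / (x $ i * x $ i) else 0))"
    by (simp only: sum_distrib_left[symmetric] sum_inverse_rho(1)[OF l Q1])
  also have "\<dots> = 0" by (intro sum.neutral ballI) (simp add: w_def)
  finally have 0: "(\<Sum>k\<in>UNIV. (Q (l $ k) z z * Q (l $ k) v v - (Q (l $ k) z v)\<^sup>2) / rho x (l $ k)) = 0" .
  have "(\<Sum>k\<in>UNIV. Q (l $ k) v v / rho x (l $ k)) =
      (\<Sum>i\<in>UNIV. v $ i * v $ i * (\<Sum>k\<in>UNIV. 1 / (a $ i - l $ k) / rho x (l $ k)))"
    unfolding Q_def sum_divide_distrib sum_distrib_left by (subst sum.swap) simp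
  also have "\<dots> = (norm v)\<^sup>2"
    unfolding sum_inverse_rho(2)[OF l Q1]
    by (simp add: norm_vec_def L2_set_def sum_nonneg power2_eq_square)
  finally show ?thesis using 0 by (simp add: Phi_def diff_divide_distrib sum_subtractf)
qed

lemma coords_exist:
  assumes p: "p \<in> E" and nz: "\<And>i. p $ i \<noteq> 0"
  shows "\<exists>l\<in>coord_interior. \<forall>k. Q (l $ k) p p = 1"
proof -
  have "\<exists>t. a $ next_index k < t \<and> t < a $ k \<and> Q t p p = 1" if k: "k \<noteq> top_index" for k
  proof -
    let ?n = "next_index k" and ?I = "UNIV - {k, next_index k}"
    have kn: "k < ?n" by (rule less_next_index[OF k])
    then have alt: "a $ ?n < a $ k" by (rule axes_decreasing)
    have out: "a $ i < a $ ?n \<or> a $ k < a $ i" if "i \<in> ?I" for i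
    proof (cases "i < k")
      case True then show ?thesis using axes_decreasing by blast
    next
      case False
      then have "k < i" using that by auto
      then have "?n < i" using next_index_le[of k i] that by (auto simp: le_less)
      then show ?thesis using axes_decreasing by blast
    qed
    \<comment> \<open>\<open>G t\<close> is \<open>1 - Q t p p\<close> multiplied by
      \<open>(a $ k - t) * (t - a $ ?n)\<close>, which clears the poles at both ends of the
      interval. What remains at each end is a single term, and the two terms have opposite
      signs.\<close>
    define G where "G t = (a $ k - t) * (t - a $ ?n) - (\<Sum>i\<in>?I. p $ i * p $ i / (a $ i - t)) * ((a $ k - t) * (t - a $ ?n))
        - p $ k * p $ k * (t - a $ ?n) + p $ ?n * p $ ?n * (a $ k - t)" for t
    have "continuous_on {a $ ?n .. a $ k} G"
      unfolding G_def using out by (intro continuous_intros) force+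
    moreover have "G (a $ k) < 0" "0 < G (a $ ?n)"
    proof -
      have "0 < p $ i * p $ i" for i using nz not_real_square_gt_zero by blast
      then show "G (a $ k) < 0" "0 < G (a $ ?n)"
        using alt unfolding G_def by (simp_all only: diff_self mult_zero_left mult_zero_right) simp_all
    qed
    ultimately obtain t where t: "a $ ?n \<le> t" "t \<le> a $ k" "G t = 0"
      using IVT2'[of G "a $ k" 0 "a $ ?n"] alt by fastforce
    then have "t \<noteq> a $ k" "t \<noteq> a $ ?n"
      using \<open>G (a $ k) < 0\<close> \<open>0 < G (a $ ?n)\<close> by auto
    then have lt: "a $ ?n < t" "t < a $ k" using t by auto
    have "Q t p p = p $ k * p $ k / (a $ k - t) + (p $ ?n * p $ ?n / (a $ ?n - t) + (\<Sum>i\<in>?I. p $ i * p $ i / (a $ i - t)))"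
    proof -
      have "(UNIV :: 'n set) - {k} - {?n} = ?I" by auto
      then show ?thesis
        unfolding Q_def using kn
        by (subst sum.remove[of _ k], simp, simp, subst sum.remove[of _ ?n]) auto
    qed
    moreover have "(a $ k - t) * (t - a $ ?n) * (1 - (p $ k * p $ k / (a $ k - t) + (p $ ?n * p $ ?n / (a $ ?n - t) + (\<Sum>i\<in>?I. p $ i * p $ i / (a $ i - t))))) = G t"
    proof -
      define S where "S = (\<Sum>i\<in>?I. p $ i * p $ i / (a $ i - t))"
      have nz: "a $ k - t \<noteq> 0" "a $ ?n - t \<noteq> 0" using lt by auto
      have "A * B * (1 - (x / A + (y / - B + S))) = A * B - S * (A * B) - x * B + y * A"
        if "A \<noteq> 0" "B \<noteq> 0" for A B x y :: real
        using that by (simp add: field_simps)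
      from this[of "a $ k - t" "t - a $ ?n"] nz show ?thesis
        unfolding G_def S_def[symmetric] by simp
    qed
    ultimately have "Q t p p = 1" using t(3) lt by simp
    with lt show ?thesis by blast
  qed
  then obtain f where f: "\<And>k. k \<noteq> top_index \<Longrightarrow> a $ next_index k < f k \<and> f k < a $ k \<and> Q (f k) p p = 1"
    by metis
  show ?thesis
    by (rule bexI[of _ "\<chi> k. if k = top_index then 0 else f k"])
      (use f p in \<open>auto simp: coord_interior_def E_iff\<close>)
qed

section \<open>The elliptic coordinates of a point of the ellipsoid\<close>

definition absv :: "(real, 'n) vec \<Rightarrow> (real, 'n) vec" where
  "absv p = (\<chi> i. \<bar>p $ i\<bar>)"

lemma absv_nth [simp]: "absv p $ i = \<bar>p $ i\<bar>"
  by (simp add: absv_def)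

lemma coords_imp_absv:
  assumes "l \<in> coord_interior" "\<And>k. Q (l $ k) p p = 1"
  shows "point l = absv p"
  by (simp add: vec_eq_iff Q_coord_unique[OF assms, symmetric])

definition proj :: "(real, 'n) vec \<Rightarrow> (real, 'n) vec" where
  "proj r = (1 / sqrt (Q 0 r r)) *\<^sub>R r"

lemma Q0_pos: "r \<noteq> 0 \<Longrightarrow> 0 < Q 0 r r"
proof -
  assume "r \<noteq> 0"
  then obtain i where "r $ i \<noteq> 0" by (auto simp: vec_eq_iff)
  then have "0 < r $ i * r $ i" using not_real_square_gt_zero by blast
  then have "0 < r $ i * r $ i / (a $ i - 0)"
    using axes_pos by simp
  then show ?thesis
    unfolding Q_def using axes_pos
    by (intro sum_pos2[of _ i]) (auto intro!: divide_nonneg_pos)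
qed

lemma Q_scaleR: "Q t (c *\<^sub>R x) (d *\<^sub>R y) = c * d * Q t x y"
  unfolding Q_def sum_distrib_left by (intro sum.cong) auto

lemma proj_in_E: "r \<noteq> 0 \<Longrightarrow> proj r \<in> E"
  using Q0_pos[of r] by (simp add: E_iff proj_def Q_scaleR)

lemma proj_E: "p \<in> E \<Longrightarrow> proj p = p"
  by (simp add: proj_def E_iff)

lemma E_nonzero: "p \<in> E \<Longrightarrow> p \<noteq> 0"
  by (auto simp: E_iff Q_def)

lemma absv_in_E: "p \<in> E \<Longrightarrow> absv p \<in> E"
  by (simp add: E_iff Q_def)

lemma continuous_proj:
  assumes "r \<noteq> 0" shows "isCont proj r"
proof -
  have "Q 0 r r \<noteq> 0" using Q0_pos[OF assms] by simp
  then have "isCont (\<lambda>r. (1 / sqrt (Q 0 r r)) *\<^sub>R r) r"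
    unfolding Q_def by (intro continuous_intros) (auto simp: axes_pos less_imp_neq[symmetric])
  then show ?thesis by (simp add: proj_def[abs_def])
qed

text \<open>Points with nonzero coordinates are dense, and the image of the box is closed.\<close>

lemma absv_in_image:
  assumes p: "p \<in> E"
  shows "absv p \<in> point ` coord_box"
proof -
  have cl: "closed (point ` coord_box)"
    by (intro compact_imp_closed compact_continuous_image continuous_on_point compact_coord_box)
  define r where "r t = absv p + t *\<^sub>R (1 :: (real, 'n) vec)" for t
  have "(r \<longlongrightarrow> absv p) (at_right 0)"
  proof -
    have "(r \<longlongrightarrow> r 0) (at_right 0)"
      unfolding r_def by (intro tendsto_intros)
    then show ?thesis by (simp add: r_def)
  qed
  then have "((\<lambda>t. proj (r t)) \<longlongrightarrow> proj (absv p)) (at_right 0)"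
    by (rule isCont_tendsto_compose[OF continuous_proj[OF E_nonzero[OF absv_in_E[OF p]]]])
  moreover have "\<forall>\<^sub>F t in at_right 0. proj (r t) \<in> point ` coord_box"
  proof (rule eventually_at_right_less[THEN eventually_mono])
    fix t :: real assume t: "0 < t"
    have pos: "r t $ i > 0" for i using t by (simp add: r_def add_nonneg_pos)
    then have "r t \<noteq> 0" by (metis less_irrefl zero_index)
    then have q: "0 < Q 0 (r t) (r t)" "proj (r t) \<in> E" by (auto intro: Q0_pos proj_in_E)
    then have pos: "proj (r t) $ i > 0" for i using pos[of i] by (simp add: proj_def)
    obtain l where l: "l \<in> coord_interior" "\<And>k. Q (l $ k) (proj (r t)) (proj (r t)) = 1"
      using coords_exist[OF q(2)] pos by (metis less_irrefl)
    have "point l = proj (r t)"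
      using coords_imp_absv[OF l] pos by (auto simp: vec_eq_iff less_imp_le abs_of_pos)
    then show "proj (r t) \<in> point ` coord_box" using l(1) coord_interior_subset by (metis image_eqI in_mono)
  qed
  ultimately have "proj (absv p) \<in> point ` coord_box"
    using Lim_in_closed_set[OF cl] by (metis trivial_limit_at_right_real)
  then show ?thesis by (simp add: proj_E absv_in_E p)
qed

text \<open>Inverting \<open>point\<close> on the closed box, rather than solving for roots, also
  covers points on the coordinate hyperplanes and makes continuity there a matter of compactness.
  The coordinates depend on \<open>absv p\<close> only.\<close>

definition coords :: "(real, 'n) vec \<Rightarrow> (real, 'n) vec" where
  "coords p = inv_into coord_box point (absv p)"

lemma coords_in_box: "p \<in> E \<Longrightarrow> coords p \<in> coord_box"
  unfolding coords_def by (intro inv_into_into absv_in_image)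

lemma point_coords: "p \<in> E \<Longrightarrow> point (coords p) = absv p"
  unfolding coords_def by (intro f_inv_into_f absv_in_image)

lemma coords_eqI: "l \<in> coord_box \<Longrightarrow> point l = absv p \<Longrightarrow> coords p = l"
  unfolding coords_def by (metis inj_on_point inv_into_f_f)

lemma coords_unique: "l \<in> coord_interior \<Longrightarrow> (\<And>k. Q (l $ k) p p = 1) \<Longrightarrow> coords p = l"
  using coord_interior_subset by (intro coords_eqI coords_imp_absv) auto

lemma coords_interior:
  assumes "p \<in> E" "\<And>i. p $ i \<noteq> 0"
  shows "coords p \<in> coord_interior" "Q (coords p $ k) p p = 1"
  using coords_exist[OF assms] coords_unique by metis+

lemma coords_square: "p \<in> E \<Longrightarrow> p $ i * p $ i = coord_sq (coords p) i"
  using point_square[OF coords_in_box, of p i] point_coords[of p] by (metis abs_mult_self_eq absv_nth)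

lemma continuous_on_coords: "continuous_on E coords"
proof -
  have "continuous_on (point ` coord_box) (inv_into coord_box point)"
    by (intro continuous_on_inv continuous_on_point compact_coord_box ballI inv_into_f_f inj_on_point)
  moreover have "continuous_on E absv"
    unfolding absv_def by (intro continuous_intros)
  ultimately show ?thesis
    unfolding coords_def using absv_in_image by (rule_tac continuous_on_compose2) auto
qed

lemma Q_cong_absv: "absv p = absv q \<Longrightarrow> Q t p p = Q t q q"
  unfolding Q_def vec_eq_iff absv_nth by (metis abs_mult_self_eq)

text \<open>The parameter \<open>t\<close> is one of the coordinates by
  \<open>Q_point_eq_1_iff\<close>; no coordinate of another index can reach the open interval of
  type \<open>i\<close>.\<close>

lemma coords_facet:
  assumes p: "p \<in> E" and t: "t \<in> type_interval a i" and i: "i \<noteq> top_index" and Q1: "Q t p p = 1"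
  shows "coords p $ i = t"
proof -
  have t: "a $ next_index i < t" "t < a $ i" using t by (auto simp: type_interval_eq)
  have ta: "a $ k \<noteq> t" for k
  proof (cases "k \<le> i")
    case True then show ?thesis using axes_mono[of k i] t by auto
  next
    case False
    then show ?thesis using axes_mono[OF next_index_le, of i k] t by (auto simp: not_le)
  qed
  have "Q t (point (coords p)) (point (coords p)) = 1"
    using Q1 Q_cong_absv[of "point (coords p)" p t] by (simp add: point_coords[OF p] absv_def)
  then obtain j where j: "coords p $ j = t" using Q_point_eq_1_iff[OF coords_in_box[OF p] ta] by blast
  have "j = i"
  proof (rule linorder_cases)
    assume "j < i" then show ?thesis using coord_box_ge[OF coords_in_box[OF p], of j i] j t by simp
  next
    assume "i < j"
    then show ?thesis using coord_box_le[OF coords_in_box[OF p] next_index_le, of i j] j t by simp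
  qed
  with j show ?thesis by simp
qed

text \<open>A coordinate equal to \<open>a $ i\<close> cancels the factor
  \<open>a $ m - a $ i\<close> in the formula for the other squares. The sum over
  \<open>m \<noteq> i\<close> is then that of \<open>lagrange_drop_root\<close>, whose term at
  \<open>i\<close> vanishes because of the second coordinate equal to \<open>a $ i\<close>.\<close>

lemma coords_focal:
  assumes p: "p \<in> E" and i: "coords p $ i = a $ i" and j: "coords p $ j = a $ i" "i \<noteq> j"
  shows "p \<in> focal_quadric a i"
proof -
  let ?l = "coords p"
  have "p $ i * p $ i = 0"
    using coords_square[OF p, of i] i by (auto simp: coord_sq_eq_0)
  then have "p $ i = 0" by simp
  have summand: "(p $ m)\<^sup>2 / (a $ m - a $ i) = (\<Prod>j\<in>UNIV - {i}. a $ m - ?l $ j) / (\<Prod>j\<in>UNIV - {m}. a $ m - a $ j)"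
    if "m \<noteq> i" for m
  proof -
    have "(\<Prod>j\<in>UNIV. a $ m - ?l $ j) = (a $ m - a $ i) * (\<Prod>j\<in>UNIV - {i}. a $ m - ?l $ j)"
      using prod.remove[of UNIV i "\<lambda>j. a $ m - ?l $ j"] i by simp
    then show ?thesis
      using coords_square[OF p, of m] that by (simp add: power2_eq_square coord_sq_def)
  qed
  have zero: "(\<Prod>j\<in>UNIV - {i}. a $ i - ?l $ j) = 0" using j by (intro prod_zero bexI[where x = j]) auto
  have "1 = (\<Prod>j\<in>UNIV - {i}. a $ i - ?l $ j) / (\<Prod>j\<in>UNIV - {i}. a $ i - a $ j) +
      (\<Sum>m\<in>UNIV - {i}. (\<Prod>j\<in>UNIV - {i}. a $ m - ?l $ j) / (\<Prod>j\<in>UNIV - {m}. a $ m - a $ j))"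
    by (subst lagrange_drop_root[OF inj_axes, where k = i and l = "($) ?l", symmetric], rule sum.remove) auto
  then have "(\<Sum>m\<in>UNIV - {i}. (p $ m)\<^sup>2 / (a $ m - a $ i)) = 1"
    unfolding zero using summand by simp
  with \<open>p $ i = 0\<close> show ?thesis by (simp add: focal_quadric_def)
qed

text \<open>Implicit differentiation of \<open>Q (l s) (p s) (p s) = 1\<close>. Since only
  continuity of \<open>coords\<close> is known so far, difference quotients are used: subtracting
  the equations at \<open>s\<close> and \<open>t\<close> gives
  \<open>(s - t) * V s + (l s - l t) * W s = 0\<close>, where \<open>W\<close> tends to
  \<open>rho\<close> and \<open>V\<close> to \<open>2 * Q (l t) (p t) p'\<close>.\<close>

lemma coords_has_derivative:
  fixes p :: "real \<Rightarrow> (real, 'n) vec"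
  assumes der: "(p has_vector_derivative p') (at t)"
    and U: "open U" "t \<in> U"
    and E: "\<And>s. s \<in> U \<Longrightarrow> p s \<in> E" and nz: "\<And>s i. s \<in> U \<Longrightarrow> p s $ i \<noteq> 0"
  shows "((\<lambda>s. coords (p s) $ k) has_real_derivative
           - 2 * Q (coords (p t) $ k) (p t) p' / rho (p t) (coords (p t) $ k)) (at t)"
proof -
  define l where "l s = coords (p s) $ k" for s
  define W where "W s = (\<Sum>i\<in>UNIV. p t $ i * p t $ i / ((a $ i - l s) * (a $ i - l t)))" for s
  define V where "V s = (\<Sum>i\<in>UNIV. (p s $ i * p s $ i - p t $ i * p t $ i) / (s - t) / (a $ i - l s))" for s
  have evU: "\<forall>\<^sub>F s in at t. s \<in> U"
    using U eventually_at_topological by blast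
  have int: "coords (p s) \<in> coord_interior" and Q1: "Q (l s) (p s) (p s) = 1" if "s \<in> U" for s
    using coords_interior[OF E nz] that by (auto simp: l_def)
  have ne: "a $ i - l s \<noteq> 0" if "s \<in> U" for s i
    using coord_interior_neq[OF int[OF that]] by (simp add: l_def)
  have p_t: "(p \<longlongrightarrow> p t) (at t)"
    using has_vector_derivative_continuous[OF der] by (simp add: isCont_def)
  have "((\<lambda>s. coords (p s)) \<longlongrightarrow> coords (p t)) (at t)"
    by (rule continuous_on_tendsto_compose[OF continuous_on_coords p_t E[OF U(2)]])
      (use evU E in \<open>auto elim: eventually_mono\<close>)
  then have l_t: "(l \<longlongrightarrow> l t) (at t)"
    unfolding l_def by (intro tendsto_intros)
  have comp: "((\<lambda>s. p s $ i) has_real_derivative p' $ i) (at t)" for i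
    using bounded_linear.has_vector_derivative[OF bounded_linear_vec_nth der]
    by (simp add: has_real_derivative_iff_has_vector_derivative)
  have "((\<lambda>s. p s $ i * p s $ i) has_real_derivative 2 * (p t $ i * p' $ i)) (at t)" for i
    by (rule derivative_eq_intros comp refl)+ simp
  then have sq: "((\<lambda>s. (p s $ i * p s $ i - p t $ i * p t $ i) / (s - t)) \<longlongrightarrow> 2 * (p t $ i * p' $ i)) (at t)" for i
    by (simp add: has_field_derivative_iff)
  have "(W \<longlongrightarrow> (\<Sum>i\<in>UNIV. p t $ i * p t $ i / ((a $ i - l t) * (a $ i - l t)))) (at t)"
    unfolding W_def using ne[OF U(2)] by (intro tendsto_intros l_t) auto
  also have "(\<Sum>i\<in>UNIV. p t $ i * p t $ i / ((a $ i - l t) * (a $ i - l t))) = rho (p t) (l t)"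
    by (simp add: rho_def power2_eq_square)
  finally have W: "(W \<longlongrightarrow> rho (p t) (l t)) (at t)" .
  have "(V \<longlongrightarrow> (\<Sum>i\<in>UNIV. 2 * (p t $ i * p' $ i) / (a $ i - l t))) (at t)"
    unfolding V_def using ne[OF U(2)] by (intro tendsto_intros l_t sq) auto
  also have "(\<Sum>i\<in>UNIV. 2 * (p t $ i * p' $ i) / (a $ i - l t)) = 2 * Q (l t) (p t) p'"
    by (simp add: Q_def sum_distrib_left)
  finally have V: "(V \<longlongrightarrow> 2 * Q (l t) (p t) p') (at t)" .
  have rp: "rho (p t) (l t) > 0" by (rule rho_pos[OF Q1[OF U(2)]])
  have "((\<lambda>s. - V s / W s) \<longlongrightarrow> - (2 * Q (l t) (p t) p') / rho (p t) (l t)) (at t)"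
    using rp by (intro tendsto_intros V W) auto
  moreover have "\<forall>\<^sub>F s in at t. - V s / W s = (l s - l t) / (s - t)"
  proof -
    have "\<forall>\<^sub>F s in at t. W s > 0" by (rule order_tendstoD(1)[OF W rp])
    moreover have "\<forall>\<^sub>F s in at t. s \<noteq> t" by (simp add: eventually_at_filter)
    ultimately show ?thesis using evU
    proof eventually_elim
      fix s assume s: "W s > 0" "s \<noteq> t" "s \<in> U"
      have "0 = Q (l s) (p s) (p s) - Q (l t) (p t) (p t)" using Q1 s(3) U(2) by simp
      also have "\<dots> = (s - t) * V s + (l s - l t) * W s"
        unfolding V_def W_def Q_def sum_distrib_left sum_subtractf[symmetric] sum.distrib[symmetric]
      proof (intro sum.cong refl)
        fix i
        show "p s $ i * p s $ i / (a $ i - l s) - p t $ i * p t $ i / (a $ i - l t) =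
          (s - t) * ((p s $ i * p s $ i - p t $ i * p t $ i) / (s - t) / (a $ i - l s)) +
          (l s - l t) * (p t $ i * p t $ i / ((a $ i - l s) * (a $ i - l t)))"
          using ne[OF s(3), of i] ne[OF U(2), of i] s(2) by (simp add: divide_simps) (simp add: algebra_simps)
      qed
      finally show "- V s / W s = (l s - l t) / (s - t)"
        using s by (simp add: field_simps)
    qed
  qed
  ultimately have "((\<lambda>s. (l s - l t) / (s - t)) \<longlongrightarrow> - (2 * Q (l t) (p t) p') / rho (p t) (l t)) (at t)"
    by (rule Lim_transform_eventually)
  then show ?thesis by (simp add: has_field_derivative_iff l_def)
qed

text \<open>Logarithmic differentiation of the product formula for a squared coordinate gives the
  factor -1/2 and the denominators \<open>a $ i - l t $ k\<close>. So the coordinate directions are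
  those of the normals \<open>xi\<close>.\<close>

lemma point_has_derivative:
  fixes l :: "real \<Rightarrow> (real, 'n) vec"
  assumes der: "\<And>k. ((\<lambda>s. l s $ k) has_real_derivative d k) (at t)" and int: "l t \<in> coord_interior"
  shows "((\<lambda>s. point (l s)) has_vector_derivative
           (- 1/2) *\<^sub>R (\<Sum>k\<in>UNIV. d k *\<^sub>R xi (point (l t)) (l t $ k))) (at t)"
proof -
  have comp: "((\<lambda>s. point (l s) $ i) has_real_derivative
      (- 1/2) * (\<Sum>k\<in>UNIV. d k * (point (l t) $ i / (a $ i - l t $ k)))) (at t)" for i
  proof -
    let ?c = "\<Prod>j\<in>UNIV - {i}. a $ i - a $ j"
    have pos: "0 < coord_sq (l t) i" by (rule coord_sq_pos[OF int])
    have "((\<lambda>s. \<Prod>j\<in>UNIV. a $ i - l s $ j) has_real_derivative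
        (\<Sum>k\<in>UNIV. (0 - d k) * (\<Prod>j\<in>UNIV - {k}. a $ i - l t $ j))) (at t)"
      by (intro has_field_derivative_prod derivative_intros der)
    then have "((\<lambda>s. coord_sq (l s) i) has_real_derivative
        (\<Sum>k\<in>UNIV. (0 - d k) * (\<Prod>j\<in>UNIV - {k}. a $ i - l t $ j)) / ?c) (at t)"
      unfolding coord_sq_def by (rule DERIV_cdivide)
    also have "(\<Sum>k\<in>UNIV. (0 - d k) * (\<Prod>j\<in>UNIV - {k}. a $ i - l t $ j)) / ?c =
       - coord_sq (l t) i * (\<Sum>k\<in>UNIV. d k / (a $ i - l t $ k))"
      unfolding sum_divide_distrib sum_distrib_left
    proof (intro sum.cong refl)
      fix k
      have "a $ i - l t $ k \<noteq> 0" using coord_interior_neq[OF int] by simp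
      moreover have "(\<Prod>j\<in>UNIV. a $ i - l t $ j) = (a $ i - l t $ k) * (\<Prod>j\<in>UNIV - {k}. a $ i - l t $ j)"
        by (rule prod.remove) auto
      ultimately show "(0 - d k) * (\<Prod>j\<in>UNIV - {k}. a $ i - l t $ j) / ?c = - coord_sq (l t) i * (d k / (a $ i - l t $ k))"
        by (simp add: coord_sq_def)
    qed
    finally have "((\<lambda>s. sqrt (coord_sq (l s) i)) has_real_derivative
        - coord_sq (l t) i * (\<Sum>k\<in>UNIV. d k / (a $ i - l t $ k)) * (inverse (sqrt (coord_sq (l t) i)) / 2)) (at t)"
      using pos by (auto intro!: derivative_eq_intros)
    moreover have "- coord_sq (l t) i * S * (inverse (sqrt (coord_sq (l t) i)) / 2) = (- 1/2) * (sqrt (coord_sq (l t) i) * S)" for S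
    proof -
      have "coord_sq (l t) i * inverse (sqrt (coord_sq (l t) i)) = sqrt (coord_sq (l t) i)"
        using pos by (metis divide_inverse less_imp_le real_div_sqrt)
      moreover have "- coord_sq (l t) i * S * (inverse (sqrt (coord_sq (l t) i)) / 2) =
          (- 1/2) * (coord_sq (l t) i * inverse (sqrt (coord_sq (l t) i)) * S)" by simp
      ultimately show ?thesis by (simp only:)
    qed
    ultimately have "((\<lambda>s. sqrt (coord_sq (l s) i)) has_real_derivative
        (- 1/2) * (sqrt (coord_sq (l t) i) * (\<Sum>k\<in>UNIV. d k / (a $ i - l t $ k)))) (at t)"
      by (simp only:)
    then show ?thesis by (simp add: sum_distrib_left mult_ac)
  qed
  show ?thesis
    unfolding has_vector_derivative_def
  proof (subst has_derivative_componentwise_within, intro ballI)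
    fix b :: "(real, 'n) vec" assume "b \<in> Basis"
    then obtain i where b: "b = axis i 1" by (auto simp: Basis_vec_def)
    show "((\<lambda>s. point (l s) \<bullet> b) has_derivative
        (\<lambda>x. (x *\<^sub>R (- 1 / 2) *\<^sub>R (\<Sum>k\<in>UNIV. d k *\<^sub>R xi (point (l t)) (l t $ k))) \<bullet> b)) (at t)"
    proof -
      have eq: "(\<lambda>x. (x *\<^sub>R (- 1 / 2) *\<^sub>R (\<Sum>k\<in>UNIV. d k *\<^sub>R xi (point (l t)) (l t $ k))) \<bullet> b) =
          (*) ((- 1/2) * (\<Sum>k\<in>UNIV. d k * (point (l t) $ i / (a $ i - l t $ k))))"
        by (rule ext) (simp add: b inner_axis xi_def)
      show ?thesis
        using comp[of i] unfolding has_field_derivative_def eq by (simp add: b inner_axis)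
    qed
  qed
qed

section \<open>The intrinsic metric of the ellipsoid\<close>

abbreviation gd :: "(real, 'n) vec \<Rightarrow> (real, 'n) vec \<Rightarrow> real" where
  "gd \<equiv> geodesic_dist E"

lemma Q_add_right: "Q t x (y + z) = Q t x y + Q t x z"
  by (simp add: Q_eq_inner inner_add_right)

lemma Q_add_left: "Q t (y + z) x = Q t y x + Q t z x"
  using Q_add_right Q_commute by metis

lemma Q_diff_right: "Q t x (y - z) = Q t x y - Q t x z"
  by (simp add: Q_eq_inner inner_diff_right)

lemma Q_diff_left: "Q t (y - z) x = Q t y x - Q t z x"
  using Q_diff_right Q_commute by metis

lemma Q_scaleR_right: "Q t x (c *\<^sub>R y) = c * Q t x y"
  by (simp add: Q_eq_inner)

lemma Q_scaleR_left: "Q t (c *\<^sub>R x) y = c * Q t x y"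
  using Q_scaleR_right Q_commute by metis

lemmas Q_linear = Q_add_right Q_add_left Q_diff_right Q_diff_left Q_scaleR_right Q_scaleR_left

section \<open>Central arcs and their lengths\<close>

lemma Q0_le_norm: "amin * Q 0 v v \<le> (norm v)\<^sup>2"
proof -
  have "amin * Q 0 v v = (\<Sum>i\<in>UNIV. (amin / a $ i) * (v $ i * v $ i))"
    by (simp add: Q_def sum_distrib_left)
  also have "\<dots> \<le> (\<Sum>i\<in>UNIV. 1 * (v $ i * v $ i))"
    using axes_pos axes_mono[OF le_top_index] by (intro sum_mono mult_right_mono) auto
  finally show ?thesis
    by (simp add: norm_vec_def L2_set_def sum_nonneg power2_eq_square)
qed

lemma Q0_nonneg: "0 \<le> Q 0 v v"
  using Q0_pos[of v] by (cases "v = 0") (auto simp: Q_def)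

lemma Q0_segment:
  assumes "p \<in> E" "q \<in> E"
  shows "Q 0 ((1 - t) *\<^sub>R p + t *\<^sub>R q) ((1 - t) *\<^sub>R p + t *\<^sub>R q) = 1 - t * (1 - t) * Q 0 (q - p) (q - p)"
    and "Q 0 ((1 - t) *\<^sub>R p + t *\<^sub>R q) (q - p) = (t - 1/2) * Q 0 (q - p) (q - p)"
  using assms by (simp_all add: E_iff Q_linear Q_commute[of 0 q p] algebra_simps)

definition arc_deriv :: "(real, 'n) vec \<Rightarrow> (real, 'n) vec \<Rightarrow> real \<Rightarrow> (real, 'n) vec" where
  "arc_deriv p q t = (let r = (1 - t) *\<^sub>R p + t *\<^sub>R q; n = sqrt (Q 0 r r) in
     (1 / n) *\<^sub>R (q - p) - (Q 0 r (q - p) / n ^ 3) *\<^sub>R r)"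

text \<open>The chord pushed radially onto the ellipsoid, an arc of a plane section through the
  center. Such explicit arcs stand in for short geodesics: their length exceeds the chord only to
  second order.\<close>

definition arc :: "(real, 'n) vec \<Rightarrow> (real, 'n) vec \<Rightarrow> real \<Rightarrow> (real, 'n) vec" where
  "arc p q t = proj ((1 - t) *\<^sub>R p + t *\<^sub>R q)"

lemma arc_has_derivative:
  assumes "(1 - t) *\<^sub>R p + t *\<^sub>R q \<noteq> 0"
  shows "(arc p q has_vector_derivative arc_deriv p q t) (at t)"
proof -
  define r where "r s = (1 - s) *\<^sub>R p + s *\<^sub>R q" for s
  define g where "g s = Q 0 (r s) (r s)" for s
  have pos: "0 < g t" unfolding g_def r_def by (rule Q0_pos[OF assms])
  have r': "(r has_vector_derivative (q - p)) (at t)"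
    unfolding r_def by (auto intro!: derivative_eq_intros)
  have ri: "((\<lambda>s. r s $ i) has_real_derivative (q - p) $ i) (at t)" for i
    using bounded_linear.has_vector_derivative[OF bounded_linear_vec_nth r']
    by (simp add: has_real_derivative_iff_has_vector_derivative)
  have "((\<lambda>s. \<Sum>i\<in>UNIV. r s $ i * r s $ i / (a $ i - 0)) has_real_derivative
     (\<Sum>i\<in>UNIV. ((q - p) $ i * r t $ i + (q - p) $ i * r t $ i) / (a $ i - 0))) (at t)"
    by (intro DERIV_sum DERIV_cdivide DERIV_mult ri)
  then have g': "(g has_real_derivative 2 * Q 0 (r t) (q - p)) (at t)"
    unfolding g_def Q_def sum_distrib_left by (simp add: mult_ac)
  have sq: "sqrt (g t) > 0" using pos by simp
  have "((\<lambda>s. 1 / sqrt (g s)) has_real_derivative - (Q 0 (r t) (q - p) / sqrt (g t) ^ 3)) (at t)"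
    using pos sq by (auto intro!: derivative_eq_intros g' simp: field_simps power3_eq_cube)
  from has_vector_derivative_scaleR[OF this r']
  show ?thesis
    unfolding arc_def[abs_def] proj_def arc_deriv_def Let_def g_def r_def by simp
qed

lemma continuous_arc_deriv:
  assumes "\<And>t. t \<in> S \<Longrightarrow> (1 - t) *\<^sub>R p + t *\<^sub>R q \<noteq> 0"
  shows "continuous_on S (arc_deriv p q)"
proof -
  have "Q 0 ((1 - t) *\<^sub>R p + t *\<^sub>R q) ((1 - t) *\<^sub>R p + t *\<^sub>R q) > 0" if "t \<in> S" for t
    by (rule Q0_pos[OF assms[OF that]])
  moreover have cQ: "continuous_on S (\<lambda>t. Q 0 (f t) (g t))" if "continuous_on S f" "continuous_on S g" for f g
    unfolding Q_def using that by (intro continuous_intros) (auto simp: axes_pos less_imp_neq[symmetric])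
  ultimately show ?thesis
    unfolding arc_deriv_def Let_def by (intro continuous_intros cQ) force+
qed

lemma arc_ends: "p \<in> E \<Longrightarrow> arc p q 0 = p" "q \<in> E \<Longrightarrow> arc p q 1 = q"
  by (simp_all add: arc_def proj_E)

lemma curve_lengths_arc:
  assumes p: "p \<in> E" and q: "q \<in> E" and nz: "\<And>t. t \<in> {0..1} \<Longrightarrow> (1 - t) *\<^sub>R p + t *\<^sub>R q \<noteq> 0"
  shows "integral {0..1} (\<lambda>t. norm (arc_deriv p q t)) \<in> curve_lengths E p q"
  unfolding curve_lengths_iff
proof (rule exI[of _ "arc p q"], rule exI[of _ "arc_deriv p q"], rule exI[of _ "{}"], intro conjI ballI)
  show der: "(arc p q has_vector_derivative arc_deriv p q t) (at t)" if "t \<in> {0..1} - {}" for t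
    using that by (intro arc_has_derivative nz) auto
  show "continuous_on {0..1} (arc p q)"
    by (intro continuous_at_imp_continuous_on ballI has_vector_derivative_continuous[OF der]) auto
  show "arc p q ` {0..1} \<subseteq> E" using nz by (auto simp: arc_def proj_in_E)
  have c: "continuous_on {0..1} (arc_deriv p q)" by (rule continuous_arc_deriv[OF nz])
  then show "continuous_on ({0..1} - {}) (arc_deriv p q)" by simp
  show "((\<lambda>t. norm (arc_deriv p q t)) has_integral integral {0..1} (\<lambda>t. norm (arc_deriv p q t))) {0..1}"
    by (intro integrable_integral integrable_continuous_real continuous_intros c)
qed (use p q in \<open>auto simp: arc_ends\<close>)

text \<open>If the chord meets the center, \<open>Q0_segment\<close> forces this to happen at its
  midpoint, so the ends are antipodal.\<close>

lemma segment_nonzero: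
  assumes "p \<in> E" "q \<in> E" "q \<noteq> - p" "t \<in> {0..1}"
  shows "(1 - t) *\<^sub>R p + t *\<^sub>R q \<noteq> 0"
proof
  assume eq: "(1 - t) *\<^sub>R p + t *\<^sub>R q = 0"
  then have "0 = Q 0 ((1 - t) *\<^sub>R p + t *\<^sub>R q) (q - p)" "0 = Q 0 ((1 - t) *\<^sub>R p + t *\<^sub>R q) ((1 - t) *\<^sub>R p + t *\<^sub>R q)"
    by (simp_all add: Q_def)
  then have "(t - 1/2) * Q 0 (q - p) (q - p) = 0" "t * (1 - t) * Q 0 (q - p) (q - p) = 1"
    using Q0_segment[OF assms(1,2), of t] by simp_all
  then have "t = 1/2" by auto
  with eq have "(1/2) *\<^sub>R (p + q) = 0" by (simp add: scaleR_add_right)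
  then show False using assms(3) by (simp add: eq_neg_iff_add_eq_0 add.commute)
qed

text \<open>The second condition gives \<open>Q 0 (q - p) (q - p) \<le> 1\<close>, which keeps the
  chord away from the center; the first lets third powers of the distance be absorbed in
  squares.\<close>

definition short :: "(real, 'n) vec \<Rightarrow> (real, 'n) vec \<Rightarrow> bool" where
  "short p q \<longleftrightarrow> norm (q - p) \<le> 1 \<and> (norm (q - p))\<^sup>2 \<le> amin"

text \<open>With chord length e, \<open>D \<le> e\<^sup>2 / amin\<close> and
  \<open>R = sqrt amax\<close> bounding the points of the chord, the speed of the arc is at most
  \<open>e + e * D + D * R\<close>. Its excess over e is at most this constant times
  \<open>e\<^sup>2\<close> for \<open>e \<le> 1\<close>.\<close>

definition arc_const :: real where
  "arc_const = (1 + sqrt (amax)) / amin"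

lemma arc_const_pos: "0 < arc_const"
  unfolding arc_const_def using axes_pos by (intro divide_pos_pos add_pos_nonneg) (auto simp: less_imp_le)

lemma arc_deriv_short:
  assumes p: "p \<in> E" and q: "q \<in> E" and sh: "short p q" and t: "t \<in> {0..1}"
  shows "(1 - t) *\<^sub>R p + t *\<^sub>R q \<noteq> 0"
    and "norm (arc_deriv p q t) \<le> norm (q - p) * (1 + arc_const * norm (q - p))"
proof -
  define r where "r = (1 - t) *\<^sub>R p + t *\<^sub>R q"
  define D where "D = Q 0 (q - p) (q - p)"
  define n where "n = sqrt (Q 0 r r)"
  define R where "R = sqrt (amax)"
  define e where "e = norm (q - p)"
  have top: "0 < amin" by (rule axes_pos)
  have e: "0 \<le> e" "e \<le> 1" "e\<^sup>2 \<le> amin" using sh by (auto simp: e_def short_def)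
  have D0: "0 \<le> D" unfolding D_def by (rule Q0_nonneg)
  have Dle: "D \<le> e\<^sup>2 / amin"
    using Q0_le_norm[of "q - p"] top by (simp add: D_def e_def pos_le_divide_eq mult.commute)
  also have "\<dots> \<le> 1" using e top by simp
  finally have D1: "D \<le> 1" .
  have tt: "t * (1 - t) \<le> 1/4" "0 \<le> t * (1 - t)"
  proof -
    have "0 \<le> (t - 1/2)\<^sup>2" by simp
    then show "t * (1 - t) \<le> 1/4" by (simp add: power2_eq_square algebra_simps)
    show "0 \<le> t * (1 - t)" using t by simp
  qed
  have "t * (1 - t) * D \<le> 1/4 * D" using D0 tt by (intro mult_right_mono)
  then have Qr: "1 - D / 4 \<le> Q 0 r r" "Q 0 r r \<le> 1"
    using Q0_segment(1)[OF p q, of t] D0 tt by (auto simp: r_def D_def)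
  then show "(1 - t) *\<^sub>R p + t *\<^sub>R q \<noteq> 0"
    using D1 unfolding r_def[symmetric] by (auto simp: Q_def)
  have n0: "0 < n" and n1: "n \<le> 1" using Qr D1 by (auto simp: n_def)
  have n2: "n\<^sup>2 = Q 0 r r" using Qr D1 by (simp add: n_def)
  have "n\<^sup>2 \<le> n" using n0 n1 by (simp add: power2_eq_square mult_left_le)
  then have nge: "1 - D / 4 \<le> n" using Qr n2 by linarith
  have i1: "1 / n \<le> 1 + D"
  proof -
    have "D * D \<le> D" using D0 D1 by (simp add: mult_left_le)
    then have "1 \<le> (1 + D) * (1 - D / 4)" using D0 D1 by (simp add: algebra_simps)
    also have "\<dots> \<le> (1 + D) * n" using nge D0 by (intro mult_left_mono) auto
    finally show ?thesis using n0 by (simp add: field_simps)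
  qed
  have i3: "1 / n ^ 3 \<le> 2"
  proof -
    \<comment> \<open>Both factors on the right are at least \<open>1 - D / 4\<close>, hence at
      least 3/4; thus \<open>1 / n ^ 3 \<le> 16 / 9\<close>.\<close>
    have "(3/4) * (3/4) \<le> n\<^sup>2 * n"
      using nge n2 Qr D1 by (intro mult_mono) auto
    also have "n\<^sup>2 * n = n ^ 3" by (simp add: power2_eq_square power3_eq_cube)
    finally show ?thesis using n0 by (simp add: field_simps)
  qed
  have Rp: "norm p \<le> R" "norm q \<le> R" "0 \<le> R"
    using E_norm_le[OF p] E_norm_le[OF q] unfolding R_def by (auto intro: real_le_rsqrt less_imp_le axes_pos)
  have "norm r \<le> (1 - t) * norm p + t * norm q"
    unfolding r_def using t by (intro order_trans[OF norm_triangle_ineq]) auto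
  also have "\<dots> \<le> (1 - t) * R + t * R"
    using t Rp by (intro add_mono mult_left_mono) auto
  finally have rR: "norm r \<le> R" by (simp add: algebra_simps)
  have "\<bar>Q 0 r (q - p)\<bar> = \<bar>t - 1/2\<bar> * D"
    using Q0_segment(2)[OF p q, of t] D0 by (simp add: r_def D_def abs_mult)
  also have "\<dots> \<le> 1/2 * D" using t D0 by (intro mult_right_mono) (auto simp: abs_if)
  finally have Qd: "\<bar>Q 0 r (q - p)\<bar> \<le> D / 2" by simp
  have "norm (arc_deriv p q t) \<le> 1 / n * e + \<bar>Q 0 r (q - p)\<bar> * (1 / n ^ 3) * norm r"
    unfolding arc_deriv_def Let_def r_def[symmetric] n_def[symmetric]
    by (rule order_trans[OF norm_triangle_ineq4]) (use n0 in \<open>simp add: e_def\<close>)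
  also have "\<dots> \<le> (1 + D) * e + (D / 2) * 2 * R"
    using i1 i3 Qd rR n0 e Rp D0 by (intro add_mono mult_mono) auto
  also have "\<dots> = e + (e * D + D * R)" by (simp add: algebra_simps)
  also have "\<dots> \<le> e + (1 * (e\<^sup>2 / amin) + (e\<^sup>2 / amin) * R)"
    using e D0 Dle Rp by (intro add_mono mult_mono order_refl) auto
  also have "\<dots> = e * (1 + arc_const * e)"
    unfolding arc_const_def R_def[symmetric] using top by (simp add: field_simps power2_eq_square)
  finally show "norm (arc_deriv p q t) \<le> norm (q - p) * (1 + arc_const * norm (q - p))"
    by (simp add: e_def)
qed

lemma gd_short_le:
  assumes "p \<in> E" "q \<in> E" "short p q"
  shows "gd p q \<le> norm (q - p) * (1 + arc_const * norm (q - p))"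
proof -
  have "integral {0..1} (\<lambda>t. norm (arc_deriv p q t)) \<le>
      integral {0..1::real} (\<lambda>t. norm (q - p) * (1 + arc_const * norm (q - p)))"
    using arc_deriv_short[OF assms]
    by (intro integral_le integrable_continuous_real continuous_intros continuous_arc_deriv) auto
  then have "integral {0..1} (\<lambda>t. norm (arc_deriv p q t)) \<le> norm (q - p) * (1 + arc_const * norm (q - p))"
    by simp
  moreover have "gd p q \<le> integral {0..1} (\<lambda>t. norm (arc_deriv p q t))"
    by (intro geodesic_dist_le curve_lengths_arc assms arc_deriv_short(1)[OF assms])
  ultimately show ?thesis by linarith
qed

section \<open>Reflections in the coordinate hyperplanes\<close>

definition reflect :: "(real, 'n) vec \<Rightarrow> (real, 'n) vec \<Rightarrow> (real, 'n) vec" where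
  "reflect s x = (\<chi> i. s $ i * x $ i)"

definition signs :: "(real, 'n) vec set" where
  "signs = {s. \<forall>i. \<bar>s $ i\<bar> = 1}"

lemma reflect_nth [simp]: "reflect s x $ i = s $ i * x $ i"
  by (simp add: reflect_def)

lemma signs_sq: "s \<in> signs \<Longrightarrow> s $ i * s $ i = 1"
  using abs_mult_self_eq[of "s $ i"] by (simp add: signs_def)

lemma reflect_reflect: "s \<in> signs \<Longrightarrow> reflect s (reflect s x) = x"
  by (simp add: vec_eq_iff signs_sq mult.assoc[symmetric])

lemma Q_reflect: "s \<in> signs \<Longrightarrow> Q t (reflect s x) (reflect s y) = Q t x y"
proof -
  assume s: "s \<in> signs"
  have "s $ i * x $ i * (s $ i * y $ i) = x $ i * y $ i" for i
  proof -
    have "s $ i * x $ i * (s $ i * y $ i) = (s $ i * s $ i) * (x $ i * y $ i)" by (simp only: mult_ac)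
    then show ?thesis by (simp add: signs_sq[OF s])
  qed
  then show ?thesis unfolding Q_def reflect_nth by (simp only:)
qed

lemma reflect_in_E: "s \<in> signs \<Longrightarrow> x \<in> E \<Longrightarrow> reflect s x \<in> E"
  by (simp add: E_iff Q_reflect)

lemma bounded_linear_reflect: "bounded_linear (reflect s)"
  by (auto intro!: linear_conv_bounded_linear[THEN iffD1] linearI simp: vec_eq_iff algebra_simps)

lemma norm_reflect: "s \<in> signs \<Longrightarrow> norm (reflect s x) = norm x"
  by (simp add: norm_vec_def L2_set_def signs_def power_mult_distrib)
    (metis (no_types, lifting) mult_1 one_power2 power2_abs)

lemma gd_reflect:
  assumes "s \<in> signs"
  shows "gd (reflect s x) (reflect s y) = gd x y"
proof -
  have 1: "curve_lengths E x y \<subseteq> curve_lengths E (reflect s x) (reflect s y)" for x y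
    using curve_lengths_linear_isometry[OF bounded_linear_reflect norm_reflect[OF assms]]
      reflect_in_E[OF assms] by blast
  have "curve_lengths E (reflect s x) (reflect s y) = curve_lengths E x y"
    using 1[of x y] 1[of "reflect s x" "reflect s y"] by (auto simp: reflect_reflect[OF assms])
  then show ?thesis by (simp add: geodesic_dist_eq_Inf)
qed

lemma compact_E: "compact E"
proof -
  have "continuous_on UNIV (\<lambda>x. Q 0 x x)"
    unfolding Q_def by (intro continuous_intros) (auto simp: axes_pos less_imp_neq[symmetric])
  then have "closed {x. Q 0 x x = 1}"
    by (intro closed_Collect_eq continuous_on_const)
  moreover have "{x. Q 0 x x = 1} = E" using E_iff by auto
  moreover have "bounded E"
    using E_norm_le by (auto simp: bounded_iff intro: real_le_rsqrt)
  ultimately show ?thesis by (simp add: compact_eq_bounded_closed)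
qed

end

text \<open>For n = 1 the ellipsoid is a pair of points that no curve joins. From n = 2 on,
  \<open>geodesic_dist\<close> is an infimum over a nonempty set.\<close>

locale confocal_proper = confocal a for a :: "real ^ 'n::{finite,linorder}" +
  assumes dim: "\<exists>i j. (i :: 'n) \<noteq> j"
begin

lemma curve_lengths_E_nonempty:
  assumes "x \<in> E" "y \<in> E"
  shows "curve_lengths E x y \<noteq> {}"
proof -
  have direct: "curve_lengths E p q \<noteq> {}" if "p \<in> E" "q \<in> E" "q \<noteq> - p" for p q
    using curve_lengths_arc[OF that(1,2) segment_nonzero[OF that]] by blast
  show ?thesis
  proof (cases "y = - x")
    case False then show ?thesis using direct assms by blast
  next
    case True
    obtain i j :: 'n where ij: "i \<noteq> j" using dim by blast
    define r where "r k = proj (axis k 1)" for k :: 'n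
    have ax: "axis k (1::real) \<noteq> (0 :: (real, 'n) vec)" for k by simp
    have rE: "r k \<in> E" for k unfolding r_def by (rule proj_in_E[OF ax])
    have rk: "r k $ k > 0" "m \<noteq> k \<Longrightarrow> r k $ m = 0" for k m
      using Q0_pos[OF ax] by (auto simp: r_def proj_def axis_def)
    have "\<exists>z\<in>E. z \<noteq> x \<and> z \<noteq> - x"
    proof (rule ccontr)
      assume "\<not> ?thesis"
      then have "r i = x \<or> r i = - x" "r j = x \<or> r j = - x" using rE by auto
      then have "r i = r j \<or> r i = - r j" by auto
      then have "r i $ i = r j $ i \<or> r i $ i = - (r j $ i)" by auto
      then show False using rk(1)[of i] rk(2)[of i j] ij by auto
    qed
    then obtain z where z: "z \<in> E" "z \<noteq> x" "z \<noteq> - x" by blast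
    obtain l where l: "l \<in> curve_lengths E x z" using direct[of x z] z assms by blast
    have "y \<noteq> - z" using z True by auto
    then obtain m where "m \<in> curve_lengths E z y" using direct[of z y] z assms by blast
    with l show ?thesis using curve_lengths_join by blast
  qed
qed

lemma gd_nonneg: "x \<in> E \<Longrightarrow> y \<in> E \<Longrightarrow> 0 \<le> gd x y"
  by (intro geodesic_dist_nonneg curve_lengths_E_nonempty)

lemma gd_triangle: "x \<in> E \<Longrightarrow> y \<in> E \<Longrightarrow> z \<in> E \<Longrightarrow> gd x z \<le> gd x y + gd y z"
  by (intro geodesic_dist_triangle curve_lengths_E_nonempty)

lemma gd_refl: "x \<in> E \<Longrightarrow> gd x x = 0"
  using gd_short_le[of x x] gd_nonneg[of x x] axes_pos[of top_index]
  by (simp add: short_def less_imp_le)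

lemma gd_chain:
  assumes "\<And>k. k \<le> N \<Longrightarrow> z k \<in> E"
  shows "gd (z 0) (z N) \<le> (\<Sum>k<N. gd (z k) (z (Suc k)))"
  using assms
proof (induction N)
  case 0 then show ?case by (simp add: gd_refl)
next
  case (Suc N)
  then have "gd (z 0) (z N) \<le> (\<Sum>k<N. gd (z k) (z (Suc k)))" by simp
  moreover have "gd (z 0) (z (Suc N)) \<le> gd (z 0) (z N) + gd (z N) (z (Suc N))"
    using Suc.prems by (intro gd_triangle) auto
  ultimately show ?case by simp
qed

lemma continuous_on_gd: "continuous_on (E \<times> E) (\<lambda>(x, y). gd x y)"
proof -
  have small: "\<exists>\<delta>>0. \<forall>x\<in>E. \<forall>y\<in>E. norm (y - x) < \<delta> \<longrightarrow> gd x y < e" if "0 < e" for e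
  proof -
    define \<delta> where "\<delta> = Min {1, sqrt (amin), e / (1 + arc_const)}"
    have pos: "0 < \<delta>" unfolding \<delta>_def using axes_pos arc_const_pos that by (auto simp: add_pos_pos)
    have "gd x y < e" if xy: "x \<in> E" "y \<in> E" "norm (y - x) < \<delta>" for x y
    proof -
      let ?n = "norm (y - x)"
      have n: "?n \<le> 1" "?n \<le> sqrt (amin)" "?n < e / (1 + arc_const)"
        using xy(3) by (auto simp: \<delta>_def)
      have "?n\<^sup>2 \<le> amin"
        using n(2) axes_pos[of top_index] power_mono[OF n(2), of 2] by (simp add: less_imp_le)
      then have "gd x y \<le> ?n * (1 + arc_const * ?n)"
        using n by (intro gd_short_le xy) (auto simp: short_def)
      also have "\<dots> \<le> ?n * (1 + arc_const * 1)"
        using n arc_const_pos by (intro mult_left_mono add_left_mono) auto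
      also have "\<dots> < e" using n(3) arc_const_pos by (simp add: field_simps)
      finally show ?thesis .
    qed
    with pos show ?thesis by blast
  qed
  show ?thesis
    unfolding continuous_on_iff
  proof (intro ballI allI impI)
    fix z and e :: real assume "z \<in> E \<times> E" and e: "0 < e"
    then obtain x y where z: "z = (x, y)" and xy: "x \<in> E" "y \<in> E" by auto
    obtain \<delta> where \<delta>: "0 < \<delta>" "\<And>x y. x \<in> E \<Longrightarrow> y \<in> E \<Longrightarrow> norm (y - x) < \<delta> \<Longrightarrow> gd x y < e / 2"
      using small[of "e/2"] e by auto
    have "dist (case (u, v) of (x, y) \<Rightarrow> gd x y) (case (x, y) of (x, y) \<Rightarrow> gd x y) < e"
      if uv: "u \<in> E" "v \<in> E" and d: "dist (u, v) (x, y) < \<delta>" for u v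
    proof -
      have n: "norm (u - x) < \<delta>" "norm (v - y) < \<delta>"
        using d dist_fst_le[of "(u, v)" "(x, y)"] dist_snd_le[of "(u, v)" "(x, y)"] by (auto simp: dist_norm)
      have s: "gd u x < e/2" "gd x u < e/2" "gd v y < e/2" "gd y v < e/2"
        using \<delta>(2)[of u x] \<delta>(2)[of x u] \<delta>(2)[of v y] \<delta>(2)[of y v] n xy uv
        by (simp_all add: norm_minus_commute)
      have "gd u v \<le> gd u x + (gd x y + gd y v)" "gd x y \<le> gd x u + (gd u v + gd v y)"
        using gd_triangle[of u x v] gd_triangle[of x y v] gd_triangle[of x u y] gd_triangle[of u v y] xy uv by auto
      then show ?thesis using s by (simp add: dist_real_def)
    qed
    then show "\<exists>d>0. \<forall>x'\<in>E \<times> E. dist x' z < d \<longrightarrow>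
        dist (case x' of (x, y) \<Rightarrow> gd x y) (case z of (x, y) \<Rightarrow> gd x y) < e"
      unfolding z using \<delta>(1) by (intro exI[of _ \<delta>]) auto
  qed
qed

lemma continuous_on_gd_compose:
  assumes "continuous_on S f" "continuous_on S g" "f ` S \<subseteq> E" "g ` S \<subseteq> E"
  shows "continuous_on S (\<lambda>t. gd (f t) (g t))"
proof -
  have "continuous_on S (\<lambda>t. case (f t, g t) of (x, y) \<Rightarrow> gd x y)"
    using assms by (intro continuous_on_compose2[OF continuous_on_gd] continuous_on_Pair) auto
  then show ?thesis by simp
qed

lemma gd_bounded: "\<exists>R>0. \<forall>x\<in>E. \<forall>y\<in>E. gd x y \<le> R"
proof -
  have "compact ((\<lambda>(x, y). gd x y) ` (E \<times> E))"
    by (intro compact_continuous_image continuous_on_gd compact_Times compact_E)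
  then have "bounded ((\<lambda>(x, y). gd x y) ` (E \<times> E))" by (rule compact_imp_bounded)
  then obtain R where "0 < R" "\<forall>z\<in>(\<lambda>(x, y). gd x y) ` (E \<times> E). norm z \<le> R"
    unfolding bounded_pos by blast
  then show ?thesis by (intro exI[of _ R]) force
qed

end

section \<open>Discrete geodesics\<close>

lemma telescope_bound:
  fixes f g :: "nat \<Rightarrow> real"
  assumes "\<And>k. Suc k < N \<Longrightarrow> \<bar>f (Suc k) - f k\<bar> \<le> g (Suc k)" "\<And>k. 0 \<le> g k" "i < N" "j < N"
  shows "\<bar>f j - f i\<bar> \<le> (\<Sum>k\<in>{1..<N}. g k)"
proof -
  have *: "\<bar>f j - f i\<bar> \<le> (\<Sum>k\<in>{i<..j}. g k)" if "i \<le> j" "j < N" for i j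
    using that
  proof (induction j)
    case (Suc j)
    show ?case
    proof (cases "i = Suc j")
      case False
      then have ij: "i \<le> j" "j < N" using Suc.prems by auto
      have "{i<..Suc j} = insert (Suc j) {i<..j}" using ij by auto
      then show ?thesis using Suc.IH[OF ij] assms(1)[of j] Suc.prems by simp
    qed simp
  qed simp
  have sub: "(\<Sum>k\<in>{i<..j}. g k) \<le> (\<Sum>k\<in>{1..<N}. g k)" if "j < N" for i j
    using that assms(2) by (intro sum_mono2) auto
  show ?thesis
    using *[of i j] *[of j i] sub[of j i] sub[of i j] assms(3,4)
    by (cases "i \<le> j") (auto simp: abs_minus_commute intro: order_trans)
qed

section \<open>Chains of minimal energy and the integrals of Jacobi\<close>

context confocal
begin

text \<open>All indices are constrained, although only those up to \<open>N\<close> enter the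
  energy: the set is then a product of compact sets, and Tychonoff's theorem yields a
  minimizer.\<close>

definition chains :: "nat \<Rightarrow> (real, 'n) vec \<Rightarrow> (real, 'n) vec \<Rightarrow> (nat \<Rightarrow> (real, 'n) vec) set" where
  "chains N x y = {z. z 0 = x \<and> z N = y \<and> (\<forall>k. z k \<in> E)}"

text \<open>The Dirichlet energy of the polygon traversed in unit time with steps of duration 1/N;
  by Cauchy-Schwarz it is at least the squared length of the polygon.\<close>

definition energy :: "nat \<Rightarrow> (nat \<Rightarrow> (real, 'n) vec) \<Rightarrow> real" where
  "energy N z = real N * (\<Sum>k<N. (norm (z (Suc k) - z k))\<^sup>2)"

definition min_energy :: "nat \<Rightarrow> (real, 'n) vec \<Rightarrow> (real, 'n) vec \<Rightarrow> real" where
  "min_energy N x y = Inf (energy N ` chains N x y)"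

lemma energy_nonneg: "0 \<le> energy N z"
  unfolding energy_def by (intro mult_nonneg_nonneg sum_nonneg) auto

lemma min_energy_le: "z \<in> chains N x y \<Longrightarrow> min_energy N x y \<le> energy N z"
  unfolding min_energy_def by (intro cInf_lower) (auto intro!: bdd_belowI[of _ 0] energy_nonneg)

lemma min_chain_exists:
  assumes "x \<in> E" "y \<in> E" "0 < N"
  shows "\<exists>z\<in>chains N x y. energy N z = min_energy N x y"
proof -
  define F where "F k = (if k = 0 then {x} else if k = N then {y} else E)" for k
  have eq: "chains N x y = Pi\<^sub>E UNIV F"
  proof (intro set_eqI iffI)
    fix z assume "z \<in> chains N x y"
    then show "z \<in> Pi\<^sub>E UNIV F" by (auto simp: chains_def F_def PiE_iff)
  next
    fix z assume z: "z \<in> Pi\<^sub>E UNIV F"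
    have zF: "z k \<in> F k" for k using z by (auto simp: PiE_iff)
    have "F k \<subseteq> E" for k using assms by (auto simp: F_def)
    then show "z \<in> chains N x y"
      using zF[of 0] zF[of N] zF assms(3) by (auto simp: chains_def F_def)
  qed
  have "compact (F k)" for k unfolding F_def using compact_E by auto
  then have "compactin (product_topology (\<lambda>i. euclidean) UNIV) (Pi\<^sub>E UNIV F)"
    by (simp add: compactin_PiE)
  then have comp: "compact (chains N x y)"
    by (simp add: euclidean_product_topology eq)
  have "F k \<noteq> {}" for k using assms by (auto simp: F_def)
  then have ne: "chains N x y \<noteq> {}" by (simp add: eq PiE_eq_empty_iff)
  have "continuous_on (chains N x y) (energy N)"
    unfolding energy_def
    by (intro continuous_intros continuous_on_subset[OF continuous_on_product_coordinates]) auto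
  from continuous_attains_inf[OF comp ne this]
  obtain z where z: "z \<in> chains N x y" "\<And>w. w \<in> chains N x y \<Longrightarrow> energy N z \<le> energy N w"
    by blast
  then have "energy N z \<le> min_energy N x y"
    unfolding min_energy_def by (intro cInf_greatest) (use ne in auto)
  with z(1) min_energy_le[OF z(1)] show ?thesis by force
qed

text \<open>\<open>e\<close> is the tangential part of \<open>m - z\<close>. The squared distance to
  \<open>m\<close> along the central arc in direction \<open>e\<close> has a minimum at 0, and its
  derivative there is a multiple of \<open>e \<bullet> e\<close>.\<close>

lemma nearest_point_normal:
  assumes z: "z \<in> E" and near: "\<And>w. w \<in> E \<Longrightarrow> norm (z - m) \<le> norm (w - m)"
  shows "\<exists>\<nu>. m - z = \<nu> *\<^sub>R xi z 0"
proof -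
  define n where "n = xi z 0"
  define c where "c = m - z"
  define e where "e = c - ((c \<bullet> n) / (n \<bullet> n)) *\<^sub>R n"
  have Qz: "Q 0 z z = 1" using z by (simp add: E_iff)
  then have "n \<noteq> 0" unfolding n_def Q_eq_inner by auto
  then have en: "e \<bullet> n = 0" by (simp add: e_def inner_diff_left)
  then have Qze: "Q 0 z e = 0" by (simp add: Q_eq_inner n_def inner_commute)
  have "c \<bullet> e = e \<bullet> e"
  proof -
    have "e \<bullet> e = c \<bullet> e - ((c \<bullet> n) / (n \<bullet> n)) * (n \<bullet> e)"
      by (subst (1) e_def) (simp add: inner_diff_left)
    then show ?thesis using en by (simp add: inner_commute)
  qed
  \<comment> \<open>Every point of the tangent line satisfies
    \<open>Q 0 z (z + t *\<^sub>R e) = 1\<close>, so the line misses the center.\<close>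
  have nz: "(1 - t) *\<^sub>R z + t *\<^sub>R (z + e) \<noteq> 0" for t
  proof
    assume "(1 - t) *\<^sub>R z + t *\<^sub>R (z + e) = 0"
    then have "Q 0 z (z + t *\<^sub>R e) = 0" by (simp add: algebra_simps Q_def)
    then show False using Qz Qze by (simp add: Q_linear)
  qed
  have "(arc z (z + e) has_vector_derivative arc_deriv z (z + e) 0) (at 0)"
    by (rule arc_has_derivative[OF nz])
  moreover have "arc_deriv z (z + e) 0 = e"
    by (simp add: arc_deriv_def Qz Qze)
  ultimately have d: "(arc z (z + e) has_vector_derivative e) (at 0)" by simp
  have "((\<lambda>t. (arc z (z + e) t - m) \<bullet> (arc z (z + e) t - m)) has_vector_derivative
      ((arc z (z + e) 0 - m) \<bullet> e + e \<bullet> (arc z (z + e) 0 - m))) (at 0)"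
    by (rule bounded_bilinear.has_vector_derivative[OF bounded_bilinear_inner])
      (use d in \<open>auto intro!: derivative_eq_intros\<close>)
  then have "((\<lambda>t. (arc z (z + e) t - m) \<bullet> (arc z (z + e) t - m)) has_real_derivative
      ((arc z (z + e) 0 - m) \<bullet> e + e \<bullet> (arc z (z + e) 0 - m))) (at 0)"
    by (simp add: has_real_derivative_iff_has_vector_derivative)
  then have "(arc z (z + e) 0 - m) \<bullet> e + e \<bullet> (arc z (z + e) 0 - m) = 0"
  proof (rule DERIV_local_min[of _ _ _ 1])
    show "\<forall>t. \<bar>0 - t\<bar> < 1 \<longrightarrow> (arc z (z + e) 0 - m) \<bullet> (arc z (z + e) 0 - m) \<le>
         (arc z (z + e) t - m) \<bullet> (arc z (z + e) t - m)"
    proof (intro allI impI)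
      fix t :: real
      have "arc z (z + e) t \<in> E" unfolding arc_def by (rule proj_in_E[OF nz])
      from power_mono[OF near[OF this], of 2]
      show "(arc z (z + e) 0 - m) \<bullet> (arc z (z + e) 0 - m) \<le>
         (arc z (z + e) t - m) \<bullet> (arc z (z + e) t - m)"
        by (simp add: power2_norm_eq_inner arc_ends z)
    qed
  qed simp
  then have "c \<bullet> e = 0"
    by (simp add: arc_ends z c_def inner_diff_left inner_diff_right inner_commute)
  with \<open>c \<bullet> e = e \<bullet> e\<close> have "e = 0" by simp
  then show ?thesis unfolding e_def c_def n_def by (metis eq_iff_diff_eq_0)
qed

text \<open>The part of \<open>Phi\<close> that depends on \<open>z\<close> is a Gram determinant of
  \<open>z\<close> and \<open>v\<close>, invariant under shears. So \<open>Phi\<close> is constant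
  along straight steps and can change only at the points of a chain.\<close>

lemma Phi_translate: "Phi t (z + c *\<^sub>R v) v = Phi t z v"
  by (simp add: Phi_def Q_linear Q_commute[of t v z] power2_eq_square algebra_simps)

lemma Q_xi:
  assumes "t \<noteq> 0" "\<And>i. a $ i \<noteq> t"
  shows "Q t w (xi z 0) = (Q t w z - Q 0 w z) / t"
  unfolding Q_def xi_def sum_subtractf[symmetric] sum_divide_distrib
proof (intro sum.cong refl)
  fix i
  show "w $ i * (\<chi> i. z $ i / (a $ i - 0)) $ i / (a $ i - t) = (w $ i * z $ i / (a $ i - t) - w $ i * z $ i / (a $ i - 0)) / t"
    using assms axes_pos[of i] by (simp add: divide_simps) (simp add: algebra_simps)
qed

text \<open>The factor \<open>Q 0 z (v + v')\<close> measures the failure of conservation. It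
  vanishes for an elastic reflection, which reverses the normal component of the velocity, and
  \<open>Q_z_sum_vel\<close> shows that it is small along minimal chains. \<open>Q_xi\<close>
  eliminates the products with the normal.\<close>

lemma Phi_kick:
  assumes z: "z \<in> E" and t: "t \<noteq> 0" "\<And>i. a $ i \<noteq> t" and v: "v' = v - k *\<^sub>R xi z 0"
  shows "Phi t z v' - Phi t z v = k * Q 0 z (v + v') * (1 - Q t z z) / t"
proof -
  define n where "n = xi z 0"
  have Q1: "Q 0 z z = 1" using z by (simp add: E_iff)
  have Qn: "Q t w n = (Q t w z - Q 0 w z) / t" for w unfolding n_def by (rule Q_xi[OF t])
  have Qn': "t * Q t w n = Q t w z - Q 0 w z" for w using t(1) by (simp add: Qn)
  have v': "v' = v - k *\<^sub>R n" by (simp add: n_def v)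
  define A B C D F G H where "A = Q t v v" "B = Q t z v" "C = Q t v n" "D = Q t z n" "F = Q t n n" "G = Q 0 z v" "H = Q 0 z n"
  have c: "Q t n v = C" "Q t v z = B" "Q t n z = D" "Q 0 v z = G" "Q 0 n z = H"
    using Q_commute by (auto simp: A_B_C_D_F_G_H_def)
  have tC: "t * C = B - G" and tD: "t * D = Q t z z - 1" and tF: "t * F = D - H"
    using Qn'[of v] Qn'[of z] Qn'[of n] Q1 c by (simp_all add: A_B_C_D_F_G_H_def(3,4,5))
  have lhs: "Phi t z v' - Phi t z v = (- 2 * k * C + k\<^sup>2 * F) * (1 - Q t z z) + (- 2 * k * B * D + k\<^sup>2 * D\<^sup>2)"
    unfolding Phi_def v' Q_linear c A_B_C_D_F_G_H_def(1-5)[symmetric]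
    by (simp add: power2_eq_square algebra_simps)
  have R: "Q 0 z (v + v') = 2 * G - k * H"
    unfolding v' Q_linear A_B_C_D_F_G_H_def(6,7)[symmetric] by simp
  have "t * (Phi t z v' - Phi t z v) =
      (- 2 * k * (t * C) + k\<^sup>2 * (t * F)) * (1 - Q t z z) + (- 2 * k * B * (t * D) + k\<^sup>2 * D * (t * D))"
    unfolding lhs by (simp add: power2_eq_square algebra_simps)
  also have "\<dots> = k * (2 * G - k * H) * (1 - Q t z z)"
    unfolding tC tD tF by (simp add: power2_eq_square algebra_simps)
  finally show ?thesis unfolding R using t(1) by (simp add: field_simps)
qed

lemma abs_Q_le:
  assumes z: "z \<in> E" and \<eta>: "0 < \<eta>" "\<And>i. \<eta> \<le> \<bar>a $ i - t\<bar>"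
  shows "\<bar>Q t z z\<bar> \<le> amax / \<eta>"
proof -
  have "\<bar>Q t z z\<bar> \<le> (\<Sum>i\<in>UNIV. \<bar>z $ i * z $ i / (a $ i - t)\<bar>)"
    unfolding Q_def by (rule sum_abs)
  also have "\<dots> \<le> (\<Sum>i\<in>UNIV. (z $ i)\<^sup>2 / \<eta>)"
    using \<eta> by (intro sum_mono) (auto simp: abs_mult power2_eq_square intro!: frac_le)
  also have "\<dots> = (norm z)\<^sup>2 / \<eta>"
    by (simp add: norm_vec_def L2_set_def sum_nonneg sum_divide_distrib)
  also have "\<dots> \<le> amax / \<eta>"
    using E_norm_le[OF z] \<eta> by (intro divide_right_mono) auto
  finally show ?thesis .
qed

end

section \<open>Minimal chains: estimates with explicit dependence on the number of steps\<close>

locale minimal_chain = confocal a for a :: "real ^ 'n::{finite,linorder}" +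
  fixes x y :: "(real, 'n) vec" and N :: nat and z :: "nat \<Rightarrow> (real, 'n) vec"
  assumes chain: "z \<in> chains N x y" and minimal: "energy N z = min_energy N x y" and N2: "2 \<le> N"
begin

definition vel :: "nat \<Rightarrow> (real, 'n) vec" where
  "vel k = real N *\<^sub>R (z (Suc k) - z k)"

lemma z_in_E: "z k \<in> E" and z_start: "z 0 = x" and z_end: "z N = y"
  using chain by (auto simp: chains_def)

lemma Npos: "0 < real N" using N2 by simp

lemma z_Suc: "z (Suc k) = z k + (1 / real N) *\<^sub>R vel k"
  using Npos by (simp add: vel_def)

lemma energy_vel: "min_energy N x y = (\<Sum>k<N. (norm (vel k))\<^sup>2) / real N"
proof -
  have "(\<Sum>k<N. (norm (vel k))\<^sup>2) = (real N)\<^sup>2 * (\<Sum>k<N. (norm (z (Suc k) - z k))\<^sup>2)"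
    by (simp add: vel_def power_mult_distrib sum_distrib_left)
  then show ?thesis
    unfolding minimal[symmetric] energy_def using Npos by (simp add: power2_eq_square)
qed

text \<open>Replacing only the two endpoints of the minimal chain gives a competitor for the new
  pair, and its energy differs by an exact quadratic expression in the displacements.\<close>

lemma endpoint_variation:
  assumes "x' \<in> E" "y' \<in> E"
  shows "min_energy N x' y' \<le> min_energy N x y - 2 * (vel 0 \<bullet> (x' - x)) + 2 * (vel (N - 1) \<bullet> (y' - y))
           + real N * (norm (x' - x))\<^sup>2 + real N * (norm (y' - y))\<^sup>2"
proof -
  \<comment> \<open>With \<open>N = M + 2\<close> the first and the last step are different, so the
    two variations do not interact.\<close>
  obtain M where M: "N = Suc (Suc M)" using N2 by (metis add_2_eq_Suc le_Suc_ex)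
  define w where "w k = (if k = 0 then x' else if k = N then y' else z k)" for k
  have "w \<in> chains N x' y'" using assms z_in_E N2 by (auto simp: chains_def w_def)
  then have le: "min_energy N x' y' \<le> energy N w" by (rule min_energy_le)
  have split: "(\<Sum>k<Suc (Suc M). f k) = f 0 + (\<Sum>k<M. f (Suc k)) + f (Suc M)" for f :: "nat \<Rightarrow> real"
    unfolding sum.lessThan_Suc[of _ "Suc M"] by (subst sum.lessThan_Suc_shift) simp
  have "energy N w = real N * ((norm (z 1 - x'))\<^sup>2 + (\<Sum>k<M. (norm (z (Suc (Suc k)) - z (Suc k)))\<^sup>2) + (norm (y' - z (Suc M)))\<^sup>2)"
    unfolding energy_def M split by (simp add: w_def M)
  also have "\<dots> = energy N z + real N * ((norm (z 1 - x'))\<^sup>2 - (norm (z 1 - x))\<^sup>2 + ((norm (y' - z (Suc M)))\<^sup>2 - (norm (y - z (Suc M)))\<^sup>2))"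
    unfolding energy_def M split using z_start z_end M by (simp add: algebra_simps)
  also have "(norm (z 1 - x'))\<^sup>2 - (norm (z 1 - x))\<^sup>2 = - 2 * ((z 1 - x) \<bullet> (x' - x)) + (norm (x' - x))\<^sup>2"
    by (simp add: power2_norm_eq_inner inner_diff_left inner_diff_right inner_commute)
  also have "(norm (y' - z (Suc M)))\<^sup>2 - (norm (y - z (Suc M)))\<^sup>2 = 2 * ((y - z (Suc M)) \<bullet> (y' - y)) + (norm (y' - y))\<^sup>2"
    by (simp add: power2_norm_eq_inner inner_diff_left inner_diff_right inner_commute)
  finally have "energy N w = energy N z + real N * (- 2 * ((z 1 - x) \<bullet> (x' - x)) + (norm (x' - x))\<^sup>2
      + (2 * ((y - z (Suc M)) \<bullet> (y' - y)) + (norm (y' - y))\<^sup>2))" .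
  moreover have "vel 0 \<bullet> (x' - x) = real N * ((z 1 - x) \<bullet> (x' - x))"
    using z_start by (simp add: vel_def)
  moreover have "vel (N - 1) \<bullet> (y' - y) = real N * ((y - z (Suc M)) \<bullet> (y' - y))"
  proof -
    have "Suc (N - 1) = N" "z (N - 1) = z (Suc M)" using M by simp_all
    then show ?thesis unfolding vel_def by (simp add: z_end)
  qed
  ultimately show ?thesis using le unfolding minimal by (simp add: algebra_simps)
qed

text \<open>By the parallelogram law, minimizing the two squared steps at \<open>z k\<close> means
  minimizing the distance from the midpoint \<open>m\<close> of its neighbours, so
  \<open>nearest_point_normal\<close> applies.\<close>

lemma stationary:
  assumes "0 < k" "k < N"
  shows "\<exists>\<kappa>. vel k = vel (k - 1) - \<kappa> *\<^sub>R xi (z k) 0"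
proof -
  define m where "m = (1/2) *\<^sub>R (z (k - 1) + z (Suc k))"
  have near: "norm (z k - m) \<le> norm (w - m)" if w: "w \<in> E" for w
  proof -
    have "z(k := w) \<in> chains N x y"
      using chain assms w by (auto simp: chains_def)
    then have "energy N z \<le> energy N (z(k := w))"
      using min_energy_le minimal by metis
    then have le: "(\<Sum>i<N. (norm (z (Suc i) - z i))\<^sup>2) \<le> (\<Sum>i<N. (norm ((z(k := w)) (Suc i) - (z(k := w)) i))\<^sup>2)"
      unfolding energy_def using Npos by simp
    have split: "(\<Sum>i<N. f i) = f (k - 1) + f k + (\<Sum>i\<in>{..<N} - {k - 1, k}. f i)" for f :: "nat \<Rightarrow> real"
    proof -
      have e: "{..<N} - {k - 1} - {k} = {..<N} - {k - 1, k}" by auto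
      show ?thesis
        using assms unfolding e[symmetric]
        by (subst sum.remove[of _ "k - 1"], simp, simp, subst sum.remove[of _ k]) auto
    qed
    have *: "(\<Sum>i\<in>{..<N} - {k - 1, k}. (norm ((z(k := w)) (Suc i) - (z(k := w)) i))\<^sup>2) =
        (\<Sum>i\<in>{..<N} - {k - 1, k}. (norm (z (Suc i) - z i))\<^sup>2)"
      using assms by (intro sum.cong) auto
    have "(norm (z k - z (k - 1)))\<^sup>2 + (norm (z (Suc k) - z k))\<^sup>2 \<le>
        (norm (w - z (k - 1)))\<^sup>2 + (norm (z (Suc k) - w))\<^sup>2"
    proof -
      have "k - Suc 0 \<noteq> k" using assms by simp
      with le * show ?thesis unfolding split using assms by simp
    qed
    moreover have "(norm (u - z (k - 1)))\<^sup>2 + (norm (z (Suc k) - u))\<^sup>2 =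
        2 * (norm (u - m))\<^sup>2 + (norm (z (Suc k) - z (k - 1)))\<^sup>2 / 2" for u
      unfolding m_def
      by (simp add: power2_norm_eq_inner inner_diff_left inner_diff_right inner_add_left inner_add_right inner_commute field_simps)
    ultimately have "(norm (z k - m))\<^sup>2 \<le> (norm (w - m))\<^sup>2" by simp
    then show ?thesis by (rule power2_le_imp_le) simp
  qed
  obtain \<nu> where \<nu>: "m - z k = \<nu> *\<^sub>R xi (z k) 0"
    using nearest_point_normal[OF z_in_E near] by blast
  have "vel k - vel (k - 1) = (2 * real N) *\<^sub>R (m - z k)"
    using assms by (simp add: vel_def m_def algebra_simps scaleR_2[symmetric])
  also have "\<dots> = (2 * real N * \<nu>) *\<^sub>R xi (z k) 0" by (simp add: \<nu>)
  finally have "vel k = vel (k - 1) - (- (2 * real N * \<nu>)) *\<^sub>R xi (z k) 0" by (simp add: algebra_simps)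
  then show ?thesis by blast
qed

text \<open>The multiplier of the constraint that \<open>z k\<close> lies on the ellipsoid, a
  discrete normal acceleration integrated over one time step.\<close>

definition kick :: "nat \<Rightarrow> real" where
  "kick k = (SOME \<kappa>. vel k = vel (k - 1) - \<kappa> *\<^sub>R xi (z k) 0)"

lemma kick: "Suc k < N \<Longrightarrow> vel (Suc k) = vel k - kick (Suc k) *\<^sub>R xi (z (Suc k)) 0"
  unfolding kick_def using someI_ex[OF stationary[of "Suc k"]] by simp

lemma Q_z_vel:
  shows "Q 0 (z k) (vel k) = - Q 0 (vel k) (vel k) / (2 * real N)"
    and "Q 0 (z (Suc k)) (vel k) = Q 0 (vel k) (vel k) / (2 * real N)"
proof -
  have "Q 0 (z k) (z k) = 1" "Q 0 (z (Suc k)) (z (Suc k)) = 1"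
    using z_in_E by (auto simp: E_iff)
  then show "Q 0 (z k) (vel k) = - Q 0 (vel k) (vel k) / (2 * real N)"
    and "Q 0 (z (Suc k)) (vel k) = Q 0 (vel k) (vel k) / (2 * real N)"
    using Npos unfolding vel_def Q_linear
    by (simp_all add: Q_commute[of 0 "z (Suc k)" "z k"] field_simps)
qed

text \<open>Pairing the velocity change with the normal gives
  \<open>kick (Suc k) * rho (z (Suc k)) 0\<close> as the sum of two values of \<open>Q 0\<close>
  divided by \<open>2 * real N\<close>, because both adjacent steps are chords of the ellipsoid.
  Nonnegativity lets kicks be summed without absolute values.\<close>

lemma kick_bounds:
  assumes "Suc k < N"
  shows "0 \<le> kick (Suc k)"
    and "kick (Suc k) \<le> amax / (2 * real N * amin) * ((norm (vel k))\<^sup>2 + (norm (vel (Suc k)))\<^sup>2)"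
proof -
  let ?z = "z (Suc k)" and ?\<kappa> = "kick (Suc k)"
  have top: "0 < amin" by (rule axes_pos)
  have rho: "1 \<le> amax * rho ?z 0"
    using z_in_E[of "Suc k"] by (intro rho_ge) (auto simp: E_iff)
  then have rpos: "0 < rho ?z 0" using axes_pos[of "Min UNIV"]
    by (metis less_le_trans zero_less_mult_pos zero_less_one)
  have "Q 0 ?z (vel (Suc k)) = Q 0 ?z (vel k) - ?\<kappa> * rho ?z 0"
    unfolding kick[OF assms] Q_linear by (simp add: Q_eq_inner rho_eq_norm power2_norm_eq_inner)
  then have eq: "?\<kappa> * rho ?z 0 = (Q 0 (vel k) (vel k) + Q 0 (vel (Suc k)) (vel (Suc k))) / (2 * real N)"
    unfolding Q_z_vel using Npos by (simp add: field_simps)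
  moreover have "0 \<le> (Q 0 (vel k) (vel k) + Q 0 (vel (Suc k)) (vel (Suc k))) / (2 * real N)"
    using Q0_nonneg Npos by (intro divide_nonneg_pos add_nonneg_nonneg) auto
  ultimately have "0 \<le> ?\<kappa> * rho ?z 0" by simp
  then show k0: "0 \<le> ?\<kappa>" using rpos by (simp add: zero_le_mult_iff)
  have "?\<kappa> \<le> ?\<kappa> * (amax * rho ?z 0)" using rho k0 by (simp add: mult_le_cancel_left1 not_less)
  also have "\<dots> = amax * ((Q 0 (vel k) (vel k) + Q 0 (vel (Suc k)) (vel (Suc k))) / (2 * real N))"
    by (simp only: eq[symmetric] mult.left_commute)
  also have "\<dots> \<le> amax * (((norm (vel k))\<^sup>2 + (norm (vel (Suc k)))\<^sup>2) / amin / (2 * real N))"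
    using Q0_le_norm[of "vel k"] Q0_le_norm[of "vel (Suc k)"] top Npos axes_pos[of "Min UNIV"]
    by (intro mult_left_mono divide_right_mono) (auto simp: pos_le_divide_eq distrib_left mult.commute distrib_right)
  finally show "?\<kappa> \<le> amax / (2 * real N * amin) * ((norm (vel k))\<^sup>2 + (norm (vel (Suc k)))\<^sup>2)"
    by (simp add: mult_ac)
qed

definition ecc :: real where "ecc = amax / amin"

lemma ecc_pos: "0 < ecc" unfolding ecc_def using axes_pos by simp

text \<open>Each velocity occurs in at most two of the bounds of \<open>kick_bounds\<close>, so the
  total kick is controlled by the energy with a constant independent of \<open>N\<close>.\<close>

lemma sum_kick: "(\<Sum>k\<in>{1..<N}. kick k) \<le> ecc * min_energy N x y"
proof -
  obtain M where M: "N = Suc M" using N2 by (cases N) auto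
  let ?c = "amax / (2 * real N * amin)"
  have c0: "0 \<le> ?c" using axes_pos Npos by (simp add: less_imp_le)
  have "(\<Sum>k\<in>{1..<N}. kick k) = (\<Sum>k<M. kick (Suc k))"
    using sum.shift_bounds_Suc_ivl[of kick 0 M] unfolding M[symmetric] by (simp add: lessThan_atLeast0)
  also have "\<dots> \<le> (\<Sum>k<M. ?c * ((norm (vel k))\<^sup>2 + (norm (vel (Suc k)))\<^sup>2))"
    using kick_bounds(2) M by (intro sum_mono) auto
  also have "\<dots> = ?c * ((\<Sum>k<M. (norm (vel k))\<^sup>2) + (\<Sum>k<M. (norm (vel (Suc k)))\<^sup>2))"
    by (simp only: sum_distrib_left[symmetric] sum.distrib)
  also have "\<dots> \<le> ?c * ((\<Sum>k<N. (norm (vel k))\<^sup>2) + (\<Sum>k<N. (norm (vel k))\<^sup>2))"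
  proof (intro mult_left_mono c0 add_mono)
    show "(\<Sum>k<M. (norm (vel k))\<^sup>2) \<le> (\<Sum>k<N. (norm (vel k))\<^sup>2)" by (simp add: M)
    show "(\<Sum>k<M. (norm (vel (Suc k)))\<^sup>2) \<le> (\<Sum>k<N. (norm (vel k))\<^sup>2)"
      using sum.lessThan_Suc_shift[of "\<lambda>k. (norm (vel k))\<^sup>2" M] unfolding M[symmetric] by simp
  qed
  also have "\<dots> = ecc * min_energy N x y"
    unfolding energy_vel ecc_def by simp
  finally show ?thesis .
qed

definition vmax :: real where "vmax = Max ((\<lambda>k. (norm (vel k))\<^sup>2) ` {..<N})"

lemma vmax_ge: "k < N \<Longrightarrow> (norm (vel k))\<^sup>2 \<le> vmax"
  unfolding vmax_def by (intro Max_ge) auto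

lemma vmax_nonneg: "0 \<le> vmax"
  using vmax_ge[of 0] N2 by (auto intro: order_trans[rotated])

text \<open>The chord relations at the common endpoint have opposite signs, so the normal components
  nearly cancel and leave a term of order 1/N. Multiplied by the total kick, which
  \<open>sum_kick\<close> bounds, this makes the drift of speed and of \<open>Phi\<close> along the
  whole chain of order 1/N.\<close>

lemma Q_z_sum_vel:
  assumes "Suc k < N"
  shows "\<bar>Q 0 (z (Suc k)) (vel k + vel (Suc k))\<bar> \<le> vmax / (2 * real N * amin)"
proof -
  have top: "0 < amin" by (rule axes_pos)
  have b: "0 \<le> Q 0 (vel j) (vel j)" "Q 0 (vel j) (vel j) \<le> vmax / amin" if "j < N" for j
    using Q0_le_norm[of "vel j"] vmax_ge[OF that] top Q0_nonneg by (auto simp: pos_le_divide_eq mult.commute)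
  have "Q 0 (z (Suc k)) (vel k + vel (Suc k)) = (Q 0 (vel k) (vel k) - Q 0 (vel (Suc k)) (vel (Suc k))) / (2 * real N)"
    unfolding Q_linear Q_z_vel by (simp add: diff_divide_distrib)
  then have "\<bar>Q 0 (z (Suc k)) (vel k + vel (Suc k))\<bar> = \<bar>Q 0 (vel k) (vel k) - Q 0 (vel (Suc k)) (vel (Suc k))\<bar> / (2 * real N)"
    using Npos by (simp add: abs_divide)
  also have "\<dots> \<le> (vmax / amin) / (2 * real N)"
    using b[of k] b[of "Suc k"] assms Npos by (intro divide_right_mono) auto
  finally show ?thesis by (simp add: mult_ac)
qed

lemma vel_sq_diff:
  assumes "i < N" "j < N"
  shows "(norm (vel j))\<^sup>2 \<le> (norm (vel i))\<^sup>2 + ecc / (2 * amin) * min_energy N x y * vmax / real N"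
proof -
  have top: "0 < amin" by (rule axes_pos)
  let ?c = "vmax / (2 * real N * amin)"
  have c0: "0 \<le> ?c" using vmax_nonneg top by simp
  define g where "g k = (if k \<in> {1..<N} then kick k * ?c else 0)" for k
  have "\<bar>(norm (vel (Suc k)))\<^sup>2 - (norm (vel k))\<^sup>2\<bar> \<le> g (Suc k)" if k: "Suc k < N" for k
  proof -
    have "(norm (vel (Suc k)))\<^sup>2 - (norm (vel k))\<^sup>2 = (vel (Suc k) - vel k) \<bullet> (vel k + vel (Suc k))"
      by (simp add: power2_norm_eq_inner algebra_simps inner_commute)
    also have "vel (Suc k) - vel k = - kick (Suc k) *\<^sub>R xi (z (Suc k)) 0" by (simp add: kick[OF k])
    finally have "(norm (vel (Suc k)))\<^sup>2 - (norm (vel k))\<^sup>2 = - kick (Suc k) * Q 0 (z (Suc k)) (vel k + vel (Suc k))"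
      by (simp add: Q_eq_inner)
    then show ?thesis
      using kick_bounds(1)[OF k] Q_z_sum_vel[OF k] k unfolding g_def
      by (simp add: abs_mult mult_left_mono del: times_divide_eq_right)
  qed
  moreover have "0 \<le> g k" for k
    using kick_bounds(1)[of "k - 1"] c0 by (auto simp: g_def simp del: times_divide_eq_right)
  ultimately have "\<bar>(norm (vel j))\<^sup>2 - (norm (vel i))\<^sup>2\<bar> \<le> (\<Sum>k\<in>{1..<N}. g k)"
    by (rule telescope_bound) (use assms in auto)
  also have "\<dots> = (\<Sum>k\<in>{1..<N}. kick k) * ?c"
    unfolding sum_distrib_right by (intro sum.cong) (auto simp: g_def)
  also have "\<dots> \<le> ecc * min_energy N x y * ?c"
    by (intro mult_right_mono sum_kick c0)
  finally show ?thesis by (simp add: mult_ac)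
qed

text \<open>The energy is the mean of the squared speeds, so \<open>vel_sq_diff\<close> bounds each
  of them by the mean plus a multiple of \<open>vmax\<close>. Under \<open>small\<close> that
  multiple is at most 1/2, so \<open>vmax\<close> can be absorbed; inserting the resulting bound
  gives the first estimate.\<close>

lemma vel_sq_le:
  assumes small: "ecc / (2 * amin) * min_energy N x y / real N \<le> 1/2" and j: "j < N"
  shows "(norm (vel j))\<^sup>2 \<le> min_energy N x y + ecc / amin * (min_energy N x y)\<^sup>2 / real N"
    and "vmax \<le> 2 * min_energy N x y"
proof -
  let ?S = "min_energy N x y" and ?c = "ecc / (2 * amin)"
  have c0: "0 \<le> ?c" using ecc_pos axes_pos by (simp add: less_imp_le)
  have S0: "0 \<le> ?S" unfolding energy_vel by (intro divide_nonneg_nonneg sum_nonneg) auto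
  have av: "(norm (vel j))\<^sup>2 \<le> ?S + ?c * ?S * vmax / real N" if "j < N" for j
  proof -
    have "real N * (norm (vel j))\<^sup>2 = (\<Sum>i<N. (norm (vel j))\<^sup>2)" by simp
    also have "\<dots> \<le> (\<Sum>i<N. (norm (vel i))\<^sup>2 + ?c * ?S * vmax / real N)"
      using vel_sq_diff that by (intro sum_mono) auto
    also have "\<dots> = real N * (?S + ?c * ?S * vmax / real N)"
      unfolding energy_vel sum.distrib using Npos by (simp add: distrib_left)
    finally show ?thesis using Npos by simp
  qed
  have "vmax \<in> (\<lambda>k. (norm (vel k))\<^sup>2) ` {..<N}"
    unfolding vmax_def using N2 by (intro Max_in) (auto simp: lessThan_empty_iff)
  then obtain k where "k < N" "vmax = (norm (vel k))\<^sup>2" by auto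
  then have "vmax \<le> ?S + (?c * ?S / real N) * vmax" using av[of k] by simp
  also have "\<dots> \<le> ?S + 1/2 * vmax"
    using small vmax_nonneg by (intro add_left_mono mult_right_mono) auto
  finally show v2: "vmax \<le> 2 * ?S" by simp
  have "?c * ?S * vmax / real N \<le> ?c * ?S * (2 * ?S) / real N"
    using v2 mult_nonneg_nonneg[OF c0 S0]
    by (intro divide_right_mono mult_left_mono) (simp_all del: times_divide_eq_left)
  also have "\<dots> = ecc / amin * ?S\<^sup>2 / real N" by (simp add: power2_eq_square)
  finally show "(norm (vel j))\<^sup>2 \<le> ?S + ecc / amin * ?S\<^sup>2 / real N"
    using av[OF j] by simp
qed

text \<open>Only the kicks change \<open>Phi\<close>. Each change carries a factor
  \<open>1 / t\<close>, which \<open>amin \<le> t\<close> bounds, and a factor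
  \<open>1 - Q t z z\<close>, which the distance \<open>\<eta>\<close> from the poles
  bounds.\<close>

lemma Phi_ends:
  assumes small: "ecc / (2 * amin) * min_energy N x y / real N \<le> 1/2"
    and \<eta>: "0 < \<eta>" "\<And>i. \<eta> \<le> \<bar>a $ i - t\<bar>" and t: "amin \<le> t"
  shows "\<bar>Phi t x (vel 0) - Phi t y (vel (N - 1))\<bar> \<le>
     ecc * (1 + amax / \<eta>) / (amin)\<^sup>2 * (min_energy N x y)\<^sup>2 / real N"
proof -
  let ?S = "min_energy N x y" and ?b = "1 + amax / \<eta>"
  have top: "0 < amin" by (rule axes_pos)
  have t0: "0 < t" using t top by simp
  have ta: "a $ i \<noteq> t" for i using \<eta>(1) \<eta>(2)[of i] by auto
  have b0: "0 \<le> ?b" using \<eta>(1) axes_pos[of "Min UNIV"] by (simp add: add_nonneg_nonneg less_imp_le)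
  have S0: "0 \<le> ?S" unfolding energy_vel by (intro divide_nonneg_nonneg sum_nonneg) auto
  let ?c = "vmax / (2 * real N * amin) * ?b / amin"
  have c0: "0 \<le> ?c" using vmax_nonneg top b0 by simp
  define g where "g k = (if k \<in> {1..<N} then kick k * ?c else 0)" for k
  have "\<bar>Phi t (z (Suc k)) (vel (Suc k)) - Phi t (z k) (vel k)\<bar> \<le> g (Suc k)" if k: "Suc k < N" for k
  proof -
    have "Phi t (z k) (vel k) = Phi t (z (Suc k)) (vel k)"
      unfolding z_Suc Phi_translate ..
    then have "Phi t (z (Suc k)) (vel (Suc k)) - Phi t (z k) (vel k) =
       kick (Suc k) * (Q 0 (z (Suc k)) (vel k + vel (Suc k)) * (1 - Q t (z (Suc k)) (z (Suc k))) / t)"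
      using Phi_kick[OF z_in_E _ ta kick[OF k], of ] t0 by simp
    also have "\<bar>\<dots>\<bar> = kick (Suc k) * (\<bar>Q 0 (z (Suc k)) (vel k + vel (Suc k))\<bar> * \<bar>1 - Q t (z (Suc k)) (z (Suc k))\<bar> / t)"
      using kick_bounds(1)[OF k] t0 by (simp add: abs_mult)
    also have "\<dots> \<le> kick (Suc k) * ?c"
    proof (intro mult_left_mono kick_bounds(1)[OF k] frac_le mult_mono Q_z_sum_vel[OF k] t top)
      show "\<bar>1 - Q t (z (Suc k)) (z (Suc k))\<bar> \<le> ?b"
        using abs_Q_le[OF z_in_E \<eta>, of "Suc k"] by linarith
    qed (use vmax_nonneg top b0 in \<open>auto simp del: times_divide_eq_right\<close>)
    finally show ?thesis using k by (simp add: g_def)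
  qed
  moreover have "0 \<le> g k" for k
    using kick_bounds(1)[of "k - 1"] c0 by (auto simp: g_def simp del: times_divide_eq_right times_divide_eq_left)
  ultimately have "\<bar>Phi t (z 0) (vel 0) - Phi t (z (N - 1)) (vel (N - 1))\<bar> \<le> (\<Sum>k\<in>{1..<N}. g k)"
    by (rule telescope_bound) (use N2 in auto)
  also have "\<dots> = (\<Sum>k\<in>{1..<N}. kick k) * ?c"
    unfolding sum_distrib_right by (intro sum.cong) (auto simp: g_def)
  also have "\<dots> \<le> (ecc * ?S) * ?c"
    by (intro mult_right_mono sum_kick c0)
  also have "\<dots> \<le> (ecc * ?S) * ((2 * ?S) / (2 * real N * amin) * ?b / amin)"
    using vel_sq_le(2)[OF small, of 0] N2 S0 ecc_pos top b0
    by (intro mult_left_mono divide_right_mono mult_right_mono) (auto intro: mult_nonneg_nonneg)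
  also have "\<dots> = ecc * ?b / (amin)\<^sup>2 * ?S\<^sup>2 / real N"
    by (simp add: power2_eq_square mult_ac)
  \<comment> \<open>The last step is a segment from \<open>z (N - 1)\<close> to \<open>y\<close>
    with velocity \<open>vel (N - 1)\<close>, so \<open>Phi\<close> may be evaluated at
    \<open>y\<close> instead.\<close>
  finally show ?thesis
    using Phi_translate[of t "z (N - 1)" "1 / real N" "vel (N - 1)"] z_Suc[of "N - 1"] N2 z_start z_end
    by simp
qed

lemma steps_sq: "(norm (z (Suc k) - z k))\<^sup>2 \<le> min_energy N x y / real N" if "k < N"
proof -
  have "(norm (z (Suc k) - z k))\<^sup>2 \<le> (\<Sum>k<N. (norm (z (Suc k) - z k))\<^sup>2)"
    using that by (intro member_le_sum) auto
  also have "\<dots> = min_energy N x y / real N"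
    using Npos unfolding minimal[symmetric] energy_def by simp
  finally show ?thesis .
qed

end

section \<open>Distances of swapped pairs\<close>

text \<open>With slope \<open>K + e\<close>, the last point up to \<open>t\<close> at which the
  bound holds can be moved further right by the Dini estimate unless it is \<open>t\<close>. Then e
  tends to 0.\<close>

lemma dini_bound:
  fixes f :: "real \<Rightarrow> real"
  assumes "s \<le> t" and cont: "continuous_on {s..t} f"
    and dini: "\<And>u e. s \<le> u \<Longrightarrow> u < t \<Longrightarrow> 0 < e \<Longrightarrow> \<forall>\<^sub>F v in at_right u. f v \<le> f u + (K + e) * (v - u)"
  shows "f t \<le> f s + K * (t - s)"
proof -
  have *: "f t \<le> f s + (K + e) * (t - s)" if e: "0 < e" for e
  proof (rule ccontr)
    assume neg: "\<not> ?thesis"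
    define g where "g v = f v - (f s + (K + e) * (v - s))" for v
    have cg: "continuous_on {s..t} g" unfolding g_def by (intro continuous_intros cont)
    define A where "A = {v \<in> {s..t}. g v \<le> 0}"
    have "closed A" unfolding A_def
      using continuous_closed_preimage[OF cg, of "{..0}"] by (simp add: vimage_def Int_def conj_commute)
    moreover have sA: "s \<in> A" using \<open>s \<le> t\<close> by (simp add: A_def g_def)
    moreover have bA: "bdd_above A" by (auto simp: A_def intro: bdd_aboveI[of _ t])
    ultimately have uA: "Sup A \<in> A" by (intro closed_contains_Sup) auto
    define u where "u = Sup A"
    have u: "s \<le> u" "u \<le> t" "g u \<le> 0" using uA by (auto simp: A_def u_def)
    have "u \<noteq> t" using neg u(3) by (auto simp: g_def)
    then have ut: "u < t" using u by simp
    have "\<forall>\<^sub>F v in at_right u. v \<in> {u<..<t}"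
      using ut by (rule eventually_at_right_real)
    with dini[OF u(1) ut e] have "\<forall>\<^sub>F v in at_right u. v \<in> A \<and> u < v"
    proof eventually_elim
      case (elim v)
      have "g v \<le> g u" using elim by (simp add: g_def algebra_simps)
      then show ?case using elim u by (auto simp: A_def)
    qed
    then obtain v where "v \<in> A" "u < v"
      using eventually_happens'[OF trivial_limit_at_right_real] by blast
    then show False using cSup_upper[OF _ bA, of v] by (simp add: u_def)
  qed
  show ?thesis
  proof (cases "s = t")
    case False
    then have st: "0 < t - s" using \<open>s \<le> t\<close> by simp
    show ?thesis
    proof (rule field_le_epsilon)
      fix e :: real assume "0 < e"
      then show "f t \<le> f s + K * (t - s) + e"
        using *[of "e / (t - s)"] st by (simp add: distrib_right)
    qed
  qed simp
qed

section \<open>First variation of the energy of a swapped pair\<close>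

context confocal
begin

lemma min_energy_nonneg: "x \<in> E \<Longrightarrow> y \<in> E \<Longrightarrow> 0 < N \<Longrightarrow> 0 \<le> min_energy N x y"
  using min_chain_exists[of x y N] energy_nonneg by metis

lemma minimal_chain_ex:
  assumes "x \<in> E" "y \<in> E" "2 \<le> N"
  shows "\<exists>z. minimal_chain a x y N z"
proof -
  obtain z where "z \<in> chains N x y" "energy N z = min_energy N x y"
    using min_chain_exists[OF assms(1,2), of N] assms(3) by auto
  then have "minimal_chain a x y N z" using assms(3) by unfold_locales auto
  then show ?thesis by blast
qed

text \<open>With \<open>R = sqrt amax\<close>, velocities are at most \<open>2 * R * N\<close>, so
  the linear terms contribute the factor \<open>4 * R * N\<close> and the quadratic ones
  \<open>2 * R * N\<close>. The growth in \<open>N\<close> is harmless, since the bound serves only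
  continuity for fixed \<open>N\<close>.\<close>

lemma min_energy_lipschitz:
  assumes "x \<in> E" "y \<in> E" "x' \<in> E" "y' \<in> E" "2 \<le> N"
  shows "min_energy N x' y' \<le> min_energy N x y + 6 * real N * sqrt (amax) * (norm (x' - x) + norm (y' - y))"
proof -
  let ?R = "sqrt (amax)"
  obtain z where "minimal_chain a x y N z" using minimal_chain_ex assms by blast
  then interpret minimal_chain a x y N z .
  have n: "norm p \<le> ?R" if "p \<in> E" for p
    using E_norm_le[OF that] by (rule real_le_rsqrt)
  have d: "norm (p - q) \<le> 2 * ?R" if "p \<in> E" "q \<in> E" for p q
    using n[OF that(1)] n[OF that(2)] norm_triangle_ineq4[of p q] by linarith
  have v: "norm (vel k) \<le> real N * (2 * ?R)" for k
    unfolding vel_def using d[OF z_in_E z_in_E, of "Suc k" k] by (simp add: mult_left_mono)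
  have i: "\<bar>vel k \<bullet> w\<bar> \<le> real N * (2 * ?R) * norm w" for k w
    by (rule order_trans[OF Cauchy_Schwarz_ineq2]) (rule mult_right_mono[OF v norm_ge_zero])
  have q: "real N * (norm (p - q))\<^sup>2 \<le> real N * (2 * ?R) * norm (p - q)" if "p \<in> E" "q \<in> E" for p q
    unfolding power2_eq_square mult.assoc[of "real N"]
    by (intro mult_left_mono mult_right_mono d that) auto
  show ?thesis
    using endpoint_variation[OF assms(3,4)] i[of 0 "x' - x"] i[of "N - 1" "y' - y"]
      q[OF assms(3,1)] q[OF assms(4,2)]
    by (simp add: algebra_simps abs_le_iff)
qed

lemma continuous_on_min_energy:
  assumes "continuous_on T f" "continuous_on T g" "\<And>t. t \<in> T \<Longrightarrow> f t \<in> E" "\<And>t. t \<in> T \<Longrightarrow> g t \<in> E" "2 \<le> N"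
  shows "continuous_on T (\<lambda>t. min_energy N (f t) (g t))"
  unfolding continuous_on_def
proof
  fix t assume t: "t \<in> T"
  let ?A = "6 * real N * sqrt (amax)"
  have "((\<lambda>s. ?A * (norm (f s - f t) + norm (g s - g t))) \<longlongrightarrow> ?A * (norm (f t - f t) + norm (g t - g t))) (at t within T)"
    using assms(1,2) t unfolding continuous_on_def by (intro tendsto_intros) auto
  then have lim: "((\<lambda>s. ?A * (norm (f s - f t) + norm (g s - g t))) \<longlongrightarrow> 0) (at t within T)" by simp
  have "((\<lambda>s. min_energy N (f s) (g s) - min_energy N (f t) (g t)) \<longlongrightarrow> 0) (at t within T)"
  proof (rule Lim_null_comparison[OF _ lim])
    show "\<forall>\<^sub>F s in at t within T. norm (min_energy N (f s) (g s) - min_energy N (f t) (g t))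
       \<le> ?A * (norm (f s - f t) + norm (g s - g t))"
      unfolding eventually_at_filter
    proof (rule always_eventually, intro allI impI)
      fix s assume s: "s \<noteq> t" "s \<in> T"
      show "norm (min_energy N (f s) (g s) - min_energy N (f t) (g t)) \<le> ?A * (norm (f s - f t) + norm (g s - g t))"
        using min_energy_lipschitz[of "f t" "g t" "f s" "g s" N] min_energy_lipschitz[of "f s" "g s" "f t" "g t" N]
          assms(3-5) s t by (simp add: abs_le_iff norm_minus_commute)
    qed
  qed
  then show "((\<lambda>t. min_energy N (f t) (g t)) \<longlongrightarrow> min_energy N (f t) (g t)) (at t within T)"
    by (simp add: LIM_zero_iff)
qed

definition swap :: "'n set \<Rightarrow> (real, 'n) vec \<Rightarrow> (real, 'n) vec \<Rightarrow> (real, 'n) vec" where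
  "swap S l m = (\<chi> k. if k \<in> S then m $ k else l $ k)"

lemma swap_nth: "swap S l m $ k = (if k \<in> S then m $ k else l $ k)"
  by (simp add: swap_def)

lemma swap_interior: "l \<in> coord_interior \<Longrightarrow> m \<in> coord_interior \<Longrightarrow> swap S l m \<in> coord_interior"
  by (auto simp: coord_interior_def swap_nth)

lemma swap_box: "l \<in> coord_box \<Longrightarrow> m \<in> coord_box \<Longrightarrow> swap S l m \<in> coord_box"
  by (auto simp: mem_coord_box swap_nth)

lemma point_interior_in_E: "l \<in> coord_interior \<Longrightarrow> point l \<in> E"
  using point_in_E coord_interior_subset by blast

lemma xi_reflect: "xi (reflect s x) t = reflect s (xi x t)"
  by (simp add: vec_eq_iff xi_def)

text \<open>The first summand comes from the deviation of the initial squared speed from the mean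
  (\<open>vel_sq_le\<close>); the second from the error of \<open>Phi_ends\<close> in each of the n
  components, weighted by \<open>1 / rho \<le> amax\<close>.\<close>

definition drift :: "real \<Rightarrow> real" where
  "drift \<eta> = amax / (amin)\<^sup>2 +
     real CARD('n) * amax * (amax / amin * (1 + amax / \<eta>) / (amin)\<^sup>2)"

lemma drift_nonneg: "0 < \<eta> \<Longrightarrow> 0 \<le> drift \<eta>"
  unfolding drift_def using axes_pos
  by (intro add_nonneg_nonneg mult_nonneg_nonneg divide_nonneg_nonneg) (auto simp: less_imp_le)

text \<open>The momenta at the two ends of a minimal chain are read off the same generating function
  \<open>Phi\<close>, so the mixed momentum (some components taken at one end, some at the other) still has
  almost the right length at the point with coordinates \<open>l\<close>.\<close>

lemma mixed_momentum_bound: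
  assumes l: "l \<in> coord_interior" and m: "m \<in> coord_interior" and s: "s \<in> signs" and top: "top_index \<notin> S"
    and x: "x = point (swap S l m)" and y: "y = reflect s (point (swap S m l))"
    and mc: "minimal_chain a x y N z"
    and small: "amax / (amin)\<^sup>2 * min_energy N x y / real N \<le> 1"
    and \<eta>: "0 < \<eta>" "\<And>i k. \<eta> \<le> \<bar>a $ i - l $ k\<bar>"
    and v: "v = real N *\<^sub>R (z 1 - x)" and w: "w = real N *\<^sub>R (y - z (N - 1))"
    and q: "\<And>k. q k = (if k \<in> S then - Q (l $ k) y w else Q (l $ k) x v)"
  shows "(\<Sum>k\<in>UNIV. d k * q k)\<^sup>2 \<le> (\<Sum>k\<in>UNIV. (d k)\<^sup>2 * rho (point l) (l $ k)) *
    (min_energy N x y + drift \<eta> * (min_energy N x y)\<^sup>2 / real N)"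
proof -
  interpret minimal_chain a x y N z by (rule mc)
  let ?S = "min_energy N x y" and ?\<rho> = "\<lambda>k. rho (point l) (l $ k)"
  have v: "v = vel 0" using z_start by (simp add: v vel_def)
  have "Suc (N - 1) = N" using N2 by simp
  then have w: "w = vel (N - 1)" using z_end by (simp add: w vel_def)
  note Ql = Q_point_coord[OF l]
  have \<rho>: "0 < ?\<rho> k" for k by (rule rho_pos[OF Ql])
  have \<rho>1: "1 / ?\<rho> k \<le> amax" for k
    using rho_ge[OF Ql point_interior_in_E[OF l], of k] \<rho>[of k] by (simp add: pos_divide_le_eq)
  have xq: "Q (l $ k) x x = 1" if "k \<notin> S" for k
    using Q_point_coord[OF swap_interior[OF l m], of S k] that by (simp add: x swap_nth)
  have yq: "Q (l $ k) y y = 1" if "k \<in> S" for k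
    using Q_point_coord[OF swap_interior[OF m l], of S k] that by (simp add: y swap_nth Q_reflect[OF s])
  let ?e = "ecc * (1 + amax / \<eta>) / (amin)\<^sup>2 * ?S\<^sup>2 / real N"
  have e0: "0 \<le> ?e"
    using ecc_pos \<eta>(1) axes_pos
    by (intro divide_nonneg_nonneg mult_nonneg_nonneg add_nonneg_nonneg) (auto simp: less_imp_le)
  have ecc_eq: "amax / (amin)\<^sup>2 = ecc / amin"
    by (simp add: ecc_def power2_eq_square)
  have small': "ecc / (2 * amin) * ?S / real N \<le> 1/2"
    using small unfolding ecc_eq by simp
  \<comment> \<open>The end whose coordinate is \<open>l $ k\<close> lies on that quadric, so the
    squared component equals \<open>Phi\<close> there. For \<open>k \<in> S\<close> this is the end
    \<open>y\<close>, and \<open>Phi_ends\<close> carries the value to \<open>x\<close>; its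
    condition \<open>amin \<le> l $ k\<close> would fail at the top index, where the coordinate is
    0.\<close>
  have qq: "(q k)\<^sup>2 \<le> Phi (l $ k) x v + ?e" for k
  proof (cases "k \<in> S")
    case True
    then have "k \<noteq> top_index" using top by auto
    then have "amin \<le> l $ k" using coord_interior_gt[OF l, of k top_index] less_top_index[of k] by simp
    then have "\<bar>Phi (l $ k) x v - Phi (l $ k) y w\<bar> \<le> ?e"
      unfolding v w using Phi_ends[OF small' \<eta>(1), of "l $ k"] \<eta>(2) by blast
    then show ?thesis using Phi_on_quadric[OF yq[OF True], of w] True by (simp add: q)
  next
    case False
    then show ?thesis using Phi_on_quadric[OF xq[OF False], of v] e0 by (simp add: q)
  qed
  have "(\<Sum>k\<in>UNIV. (q k)\<^sup>2 / ?\<rho> k) \<le> (\<Sum>k\<in>UNIV. Phi (l $ k) x v / ?\<rho> k + amax * ?e)"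
  proof (rule sum_mono)
    fix k
    have "(q k)\<^sup>2 / ?\<rho> k \<le> (Phi (l $ k) x v + ?e) / ?\<rho> k"
      using qq \<rho> by (intro divide_right_mono) (auto simp: less_imp_le)
    also have "\<dots> = Phi (l $ k) x v / ?\<rho> k + 1 / ?\<rho> k * ?e" by (simp add: add_divide_distrib)
    also have "\<dots> \<le> Phi (l $ k) x v / ?\<rho> k + amax * ?e"
      by (intro add_left_mono mult_right_mono \<rho>1 e0)
    finally show "(q k)\<^sup>2 / ?\<rho> k \<le> Phi (l $ k) x v / ?\<rho> k + amax * ?e" .
  qed
  also have "\<dots> = (norm v)\<^sup>2 + real CARD('n) * (amax * ?e)"
    by (simp add: sum.distrib sum_Phi[OF l Ql])
  also have "\<dots> \<le> ?S + ecc / amin * ?S\<^sup>2 / real N + real CARD('n) * (amax * ?e)"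
    using vel_sq_le(1)[OF small', of 0] N2 by (simp add: v)
  also have "\<dots> = ?S + drift \<eta> * ?S\<^sup>2 / real N"
    unfolding drift_def ecc_eq by (simp add: ecc_def add_divide_distrib distrib_right)
  finally have bound: "(\<Sum>k\<in>UNIV. (q k)\<^sup>2 / ?\<rho> k) \<le> ?S + drift \<eta> * ?S\<^sup>2 / real N" .
  have "(\<Sum>k\<in>UNIV. d k * q k)\<^sup>2 = (\<Sum>k\<in>UNIV. (d k * sqrt (?\<rho> k)) * (q k / sqrt (?\<rho> k)))\<^sup>2"
    using \<rho> by (simp add: less_imp_neq[symmetric])
  also have "\<dots> \<le> (\<Sum>k\<in>UNIV. (d k * sqrt (?\<rho> k))\<^sup>2) * (\<Sum>k\<in>UNIV. (q k / sqrt (?\<rho> k))\<^sup>2)"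
    by (rule Cauchy_Schwarz_ineq_sum)
  also have "\<dots> = (\<Sum>k\<in>UNIV. (d k)\<^sup>2 * ?\<rho> k) * (\<Sum>k\<in>UNIV. (q k)\<^sup>2 / ?\<rho> k)"
    using \<rho> by (simp add: power_mult_distrib power_divide less_imp_le)
  also have "\<dots> \<le> (\<Sum>k\<in>UNIV. (d k)\<^sup>2 * ?\<rho> k) * (?S + drift \<eta> * ?S\<^sup>2 / real N)"
    using \<rho> by (intro mult_left_mono bound sum_nonneg mult_nonneg_nonneg) (auto simp: less_imp_le)
  finally show ?thesis .
qed

text \<open>A smooth \<open>G\<close> touches \<open>f\<close> at \<open>u\<close> from above, so
  its derivative controls the upper right Dini derivative of the root. The factor 4 in
  \<open>speed\<close> reflects the metric coefficients \<open>rho / 4\<close>: \<open>B\<close>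
  bounds the speed of the moving point. The constant \<open>c\<close> covers the error term of
  \<open>mixed_momentum_bound\<close>.\<close>

lemma energy_dini:
  fixes lam :: "real \<Rightarrow> (real, 'n) vec"
  assumes l: "lam u \<in> coord_interior" and ev: "\<forall>\<^sub>F v in at_right u. lam v \<in> coord_interior"
    and der: "\<And>k. ((\<lambda>v. lam v $ k) has_real_derivative d k) (at u)"
    and speed: "(\<Sum>k\<in>UNIV. (d k)\<^sup>2 * rho (point (lam u)) (lam u $ k)) \<le> 4 * B\<^sup>2" and B: "0 \<le> B"
    and m: "m \<in> coord_interior" and s: "s \<in> signs" and top: "top_index \<notin> S"
    and f: "\<And>v. f v = min_energy N (point (swap S (lam v) m)) (reflect s (point (swap S m (lam v))))"
    and small: "amax / (amin)\<^sup>2 * f u / real N \<le> 1"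
    and \<eta>: "0 < \<eta>" "\<And>i k. \<eta> \<le> \<bar>a $ i - lam u $ k\<bar>"
    and c: "0 < c" "drift \<eta> * (f u)\<^sup>2 / real N \<le> c" and N: "2 \<le> N" and e: "0 < e"
  shows "\<forall>\<^sub>F v in at_right u. sqrt (f v + c) \<le> sqrt (f u + c) + (B + e) * (v - u)"
proof -
  define x where "x v = point (swap S (lam v) m)" for v
  define y where "y v = reflect s (point (swap S m (lam v)))" for v
  have xE: "x v \<in> E" and yE: "y v \<in> E" if "lam v \<in> coord_interior" for v
    using that m s unfolding x_def y_def by (auto intro!: point_interior_in_E reflect_in_E swap_interior)
  obtain z where mc: "minimal_chain a (x u) (y u) N z"
    using minimal_chain_ex[OF xE[OF l] yE[OF l] N] by blast
  interpret minimal_chain a "x u" "y u" N z by (rule mc)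
  define p where "p = real N *\<^sub>R (z 1 - x u)"
  define w where "w = real N *\<^sub>R (y u - z (N - 1))"
  have p: "p = vel 0" using z_start by (simp add: p_def vel_def)
  have "Suc (N - 1) = N" using N2 by simp
  then have w: "w = vel (N - 1)" using z_end by (simp add: w_def vel_def)
  define q where "q k = (if k \<in> S then - Q (lam u $ k) (y u) w else Q (lam u $ k) (x u) p)" for k
  have fu: "f u = min_energy N (x u) (y u)" by (simp add: f x_def y_def)
  have f0: "0 \<le> f u" unfolding fu using N by (intro min_energy_nonneg xE yE l) auto
  \<comment> \<open>The bound of \<open>endpoint_variation\<close> along the moving pair, with the
    minimal chain at \<open>u\<close> kept fixed.\<close>
  define G where "G v = f u - 2 * (p \<bullet> (x v - x u)) + 2 * (w \<bullet> (y v - y u))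
           + real N * ((x v - x u) \<bullet> (x v - x u)) + real N * ((y v - y u) \<bullet> (y v - y u))" for v
  have Gu: "G u = f u" by (simp add: G_def)
  have fG: "f v \<le> G v" if "lam v \<in> coord_interior" for v
    using endpoint_variation[OF xE[OF that] yE[OF that]]
    by (simp add: f x_def[symmetric] y_def[symmetric] G_def fu p w power2_norm_eq_inner)
  define dx where "dx = (- 1/2) *\<^sub>R (\<Sum>k\<in>UNIV. (if k \<in> S then 0 else d k) *\<^sub>R xi (x u) (swap S (lam u) m $ k))"
  define dy where "dy = (- 1/2) *\<^sub>R (\<Sum>k\<in>UNIV. (if k \<in> S then d k else 0) *\<^sub>R xi (y u) (swap S m (lam u) $ k))"
  have x': "(x has_vector_derivative dx) (at u)"
    unfolding x_def dx_def
  proof (rule point_has_derivative)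
    show "((\<lambda>v. swap S (lam v) m $ k) has_real_derivative (if k \<in> S then 0 else d k)) (at u)" for k
      using der[of k] by (simp add: swap_nth)
  qed (intro swap_interior l m)
  interpret R: bounded_linear "reflect s" by (rule bounded_linear_reflect)
  have "((\<lambda>v. point (swap S m (lam v))) has_vector_derivative
     (- 1/2) *\<^sub>R (\<Sum>k\<in>UNIV. (if k \<in> S then d k else 0) *\<^sub>R xi (point (swap S m (lam u))) (swap S m (lam u) $ k))) (at u)"
  proof (rule point_has_derivative)
    show "((\<lambda>v. swap S m (lam v) $ k) has_real_derivative (if k \<in> S then d k else 0)) (at u)" for k
      using der[of k] by (simp add: swap_nth)
  qed (intro swap_interior l m)
  from R.has_vector_derivative[OF this]
  have y': "(y has_vector_derivative dy) (at u)"
    unfolding y_def dy_def xi_reflect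
    by (simp add: R.neg R.scaleR R.sum)
  have G1: "(G has_vector_derivative - 2 * (p \<bullet> dx) + 2 * (w \<bullet> dy)) (at u)"
  proof -
    have xs: "((\<lambda>v. x v - x u) has_vector_derivative dx) (at u)" "((\<lambda>v. y v - y u) has_vector_derivative dy) (at u)"
      using x' y' by (auto intro!: derivative_eq_intros)
    have i1: "((\<lambda>v. p \<bullet> (x v - x u)) has_vector_derivative p \<bullet> dx) (at u)"
      and i2: "((\<lambda>v. w \<bullet> (y v - y u)) has_vector_derivative w \<bullet> dy) (at u)"
      using xs by (auto intro!: bounded_linear.has_vector_derivative[OF bounded_linear_inner_right])
    have i3: "((\<lambda>v. (x v - x u) \<bullet> (x v - x u)) has_vector_derivative (x u - x u) \<bullet> dx + dx \<bullet> (x u - x u)) (at u)"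
      and i4: "((\<lambda>v. (y v - y u) \<bullet> (y v - y u)) has_vector_derivative (y u - y u) \<bullet> dy + dy \<bullet> (y u - y u)) (at u)"
      by (rule bounded_bilinear.has_vector_derivative[OF bounded_bilinear_inner xs(1) xs(1)],
          rule bounded_bilinear.has_vector_derivative[OF bounded_bilinear_inner xs(2) xs(2)])
    show ?thesis
      using i1 i2 i3 i4 unfolding G_def[abs_def] has_real_derivative_iff_has_vector_derivative[symmetric]
      by (auto intro!: derivative_eq_intros)
  qed
  let ?D = "\<Sum>k\<in>UNIV. d k * q k"
  \<comment> \<open>The factor -1/2 of \<open>point_has_derivative\<close> cancels the 2 of the
    first variation; the opposite signs at the two ends explain the minus sign in
    \<open>q\<close>.\<close>
  have "- 2 * (p \<bullet> dx) + 2 * (w \<bullet> dy) = ?D"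
  proof -
    have "- 2 * (p \<bullet> dx) = (\<Sum>k\<in>UNIV. (if k \<in> S then 0 else d k) * Q (swap S (lam u) m $ k) (x u) p)"
      unfolding dx_def by (simp add: inner_sum_right Q_eq_inner inner_commute)
    moreover have "2 * (w \<bullet> dy) = (\<Sum>k\<in>UNIV. - ((if k \<in> S then d k else 0) * Q (swap S m (lam u) $ k) (y u) w))"
      unfolding dy_def by (simp add: inner_sum_right Q_eq_inner inner_commute sum_negf)
    ultimately show ?thesis
      unfolding sum.distrib[symmetric]
      by (simp add: sum.distrib[symmetric]) (auto intro!: sum.cong simp: q_def swap_nth)
  qed
  with G1 have G': "(G has_real_derivative ?D) (at u)"
    by (simp add: has_real_derivative_iff_has_vector_derivative)
  have "?D\<^sup>2 \<le> (\<Sum>k\<in>UNIV. (d k)\<^sup>2 * rho (point (lam u)) (lam u $ k)) *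
    (min_energy N (x u) (y u) + drift \<eta> * (min_energy N (x u) (y u))\<^sup>2 / real N)"
    by (rule mixed_momentum_bound[OF l m s top x_def y_def mc _ \<eta> p_def w_def q_def])
      (use small fu in simp)
  also have "\<dots> \<le> (4 * B\<^sup>2) * (f u + c)"
    unfolding fu[symmetric] using c(2) f0 drift_nonneg[OF \<eta>(1)] by (intro mult_mono speed) auto
  also have "\<dots> = (2 * B * sqrt (f u + c))\<^sup>2"
    using f0 c(1) by (simp add: power_mult_distrib)
  finally have "?D \<le> 2 * B * sqrt (f u + c)"
    by (rule power2_le_imp_le) (use B f0 c(1) in auto)
  moreover have sq0: "0 < sqrt (f u + c)" using f0 c(1) by simp
  ultimately have "?D / (2 * sqrt (f u + c)) \<le> B"
    by (simp add: pos_divide_le_eq mult_ac)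
  then have D: "?D / (2 * sqrt (f u + c)) < B + e" using e by linarith
  have "((\<lambda>v. G v + c) has_real_derivative ?D) (at u)"
    using DERIV_add[OF G' DERIV_const[of c]] by simp
  moreover have "(sqrt has_real_derivative inverse (sqrt (G u + c)) / 2) (at (G u + c))"
    using sq0 by (intro DERIV_real_sqrt) (simp add: Gu)
  ultimately have "((\<lambda>v. sqrt (G v + c)) has_real_derivative inverse (sqrt (G u + c)) / 2 * ?D) (at u)"
    by (intro DERIV_chain2)
  also have "inverse (sqrt (G u + c)) / 2 * ?D = ?D / (2 * sqrt (f u + c))"
  proof -
    have "inverse r / 2 * P = P / (2 * r)" for r P :: real by (simp add: field_simps)
    then show ?thesis by (simp only: Gu)
  qed
  finally have "((\<lambda>v. (sqrt (G v + c) - sqrt (G u + c)) / (v - u)) \<longlongrightarrow>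
      ?D / (2 * sqrt (f u + c))) (at_right u)"
    by (auto simp: has_field_derivative_iff intro: tendsto_mono at_le)
  from order_tendstoD(2)[OF this D] have "\<forall>\<^sub>F v in at_right u. (sqrt (G v + c) - sqrt (G u + c)) / (v - u) < B + e" .
  then show ?thesis using ev eventually_at_right_less[of u]
  proof eventually_elim
    case (elim v)
    have "sqrt (f v + c) \<le> sqrt (G v + c)" using fG[OF elim(2)] by simp
    also have "\<dots> \<le> sqrt (G u + c) + (B + e) * (v - u)"
      using elim(1,3) by (simp add: pos_divide_less_eq)
    finally show ?case by (simp add: Gu)
  qed
qed

end

section \<open>From energies to distances\<close>

context confocal_proper
begin

text \<open>A curve cut into \<open>N\<close> equal steps is a competing chain whose energy is at
  most its squared length.\<close>

lemma min_energy_le_gd: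
  assumes "x \<in> E" "y \<in> E" "0 < N"
  shows "min_energy N x y \<le> (gd x y)\<^sup>2"
proof -
  have "sqrt (min_energy N x y) \<le> len" if len: "len \<in> curve_lengths E x y" for len
  proof -
    obtain z where z: "z 0 = x" "z N = y" "\<And>k. z k \<in> E" "\<And>k. k < N \<Longrightarrow> norm (z (Suc k) - z k) \<le> len / N"
      using curve_lengths_equal_steps[OF len assms(3)] by blast
    then have "min_energy N x y \<le> energy N z" by (intro min_energy_le) (simp add: chains_def)
    also have "\<dots> \<le> real N * (\<Sum>k<N. (len / N)\<^sup>2)"
      unfolding energy_def using z(4) by (intro mult_left_mono sum_mono power_mono) auto
    also have "\<dots> = len\<^sup>2" using assms(3) by (simp add: power2_eq_square)
    finally show ?thesis using curve_lengths_nonneg[OF len] by (simp add: real_le_lsqrt)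
  qed
  then have "sqrt (min_energy N x y) \<le> gd x y"
    unfolding geodesic_dist_eq_Inf by (intro cInf_greatest curve_lengths_E_nonempty assms(1,2))
  then have "(sqrt (min_energy N x y))\<^sup>2 \<le> (gd x y)\<^sup>2"
    using min_energy_nonneg[OF assms] by (intro power_mono) auto
  then show ?thesis using min_energy_nonneg[OF assms] by simp
qed

text \<open>Central arcs replace the steps of a minimal chain. Their total excess over the chords is
  at most \<open>arc_const\<close> times the sum of squared steps, that is, the energy divided by
  \<open>N\<close>.\<close>

lemma gd_le_min_energy:
  assumes xy: "x \<in> E" "y \<in> E" and N: "2 \<le> N"
    and small: "min_energy N x y / N \<le> 1" "min_energy N x y / N \<le> amin"
  shows "gd x y \<le> sqrt (min_energy N x y) + arc_const * min_energy N x y / N"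
proof -
  obtain z where "minimal_chain a x y N z" using minimal_chain_ex[OF xy N] by blast
  then interpret minimal_chain a x y N z .
  let ?d = "\<lambda>k. norm (z (Suc k) - z k)"
  have S: "(\<Sum>k<N. (?d k)\<^sup>2) = min_energy N x y / N"
    using Npos unfolding minimal[symmetric] energy_def by simp
  have "gd x y \<le> (\<Sum>k<N. gd (z k) (z (Suc k)))"
    using gd_chain[of N z] z_in_E z_start z_end by simp
  also have "\<dots> \<le> (\<Sum>k<N. ?d k * (1 + arc_const * ?d k))"
  proof (intro sum_mono gd_short_le z_in_E)
    fix k assume "k \<in> {..<N}"
    then have "(?d k)\<^sup>2 \<le> min_energy N x y / N" using steps_sq by simp
    then have "(?d k)\<^sup>2 \<le> 1" "(?d k)\<^sup>2 \<le> amin" using small by linarith+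
    moreover have "?d k \<le> 1" using \<open>(?d k)\<^sup>2 \<le> 1\<close> by (simp add: power_le_one_iff)
    ultimately show "short (z k) (z (Suc k))" by (simp add: short_def)
  qed
  also have "\<dots> = (\<Sum>k<N. ?d k) + arc_const * (\<Sum>k<N. (?d k)\<^sup>2)"
    unfolding sum_distrib_left sum.distrib[symmetric]
    by (intro sum.cong refl) (simp add: power2_eq_square algebra_simps)
  also have "(\<Sum>k<N. ?d k) \<le> sqrt (min_energy N x y)"
  proof (rule real_le_rsqrt)
    show "(\<Sum>k<N. ?d k)\<^sup>2 \<le> min_energy N x y"
      using sum_squared_le_sum_of_squares[of ?d "{..<N}"] Npos unfolding S by simp
  qed
  finally show ?thesis by (simp add: S)
qed

text \<open>For fixed \<open>N\<close>, \<open>dini_bound\<close> integrates the estimate of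
  \<open>energy_dini\<close>; then \<open>N\<close> tends to infinity. The distance
  \<open>\<eta>\<close> from the poles is uniform along the curve by compactness, and the energies
  are bounded by \<open>R\<^sup>2\<close> for all \<open>N\<close>.\<close>

lemma swapped_dist_interior:
  fixes lam :: "real \<Rightarrow> (real, 'n) vec"
  assumes tt: "t1 \<le> t2" and l: "\<And>u. u \<in> {t1..t2} \<Longrightarrow> lam u \<in> coord_interior"
    and der: "\<And>u k. u \<in> {t1..t2} \<Longrightarrow> ((\<lambda>v. lam v $ k) has_real_derivative d u k) (at u)"
    and speed: "\<And>u. u \<in> {t1..t2} \<Longrightarrow> (\<Sum>k\<in>UNIV. (d u k)\<^sup>2 * rho (point (lam u)) (lam u $ k)) \<le> 4 * B\<^sup>2" and B: "0 \<le> B"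
    and m: "m \<in> coord_interior" and s: "s \<in> signs" and top: "top_index \<notin> S"
  shows "gd (point (swap S (lam t2) m)) (reflect s (point (swap S m (lam t2)))) \<le>
     gd (point (swap S (lam t1) m)) (reflect s (point (swap S m (lam t1)))) + B * (t2 - t1)"
proof -
  define x where "x v = point (swap S (lam v) m)" for v
  define y where "y v = reflect s (point (swap S m (lam v)))" for v
  have xE: "x v \<in> E" and yE: "y v \<in> E" if "v \<in> {t1..t2}" for v
    using l[OF that] m s unfolding x_def y_def by (auto intro!: point_interior_in_E reflect_in_E swap_interior)
  have lcont: "continuous_on {t1..t2} (\<lambda>v. lam v $ k)" for k
    using der[of _ k] by (intro continuous_at_imp_continuous_on ballI) (auto dest: DERIV_isCont)
  have "\<exists>\<eta>>0. \<forall>u\<in>{t1..t2}. \<eta> \<le> \<bar>a $ i - lam u $ k\<bar>" for i k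
  proof -
    have "\<exists>u\<in>{t1..t2}. \<forall>v\<in>{t1..t2}. \<bar>a $ i - lam u $ k\<bar> \<le> \<bar>a $ i - lam v $ k\<bar>"
      using tt by (intro continuous_attains_inf continuous_intros lcont) auto
    then obtain u where u: "u \<in> {t1..t2}" "\<And>v. v \<in> {t1..t2} \<Longrightarrow> \<bar>a $ i - lam u $ k\<bar> \<le> \<bar>a $ i - lam v $ k\<bar>" by blast
    then show ?thesis using coord_interior_neq[OF l[OF u(1)], of i k] by (intro exI[of _ "\<bar>a $ i - lam u $ k\<bar>"]) auto
  qed
  then obtain h where h: "\<And>i k. 0 < h i k" "\<And>i k u. u \<in> {t1..t2} \<Longrightarrow> h i k \<le> \<bar>a $ i - lam u $ k\<bar>"
    by metis
  define \<eta> where "\<eta> = Min (range (\<lambda>(i, k). h i k))"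
  have \<eta>0: "0 < \<eta>" unfolding \<eta>_def using h(1) by (subst Min_gr_iff) auto
  have \<eta>: "\<eta> \<le> \<bar>a $ i - lam u $ k\<bar>" if "u \<in> {t1..t2}" for i k u
  proof -
    have "\<eta> \<le> h i k" unfolding \<eta>_def by (intro Min_le) (auto intro!: image_eqI[of _ _ "(i, k)"])
    then show ?thesis using h(2)[OF that, of i k] by linarith
  qed
  obtain R where R: "0 < R" "\<And>p q. p \<in> E \<Longrightarrow> q \<in> E \<Longrightarrow> gd p q \<le> R" using gd_bounded by blast
  have eR: "min_energy N (x v) (y v) \<le> R\<^sup>2" if "v \<in> {t1..t2}" "0 < N" for N v
  proof -
    have "(gd (x v) (y v))\<^sup>2 \<le> R\<^sup>2"
      using R(2)[OF xE yE] gd_nonneg[OF xE yE] that(1) by (intro power_mono) auto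
    then show ?thesis using min_energy_le_gd[OF xE[OF that(1)] yE[OF that(1)] that(2)] by linarith
  qed
  \<comment> \<open>\<open>C / N\<close> dominates the error
    \<open>drift \<eta> * (f u)\<^sup>2 / N\<close> for energies up to \<open>R\<^sup>2\<close>; the
    added 1 makes it positive.\<close>
  define C where "C = drift \<eta> * R ^ 4 + 1"
  have C: "0 < C" unfolding C_def using drift_nonneg[OF \<eta>0] by (simp add: add_nonneg_pos)
  have xcont: "continuous_on {t1..t2} x" and ycont: "continuous_on {t1..t2} y"
  proof -
    have sw: "continuous_on {t1..t2} (\<lambda>v. swap S (lam v) m)" "continuous_on {t1..t2} (\<lambda>v. swap S m (lam v))"
    proof -
      have "continuous_on {t1..t2} (\<lambda>v. if k \<in> S then m $ k else lam v $ k)"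
        "continuous_on {t1..t2} (\<lambda>v. if k \<in> S then lam v $ k else m $ k)" for k
        by (cases "k \<in> S"; simp add: lcont)+
      then show "continuous_on {t1..t2} (\<lambda>v. swap S (lam v) m)" "continuous_on {t1..t2} (\<lambda>v. swap S m (lam v))"
        unfolding swap_def by (auto intro!: continuous_on_vec_lambda)
    qed
    show "continuous_on {t1..t2} x" unfolding x_def
      by (rule continuous_on_compose2[OF continuous_on_point[of UNIV] sw(1)]) simp
    have "continuous_on {t1..t2} (\<lambda>v. point (swap S m (lam v)))"
      by (rule continuous_on_compose2[OF continuous_on_point[of UNIV] sw(2)]) simp
    then show "continuous_on {t1..t2} y" unfolding y_def
      by (rule bounded_linear.continuous_on[OF bounded_linear_reflect])
  qed
  \<comment> \<open>For \<open>N \<ge> K\<close> the smallness conditions of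
    \<open>energy_dini\<close> and \<open>gd_le_min_energy\<close> hold at once.\<close>
  define K where "K = max (amax / (amin)\<^sup>2) (max 1 (1 / amin)) * R\<^sup>2"
  have main: "gd (x t2) (y t2) \<le> sqrt ((gd (x t1) (y t1))\<^sup>2 + C / N) + B * (t2 - t1) + arc_const * R\<^sup>2 / N"
    if N: "2 \<le> N" "K \<le> real N" for N :: nat
  proof -
    define f where "f v = min_energy N (x v) (y v)" for v
    have f0: "0 \<le> f v" "f v \<le> R\<^sup>2" if "v \<in> {t1..t2}" for v
      using eR[OF that, of N] min_energy_nonneg[OF xE[OF that] yE[OF that], of N] N by (auto simp: f_def)
    have smallR: "k * f v / N \<le> 1" if v: "v \<in> {t1..t2}" and k: "0 \<le> k" "k \<le> max (amax / (amin)\<^sup>2) (max 1 (1 / amin))" for k v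
    proof -
      have "k * f v \<le> K" unfolding K_def using f0[OF v] k by (intro mult_mono) auto
      then show ?thesis using N by simp
    qed
    have Nc: "0 < C / real N" using C N by simp
    have "sqrt (f t2 + C / N) \<le> sqrt (f t1 + C / N) + B * (t2 - t1)"
    proof (rule dini_bound[OF tt])
      show "continuous_on {t1..t2} (\<lambda>v. sqrt (f v + C / N))"
        unfolding f_def using xE yE N by (intro continuous_intros continuous_on_min_energy xcont ycont) auto
      fix u e :: real assume u: "t1 \<le> u" "u < t2" and e: "0 < e"
      then have uI: "u \<in> {t1..t2}" by simp
      have "\<forall>\<^sub>F v in at_right u. v \<in> {u<..<t2}" using u(2) by (rule eventually_at_right_real)
      then have ev: "\<forall>\<^sub>F v in at_right u. lam v \<in> coord_interior"
        by eventually_elim (use l u in auto)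
      have "(f u)\<^sup>2 \<le> (R\<^sup>2)\<^sup>2" using f0[OF uI] by (intro power_mono) auto
      then have "drift \<eta> * (f u)\<^sup>2 / real N \<le> C / N"
        using drift_nonneg[OF \<eta>0] unfolding C_def
        by (intro divide_right_mono add_increasing2 mult_left_mono) (auto simp: power_mult[symmetric])
      moreover have "amax / (amin)\<^sup>2 * f u / N \<le> 1"
        using axes_pos by (intro smallR[OF uI]) (auto simp: less_imp_le)
      ultimately show "\<forall>\<^sub>F v in at_right u. sqrt (f v + C / N) \<le> sqrt (f u + C / N) + (B + e) * (v - u)"
        by (intro energy_dini[OF l[OF uI] ev der[OF uI] speed[OF uI] B m s top _ _ \<eta>0 \<eta>[OF uI] Nc _ N(1) e])
          (simp_all add: f_def x_def y_def)
    qed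
    also have "\<dots> \<le> sqrt ((gd (x t1) (y t1))\<^sup>2 + C / N) + B * (t2 - t1)"
      using min_energy_le_gd[OF xE yE, of t1 t1 N] tt N by (simp add: f_def)
    finally have 1: "sqrt (f t2 + C / N) \<le> sqrt ((gd (x t1) (y t1))\<^sup>2 + C / N) + B * (t2 - t1)" .
    have t2: "t2 \<in> {t1..t2}" using tt by simp
    have "1 * f t2 / N \<le> 1" "1 / amin * f t2 / N \<le> 1"
      using axes_pos by (intro smallR[OF t2]; simp add: less_imp_le)+
    then have "gd (x t2) (y t2) \<le> sqrt (f t2) + arc_const * f t2 / N"
      unfolding f_def using axes_pos[of top_index] N
      by (intro gd_le_min_energy xE yE t2) (auto simp: field_simps)
    also have "\<dots> \<le> sqrt (f t2 + C / N) + arc_const * R\<^sup>2 / N"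
      using Nc f0[OF t2] arc_const_pos by (intro add_mono divide_right_mono mult_left_mono) auto
    finally show ?thesis using 1 by linarith
  qed
  have "(\<lambda>N. sqrt ((gd (x t1) (y t1))\<^sup>2 + C / real N) + B * (t2 - t1) + arc_const * R\<^sup>2 / real N)
     \<longlonglongrightarrow> sqrt ((gd (x t1) (y t1))\<^sup>2 + 0) + B * (t2 - t1) + 0"
    by (intro tendsto_intros lim_const_over_n)
  moreover have "\<forall>\<^sub>F N in sequentially. gd (x t2) (y t2) \<le>
      sqrt ((gd (x t1) (y t1))\<^sup>2 + C / real N) + B * (t2 - t1) + arc_const * R\<^sup>2 / real N"
  proof -
    obtain N0 :: nat where "K \<le> real N0" using real_arch_simple by blast
    then show ?thesis
      unfolding eventually_sequentially
      by (intro exI[of _ "max 2 N0"] allI impI main) (auto intro: order_trans)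
  qed
  ultimately have "gd (x t2) (y t2) \<le> sqrt ((gd (x t1) (y t1))\<^sup>2 + 0) + B * (t2 - t1) + 0"
    by (rule tendsto_lowerbound) simp
  then show ?thesis
    using gd_nonneg[OF xE yE, of t1 t1] tt by (simp add: x_def y_def)
qed

end

section \<open>Crossing the coordinate hyperplanes\<close>

lemma piecewise_increment_bound:
  fixes f :: "real \<Rightarrow> real"
  assumes "finite K" "t1 \<le> t2"
    and "\<And>u v. t1 \<le> u \<Longrightarrow> u < v \<Longrightarrow> v \<le> t2 \<Longrightarrow> K \<inter> {u<..<v} = {} \<Longrightarrow> f v \<le> f u + B * (v - u)"
  shows "f t2 \<le> f t1 + B * (t2 - t1)"
  using assms(2,3)
proof (induction "card (K \<inter> {t1<..<t2})" arbitrary: t1 t2 rule: less_induct)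
  case less
  show ?case
  proof (cases "K \<inter> {t1<..<t2} = {}")
    case True
    then show ?thesis using less.prems(1) less.prems(2)[of t1 t2] by (cases "t1 = t2") auto
  next
    case False
    then obtain c where c: "c \<in> K" "t1 < c" "c < t2" by auto
    have fin: "finite (K \<inter> {t1<..<t2})" using \<open>finite K\<close> by simp
    have "card (K \<inter> {t1<..<c}) < card (K \<inter> {t1<..<t2})" "card (K \<inter> {c<..<t2}) < card (K \<inter> {t1<..<t2})"
    proof -
      have "K \<inter> {t1<..<c} \<subseteq> K \<inter> {t1<..<t2}" "K \<inter> {c<..<t2} \<subseteq> K \<inter> {t1<..<t2}"
        "c \<in> K \<inter> {t1<..<t2}" "c \<notin> K \<inter> {t1<..<c}" "c \<notin> K \<inter> {c<..<t2}"
        using c by auto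
      then show "card (K \<inter> {t1<..<c}) < card (K \<inter> {t1<..<t2})" "card (K \<inter> {c<..<t2}) < card (K \<inter> {t1<..<t2})"
        by (metis fin psubsetI psubset_card_mono)+
    qed
    then have "f c \<le> f t1 + B * (c - t1)" "f t2 \<le> f c + B * (t2 - c)"
      using less.hyps[of t1 c] less.hyps[of c t2] c less.prems(2) by simp_all
    then show ?thesis by (simp add: algebra_simps)
  qed
qed

lemma increment_bound_closure:
  fixes g :: "real \<Rightarrow> real"
  assumes "t1 < t2" "continuous_on {t1..t2} g"
    and "\<And>u v. t1 < u \<Longrightarrow> u \<le> v \<Longrightarrow> v < t2 \<Longrightarrow> g v \<le> g u + B * (v - u)"
  shows "g t2 \<le> g t1 + B * (t2 - t1)"
proof -
  have half: "\<forall>\<^sub>F e in at_right 0. e \<in> {0<..<(t2 - t1) / 2}"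
    using assms(1) by (intro eventually_at_right_real) simp
  have lim: "((\<lambda>e. g (h e)) \<longlongrightarrow> g (h 0)) (at_right 0)"
    if "(h \<longlongrightarrow> h 0) (at_right 0)" "\<And>e. e \<in> {0<..<(t2 - t1) / 2} \<Longrightarrow> h e \<in> {t1..t2}" "h 0 \<in> {t1..t2}" for h :: "real \<Rightarrow> real"
    by (rule continuous_on_tendsto_compose[OF assms(2) that(1,3)]) (rule eventually_mono[OF half that(2)])
  have "((\<lambda>e. g (t1 + e) + B * ((t2 - e) - (t1 + e))) \<longlongrightarrow> g (t1 + 0) + B * ((t2 - 0) - (t1 + 0))) (at_right 0)"
    by (intro tendsto_intros lim[of "\<lambda>e. t1 + e"]) (use assms(1) in auto)
  moreover have "((\<lambda>e. g (t2 - e)) \<longlongrightarrow> g (t2 - 0)) (at_right 0)"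
    by (intro lim[of "\<lambda>e. t2 - e"] tendsto_intros) (use assms(1) in auto)
  moreover have "\<forall>\<^sub>F e in at_right 0. g (t2 - e) \<le> g (t1 + e) + B * ((t2 - e) - (t1 + e))"
    using half
  proof eventually_elim
    case (elim e)
    then show ?case using assms(3)[of "t1 + e" "t2 - e"] by (simp add: field_simps)
  qed
  ultimately have "g (t2 - 0) \<le> g (t1 + 0) + B * ((t2 - 0) - (t1 + 0))"
    by (intro tendsto_le[OF trivial_limit_at_right_real])
  then show ?thesis by simp
qed

context confocal
begin

text \<open>Moving along the vector \<open>1\<close> makes every coordinate nonzero for all small
  positive \<open>t\<close>; radial projection only multiplies by a positive factor.\<close>

lemma generic_points_dense:
  assumes p: "p \<in> E" and e: "0 < e"
  shows "\<exists>q\<in>E. norm (q - p) < e \<and> (\<forall>i. q $ i \<noteq> 0)"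
proof -
  define r where "r t = p + t *\<^sub>R (1 :: (real, 'n) vec)" for t
  have "(r \<longlongrightarrow> p + 0 *\<^sub>R 1) (at_right 0)"
    unfolding r_def by (intro tendsto_intros)
  then have "((\<lambda>t. proj (r t)) \<longlongrightarrow> proj p) (at_right 0)"
    by (intro isCont_tendsto_compose[OF continuous_proj[OF E_nonzero[OF p]]]) simp
  then have "\<forall>\<^sub>F t in at_right 0. norm (proj (r t) - p) < e"
    using e by (simp add: proj_E[OF p] tendsto_iff dist_norm)
  moreover have "\<forall>\<^sub>F t in at_right 0. \<forall>i. r t $ i \<noteq> 0"
  proof (rule eventually_all_finite)
    fix i
    show "\<forall>\<^sub>F t in at_right 0. r t $ i \<noteq> 0"
    proof (cases "0 \<le> p $ i")
      case True
      then show ?thesis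
        using eventually_at_right_less[of 0] by (auto elim!: eventually_mono simp: r_def)
    next
      case False
      then have "\<forall>\<^sub>F t in at_right 0. t \<in> {0<..<- p $ i}" by (intro eventually_at_right_real) simp
      then show ?thesis by (auto elim!: eventually_mono simp: r_def)
    qed
  qed
  ultimately have "\<forall>\<^sub>F t in at_right 0. norm (proj (r t) - p) < e \<and> (\<forall>i. r t $ i \<noteq> 0)"
    by (rule eventually_conj)
  then obtain t where t: "norm (proj (r t) - p) < e" "\<And>i. r t $ i \<noteq> 0"
    using eventually_happens'[OF trivial_limit_at_right_real] by blast
  have "r t \<noteq> 0" using t(2) by auto
  then have "proj (r t) \<in> E" "0 < Q 0 (r t) (r t)" by (auto intro: proj_in_E Q0_pos)
  then show ?thesis using t by (intro bexI[of _ "proj (r t)"]) (auto simp: proj_def)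
qed

text \<open>Zero coordinates count as positive, so that the value always lies in
  \<open>signs\<close>.\<close>

definition sgv :: "(real, 'n) vec \<Rightarrow> (real, 'n) vec" where
  "sgv p = (\<chi> i. if p $ i < 0 then - 1 else 1)"

lemma sgv_signs: "sgv p \<in> signs"
  by (simp add: sgv_def signs_def)

text \<open>This is \<Psi> of the overview for \<open>x = p\<close> and \<open>y = point m\<close>,
  with \<open>s\<close> the orthant of \<open>p\<close>: reflecting both points by \<open>s\<close>
  moves the signs of \<open>p\<close> to the second point before the swap.\<close>

definition swapped_dist :: "'n set \<Rightarrow> (real, 'n) vec \<Rightarrow> (real, 'n) vec \<Rightarrow> (real, 'n) vec \<Rightarrow> real" where
  "swapped_dist S m s p = gd (point (swap S (coords p) m)) (reflect s (point (swap S m (coords p))))"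

text \<open>A sign can only change where \<open>p\<close> has a zero coordinate; there one of the two swapped points
  lies on the mirror.\<close>

lemma swapped_dist_sign_change:
  assumes p: "p \<in> E" and s: "s \<in> signs" "s' \<in> signs" and eq: "\<And>i. p $ i \<noteq> 0 \<Longrightarrow> s $ i = s' $ i"
  shows "swapped_dist S m s p = swapped_dist S m s' p"
proof -
  define x where "x = point (swap S (coords p) m)"
  define y where "y = point (swap S m (coords p))"
  have xy: "x $ i = 0 \<or> y $ i = 0" if "p $ i = 0" for i
  proof -
    have "coord_sq (coords p) i = 0" using coords_square[OF p, of i] that by simp
    then obtain j where "coords p $ j = a $ i" by (auto simp: coord_sq_eq_0)
    then show ?thesis
      by (cases "j \<in> S") (auto simp: x_def y_def coord_sq_eq_0 swap_nth intro!: exI[of _ j])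
  qed
  \<comment> \<open>\<open>r\<close> fixes \<open>x\<close>. Where \<open>s\<close> and
    \<open>s'\<close> differ it either exchanges them, if \<open>x $ i = 0\<close>, or acts where
    \<open>y $ i = 0\<close>.\<close>
  define r where "r = (\<chi> i. if s $ i \<noteq> s' $ i \<and> x $ i = 0 then - 1 else (1::real))"
  have r: "r \<in> signs" by (simp add: r_def signs_def)
  have "gd x (reflect s y) = gd (reflect r x) (reflect r (reflect s y))" by (simp add: gd_reflect[OF r])
  also have "reflect r x = x" by (simp add: vec_eq_iff r_def)
  also have "reflect r (reflect s y) = reflect s' y"
  proof -
    have "r $ i * (s $ i * y $ i) = s' $ i * y $ i" for i
    proof (cases "s $ i = s' $ i")
      case True then show ?thesis by (simp add: r_def)
    next
      case False
      then have "x $ i = 0 \<or> y $ i = 0" using eq[of i] xy[of i] by blast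
      moreover have "\<bar>s $ i\<bar> = 1" "\<bar>s' $ i\<bar> = 1" using s by (auto simp: signs_def)
      then have "s' $ i = - s $ i" using False by linarith
      ultimately show ?thesis by (auto simp: r_def)
    qed
    then show ?thesis by (simp add: vec_eq_iff)
  qed
  finally show ?thesis by (simp add: swapped_dist_def x_def y_def)
qed

lemma rho_absv: "rho (absv p) t = rho p t"
  by (simp add: rho_def power_divide)

end

context confocal_proper
begin

lemma continuous_on_swapped_dist:
  assumes f: "continuous_on T f" "f ` T \<subseteq> E" and m: "m \<in> coord_box" and s: "s \<in> signs"
  shows "continuous_on T (\<lambda>t. swapped_dist S m s (f t))"
proof -
  have Lf: "continuous_on T (\<lambda>t. coords (f t))"
    by (rule continuous_on_compose2[OF continuous_on_coords f])
  have c: "continuous_on T (\<lambda>t. if k \<in> S then m $ k else coords (f t) $ k)"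
    "continuous_on T (\<lambda>t. if k \<in> S then coords (f t) $ k else m $ k)" for k
    using Lf by (cases "k \<in> S"; auto intro!: continuous_intros)+
  have sw: "continuous_on T (\<lambda>t. swap S (coords (f t)) m)" "continuous_on T (\<lambda>t. swap S m (coords (f t)))"
    unfolding swap_def by (auto intro!: continuous_on_vec_lambda c)
  have X1: "continuous_on T (\<lambda>t. point (swap S (coords (f t)) m))"
    by (rule continuous_on_compose2[OF continuous_on_point[of UNIV] sw(1)]) simp
  have "continuous_on T (\<lambda>t. point (swap S m (coords (f t))))"
    by (rule continuous_on_compose2[OF continuous_on_point[of UNIV] sw(2)]) simp
  then have X2: "continuous_on T (\<lambda>t. reflect s (point (swap S m (coords (f t)))))"
    by (rule bounded_linear.continuous_on[OF bounded_linear_reflect])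
  have "coords (f t) \<in> coord_box" if "t \<in> T" for t using f(2) that by (intro coords_in_box) auto
  then show ?thesis
    unfolding swapped_dist_def
    by (intro continuous_on_gd_compose X1 X2) (auto intro!: point_in_E reflect_in_E s swap_box m)
qed

text \<open>Between zeros of the coordinates the signs are constant and the elliptic coordinates
  differentiable, so \<open>swapped_dist_interior\<close> applies. The ends are reached by
  continuity with these signs, which \<open>swapped_dist_sign_change\<close> then replaces by those
  of the ends.\<close>

lemma swapped_dist_arc_piece:
  assumes p: "p \<in> E" and q: "q \<in> E" and sh: "short p q" and m: "m \<in> coord_interior" and top: "top_index \<notin> S"
    and t: "0 \<le> t1" "t1 < t2" "t2 \<le> 1"
    and nz: "\<And>t i. t1 < t \<Longrightarrow> t < t2 \<Longrightarrow> (1 - t) * p $ i + t * q $ i \<noteq> 0"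
  shows "swapped_dist S m (sgv (arc p q t2)) (arc p q t2) \<le> swapped_dist S m (sgv (arc p q t1)) (arc p q t1) +
    norm (q - p) * (1 + arc_const * norm (q - p)) * (t2 - t1)"
proof -
  define B where "B = norm (q - p) * (1 + arc_const * norm (q - p))"
  have B0: "0 \<le> B" unfolding B_def using arc_const_pos by (intro mult_nonneg_nonneg add_nonneg_nonneg) auto
  define r where "r t = (1 - t) *\<^sub>R p + t *\<^sub>R q" for t
  have ri: "r t $ i = (1 - t) * p $ i + t * q $ i" for t i by (simp add: r_def)
  have r0: "r t \<noteq> 0" and dB: "norm (arc_deriv p q t) \<le> B" if "t \<in> {0..1}" for t
    using arc_deriv_short[OF p q sh that] by (auto simp: r_def B_def)
  have pos: "0 < Q 0 (r t) (r t)" if "t \<in> {0..1}" for t by (rule Q0_pos[OF r0[OF that]])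
  have arc_i: "arc p q t $ i = r t $ i / sqrt (Q 0 (r t) (r t))" for t i
    by (simp add: arc_def proj_def r_def)
  have arcE: "arc p q t \<in> E" if "t \<in> {0..1}" for t
    unfolding arc_def using r0[OF that] by (intro proj_in_E) (simp add: r_def)
  have arcD: "(arc p q has_vector_derivative arc_deriv p q t) (at t)" if "t \<in> {0..1}" for t
    using r0[OF that] by (intro arc_has_derivative) (simp add: r_def)
  have arc_nz: "arc p q t $ i \<noteq> 0" if "t1 < t" "t < t2" for t i
    using nz[OF that, of i] pos[of t] that t by (simp add: arc_i ri)
  define s where "s = sgv (arc p q ((t1 + t2) / 2))"
  have s: "s \<in> signs" unfolding s_def by (rule sgv_signs)
  have sign_eq: "swapped_dist S m (sgv (arc p q u)) (arc p q u) = swapped_dist S m s (arc p q u)" if u: "u \<in> {t1..t2}" for u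
  proof (rule swapped_dist_sign_change[OF arcE sgv_signs s])
    show "u \<in> {0..1}" using u t by auto
    fix i assume "arc p q u $ i \<noteq> 0"
    then have ru: "r u $ i \<noteq> 0" by (auto simp: arc_i)
    let ?c = "(t1 + t2) / 2"
    have rc: "r ?c $ i \<noteq> 0" using nz[of ?c i] t by (simp add: ri)
    have "r u $ i < 0 \<longleftrightarrow> r ?c $ i < 0"
    proof (rule ccontr)
      assume ne: "\<not> ?thesis"
      define f where "f v = r v $ i" for v
      have fa: "f v = p $ i + v * (q $ i - p $ i)" for v by (simp add: f_def ri algebra_simps)
      \<comment> \<open>The zero of the affine function \<open>f\<close> between \<open>u\<close>
        and the midpoint; it lies strictly inside the interval, even if \<open>u\<close> is one of
        its ends.\<close>
      define v where "v = u + (?c - u) * (f u / (f u - f ?c))"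
      have opp: "f u < 0 \<and> 0 < f ?c \<or> 0 < f u \<and> f ?c < 0" using ne ru rc by (auto simp: f_def)
      then have frac: "0 < f u / (f u - f ?c)" "f u / (f u - f ?c) < 1"
        by (auto simp: divide_simps zero_less_mult_iff)
      have "f (u + (c - u) * w) = f u + (f c - f u) * w" for c w
        unfolding fa by (simp add: algebra_simps)
      then have "f v = f u + (f ?c - f u) * (f u / (f u - f ?c))" by (simp only: v_def)
      also have "\<dots> = 0" using opp by (auto simp: field_simps)
      finally have "f v = 0" .
      moreover have "t1 < v \<and> v < t2"
      proof -
        define w where "w = f u / (f u - f ?c)"
        have w: "0 < w" "w < 1" using frac by (auto simp: w_def)
        have "v = u - w * u + (w * t1 + w * t2) / 2" by (simp add: v_def w_def[symmetric] field_simps)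
        moreover have "(1 - w) * t1 \<le> (1 - w) * u" "(1 - w) * u \<le> (1 - w) * t2"
          using w u by (auto intro!: mult_left_mono)
        then have "t1 - w * t1 \<le> u - w * u" "u - w * u \<le> t2 - w * t2" by (simp_all add: left_diff_distrib)
        moreover have "w * t1 < w * t2" using w t by (auto intro!: mult_strict_left_mono)
        moreover have "t1 < v' \<and> v' < t2"
          if "v' = p' + (A + C) / 2" "t1 - A \<le> p'" "p' \<le> t2 - C" "A < C" for v' p' A C :: real
          using that by (simp add: field_simps)
        ultimately show ?thesis by blast
      qed
      ultimately show False using nz[of v i] by (simp add: f_def ri)
    qed
    moreover have "?c \<in> {0..1}" "u \<in> {0..1}" using u t by auto
    ultimately show "sgv (arc p q u) $ i = s $ i"
      using pos[of u] pos[of ?c] by (simp add: sgv_def s_def arc_i divide_less_0_iff)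
  qed
  have "swapped_dist S m s (arc p q t2) \<le> swapped_dist S m s (arc p q t1) + B * (t2 - t1)"
  proof (rule increment_bound_closure[OF t(2)])
    have "continuous_on {t1..t2} (arc p q)"
      using t by (intro continuous_at_imp_continuous_on ballI has_vector_derivative_continuous[OF arcD]) auto
    then show "continuous_on {t1..t2} (\<lambda>t. swapped_dist S m s (arc p q t))"
      using arcE t m coord_interior_subset s by (intro continuous_on_swapped_dist) auto
    fix u v assume uv: "t1 < u" "u \<le> v" "v < t2"
    define d where "d w k = - 2 * Q (coords (arc p q w) $ k) (arc p q w) (arc_deriv p q w) / rho (arc p q w) (coords (arc p q w) $ k)" for w k
    have in01: "w \<in> {0..1}" if "w \<in> {t1<..<t2}" for w using that t by auto
    have int: "coords (arc p q w) \<in> coord_interior" "\<And>k. Q (coords (arc p q w) $ k) (arc p q w) (arc p q w) = 1"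
      if "w \<in> {t1<..<t2}" for w
      using coords_interior[OF arcE[OF in01[OF that]]] arc_nz that by auto
    show "swapped_dist S m s (arc p q v) \<le> swapped_dist S m s (arc p q u) + B * (v - u)"
      unfolding swapped_dist_def
    proof (rule swapped_dist_interior[OF uv(2) _ _ _ B0 m s top])
      fix w assume w: "w \<in> {u..v}"
      then have w': "w \<in> {t1<..<t2}" using uv by auto
      show "coords (arc p q w) \<in> coord_interior" by (rule int[OF w'])
      show "((\<lambda>v. coords (arc p q v) $ k) has_real_derivative d w k) (at w)" for k
        unfolding d_def
        by (rule coords_has_derivative[OF arcD[OF in01[OF w']] open_greaterThanLessThan w'])
          (use arcE in01 arc_nz in auto)
      \<comment> \<open>The factor 2 in the derivative of the coordinates yields the 4;
        \<open>xi_parseval\<close> sums the remaining terms to the squared speed of the arc.\<close>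
      have "(d w k)\<^sup>2 * rho (point (coords (arc p q w))) (coords (arc p q w) $ k) =
          4 * ((Q (coords (arc p q w) $ k) (arc p q w) (arc_deriv p q w))\<^sup>2 / rho (arc p q w) (coords (arc p q w) $ k))" for k
        unfolding point_coords[OF arcE[OF in01[OF w']]] rho_absv
        using rho_pos[OF int(2)[OF w', of k]] by (simp add: d_def power2_eq_square)
      then have "(\<Sum>k\<in>UNIV. (d w k)\<^sup>2 * rho (point (coords (arc p q w))) (coords (arc p q w) $ k)) = 4 * (norm (arc_deriv p q w))\<^sup>2"
        unfolding xi_parseval[OF int[OF w'], symmetric] by (simp add: sum_distrib_left)
      also have "\<dots> \<le> 4 * B\<^sup>2"
        using dB[OF in01[OF w']] by (intro mult_left_mono power_mono) auto
      finally show "(\<Sum>k\<in>UNIV. (d w k)\<^sup>2 * rho (point (coords (arc p q w))) (coords (arc p q w) $ k)) \<le> 4 * B\<^sup>2" .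
    qed
  qed
  then show ?thesis using sign_eq[of t1] sign_eq[of t2] t by (simp add: B_def)
qed

text \<open>Along the chord each coordinate is an affine function of \<open>t\<close> that is
  nonzero at \<open>p\<close>, so it has at most one zero.\<close>

lemma swapped_dist_arc:
  assumes p: "p \<in> E" and q: "q \<in> E" and sh: "short p q" and m: "m \<in> coord_interior" and top: "top_index \<notin> S"
    and nz: "\<And>i. p $ i \<noteq> 0"
  shows "swapped_dist S m (sgv q) q \<le> swapped_dist S m (sgv p) p + norm (q - p) * (1 + arc_const * norm (q - p))"
proof -
  define K where "K = (\<Union>i\<in>UNIV. {t. (1 - t) * p $ i + t * q $ i = 0})"
  define f where "f t = swapped_dist S m (sgv (arc p q t)) (arc p q t)" for t
  have "finite {t. (1 - t) * p $ i + t * q $ i = 0}" for i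
  proof (rule finite_subset)
    show "{t. (1 - t) * p $ i + t * q $ i = 0} \<subseteq> {p $ i / (p $ i - q $ i)}"
    proof
      fix t assume "t \<in> {t. (1 - t) * p $ i + t * q $ i = 0}"
      then have eq: "t * (p $ i - q $ i) = p $ i" by (simp add: algebra_simps)
      then have "p $ i - q $ i \<noteq> 0" using nz[of i] by auto
      then show "t \<in> {p $ i / (p $ i - q $ i)}" using eq by (simp add: field_simps)
    qed
  qed simp
  then have finK: "finite K" by (simp add: K_def)
  have "f 1 \<le> f 0 + norm (q - p) * (1 + arc_const * norm (q - p)) * (1 - 0)"
  proof (rule piecewise_increment_bound[OF finK])
    fix u v :: real assume "0 \<le> u" "u < v" "v \<le> 1" "K \<inter> {u<..<v} = {}"
    then show "f v \<le> f u + norm (q - p) * (1 + arc_const * norm (q - p)) * (v - u)"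
      unfolding f_def K_def by (intro swapped_dist_arc_piece p q sh m top) (auto, force)
  qed simp
  then show ?thesis by (simp add: f_def arc_ends p q)
qed

lemma coords_point: "l \<in> coord_interior \<Longrightarrow> s \<in> signs \<Longrightarrow> coords (reflect s (point l)) = l"
  by (intro coords_unique) (simp_all add: Q_reflect Q_point_coord)

text \<open>\<open>F\<close> vanishes at \<open>point m\<close>, where the swap exchanges equal
  coordinates. Summing its increments along short central arcs that follow the curve back to its
  start bounds \<open>F\<close> there by the length.\<close>

lemma swapped_dist_le_length:
  assumes l: "l \<in> coord_interior" and m: "m \<in> coord_interior" and s: "s \<in> signs" and top: "top_index \<notin> S"
    and len: "len \<in> curve_lengths E (reflect s (point l)) (point m)"
  shows "gd (point (swap S l m)) (reflect s (point (swap S m l))) \<le> len"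
proof -
  let ?x = "reflect s (point l)" and ?y = "point m"
  define F where "F p = swapped_dist S m (sgv p) p" for p
  have Xpos: "0 < point l $ i" if "l \<in> coord_interior" for l i using coord_sq_pos[OF that] by simp
  have "sgv ?x = s"
  proof -
    have "(s $ i * point l $ i < 0 \<longrightarrow> s $ i = - 1) \<and> (\<not> s $ i * point l $ i < 0 \<longrightarrow> s $ i = 1)" for i
      using Xpos[OF l, of i] s unfolding signs_def
      by (auto simp: mult_less_0_iff abs_if simp del: point_nth split: if_splits)
    then show ?thesis by (simp add: sgv_def vec_eq_iff)
  qed
  then have Fx: "F ?x = gd (point (swap S l m)) (reflect s (point (swap S m l)))"
    by (simp add: F_def swapped_dist_def coords_point[OF l s])
  have "\<not> ?y $ i < 0" for i using Xpos[OF m, of i] by simp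
  then have one: "sgv ?y = 1" by (simp add: sgv_def vec_eq_iff del: point_nth)
  have "reflect 1 ?y = ?y" "(1 :: (real, 'n) vec) \<in> signs" by (simp_all add: vec_eq_iff signs_def)
  moreover from this have "coords ?y = m" using coords_point[OF m, of 1] by simp
  moreover have "swap S m m = m" by (simp add: vec_eq_iff swap_nth)
  ultimately have Fy: "F ?y = 0"
    by (simp add: F_def swapped_dist_def one gd_refl point_interior_in_E m)
  have nzx: "?x $ i \<noteq> 0" for i
  proof -
    have "s $ i \<noteq> 0" using s by (auto simp: signs_def dest: spec[of _ i])
    then show ?thesis using Xpos[OF l, of i] by (simp del: point_nth)
  qed
  have nzy: "?y $ i \<noteq> 0" for i using Xpos[OF m, of i] by simp
  have xE: "?x \<in> E" and yE: "?y \<in> E" by (auto intro!: reflect_in_E s point_interior_in_E l m)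
  have len0: "0 \<le> len" using curve_lengths_nonneg[OF len] .
  \<comment> \<open>A step \<open>len / N\<close> plus a displacement of at most
    \<open>1 / N\<^sup>2\<close> at each of its ends; the displacements are so small that
    \<open>N * h N\<close> still tends to \<open>len\<close>.\<close>
  define h where "h N = len / real N + 2 / (real N)\<^sup>2" for N
  have step: "F ?x \<le> real N * (h N * (1 + arc_const * h N))"
    if N: "0 < N" "h N \<le> 1" "(h N)\<^sup>2 \<le> amin" for N
  proof -
    obtain z where z: "z 0 = ?x" "z N = ?y" "\<And>k. z k \<in> E" "\<And>k. k < N \<Longrightarrow> norm (z (Suc k) - z k) \<le> len / N"
      using curve_lengths_equal_steps[OF len N(1)] by blast
    \<comment> \<open>\<open>swapped_dist_arc\<close> starts from a point without zero coordinates,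
      so the inner points of the chain are perturbed; the two ends have this property
      already.\<close>
    have "\<exists>q\<in>E. norm (q - z k) \<le> 1 / (real N)\<^sup>2 \<and> (\<forall>i. q $ i \<noteq> 0) \<and> (k = 0 \<longrightarrow> q = ?x) \<and> (k = N \<longrightarrow> q = ?y)" for k
    proof (cases "k = 0 \<or> k = N")
      case True
      then show ?thesis using z(1,2) xE yE nzx nzy N(1) by (auto simp del: point_nth reflect_nth)
    next
      case False
      have "0 < 1 / (real N)\<^sup>2" using N(1) by simp
      from generic_points_dense[OF z(3)[of k] this] False show ?thesis by (auto intro: less_imp_le)
    qed
    then obtain w where w: "\<And>k. w k \<in> E" "\<And>k. norm (w k - z k) \<le> 1 / (real N)\<^sup>2" "\<And>k i. w k $ i \<noteq> 0" "w 0 = ?x" "w N = ?y"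
      by metis
    have steps: "norm (w k - w (Suc k)) \<le> h N" if "k < N" for k
    proof -
      have "norm (w k - w (Suc k)) \<le> norm (w k - z k) + norm (z (Suc k) - z k) + norm (w (Suc k) - z (Suc k))"
        using norm_triangle_ineq4[of "(w k - z k) - (z (Suc k) - z k)" "w (Suc k) - z (Suc k)"]
          norm_triangle_ineq4[of "w k - z k" "z (Suc k) - z k"]
        by (simp add: algebra_simps)
      also have "\<dots> \<le> h N" using w(2)[of k] w(2)[of "Suc k"] z(4)[OF that] by (simp add: h_def)
      finally show ?thesis .
    qed
    have h0: "0 \<le> h N" using len0 by (simp add: h_def)
    have "F (w k) \<le> F (w (Suc k)) + h N * (1 + arc_const * h N)" if "k < N" for k
    proof -
      have "(norm (w k - w (Suc k)))\<^sup>2 \<le> (h N)\<^sup>2" using steps[OF that] by (intro power_mono) auto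
      then have "short (w (Suc k)) (w k)" using steps[OF that] N by (simp add: short_def)
      then have "F (w k) \<le> F (w (Suc k)) + norm (w k - w (Suc k)) * (1 + arc_const * norm (w k - w (Suc k)))"
        unfolding F_def by (intro swapped_dist_arc w m top)
      also have "\<dots> \<le> F (w (Suc k)) + h N * (1 + arc_const * h N)"
        using steps[OF that] h0 arc_const_pos by (intro add_left_mono mult_mono) auto
      finally show ?thesis .
    qed
    then have "F (w 0) \<le> F (w k) + real k * (h N * (1 + arc_const * h N))" if "k \<le> N" for k
      using that by (induction k) (auto simp: distrib_right intro: order_trans)
    from this[of N] show ?thesis using w(4,5) Fy by simp
  qed
  have hlim: "h \<longlonglongrightarrow> 0"
  proof -
    have "(\<lambda>N. (2 / real N) * (1 / real N)) \<longlonglongrightarrow> 0 * 0"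
      by (intro tendsto_mult lim_const_over_n)
    then have "(\<lambda>N. 2 / (real N)\<^sup>2) \<longlonglongrightarrow> 0" by (simp add: power2_eq_square)
    then have "(\<lambda>N. len / real N + 2 / (real N)\<^sup>2) \<longlonglongrightarrow> 0 + 0"
      by (intro tendsto_add lim_const_over_n)
    then show ?thesis by (simp add: h_def[abs_def])
  qed
  have Nh: "(\<lambda>N. real N * h N) \<longlonglongrightarrow> len"
  proof -
    have "(\<lambda>N. len + 2 / real N) \<longlonglongrightarrow> len + 0" by (intro tendsto_intros lim_const_over_n)
    moreover have "\<forall>\<^sub>F N in sequentially. len + 2 / real N = real N * h N"
      using eventually_gt_at_top[of 0] by eventually_elim (simp add: h_def field_simps power2_eq_square)
    ultimately have "(\<lambda>N. real N * h N) \<longlonglongrightarrow> len + 0" by (rule Lim_transform_eventually)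
    then show ?thesis by simp
  qed
  have "(\<lambda>N. real N * h N * (1 + arc_const * h N)) \<longlonglongrightarrow> len * (1 + arc_const * 0)"
    by (intro tendsto_intros Nh hlim)
  moreover have "\<forall>\<^sub>F N in sequentially. F ?x \<le> real N * h N * (1 + arc_const * h N)"
  proof -
    have "(\<lambda>N. (h N)\<^sup>2) \<longlonglongrightarrow> 0\<^sup>2" by (intro tendsto_intros hlim)
    then have "(\<lambda>N. (h N)\<^sup>2) \<longlonglongrightarrow> 0" by simp
    from order_tendstoD(2)[OF this axes_pos] have "\<forall>\<^sub>F N in sequentially. (h N)\<^sup>2 < amin" .
    moreover have "\<forall>\<^sub>F N in sequentially. h N < 1" using order_tendstoD(2)[OF hlim] by simp
    ultimately show ?thesis using eventually_gt_at_top[of 0]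
    proof eventually_elim
      case (elim N)
      then show ?case using step[of N] by (simp add: mult.assoc less_imp_le)
    qed
  qed
  ultimately have "F ?x \<le> len * (1 + arc_const * 0)" by (rule tendsto_lowerbound) simp
  then show ?thesis by (simp add: Fx)
qed

lemma swapped_dist_le:
  assumes l: "l \<in> coord_interior" and m: "m \<in> coord_interior" and s: "s \<in> signs" and top: "top_index \<notin> S"
  shows "gd (point (swap S l m)) (reflect s (point (swap S m l))) \<le> gd (point l) (reflect s (point m))"
proof -
  have "gd (point (swap S l m)) (reflect s (point (swap S m l))) \<le> gd (reflect s (point l)) (point m)"
    unfolding geodesic_dist_eq_Inf[of E "reflect s (point l)"]
    by (intro cInf_greatest curve_lengths_E_nonempty swapped_dist_le_length assms)
      (auto intro!: reflect_in_E s point_interior_in_E l m)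
  also have "\<dots> = gd (point l) (reflect s (point m))"
    using gd_reflect[OF s, of "reflect s (point l)" "point m"] by (simp add: reflect_reflect[OF s])
  finally show ?thesis .
qed

end

section \<open>Parallelepipeds\<close>

lemma sgn_const_on_connected:
  fixes c :: "'a::topological_space \<Rightarrow> real"
  assumes "connected S" "continuous_on S c" "\<And>t. t \<in> S \<Longrightarrow> c t \<noteq> 0" "u \<in> S" "v \<in> S"
  shows "sgn (c u) = sgn (c v)"
proof -
  have "connected (c ` S)" using assms(1,2) by (rule connected_continuous_image[rotated])
  then have iv: "\<And>x y z. x \<in> c ` S \<Longrightarrow> y \<in> c ` S \<Longrightarrow> x \<le> z \<Longrightarrow> z \<le> y \<Longrightarrow> z \<in> c ` S"
    unfolding connected_iff_interval by blast
  have "0 \<notin> c ` S" using assms(3) by force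
  then show ?thesis
    using iv[of "c u" "c v" 0] iv[of "c v" "c u" 0] assms(4,5) by (auto simp: sgn_if)
qed

lemma convex_cube_facet: "convex (cube_facet k b)"
proof -
  have "cube_facet k b = cbox 0 1 \<inter> {t. inner (axis k 1) t = b}"
    by (auto simp: cube_facet_def inner_axis inner_axis')
  then show ?thesis by (simp add: convex_Int convex_hyperplane)
qed

lemma cube_vertex_in_facet: "v \<in> cube_vertices \<Longrightarrow> v \<in> cube_facet k (v $ k)"
  by (simp add: cube_vertices_def cube_facet_def mem_box_cart) (metis order_refl zero_le_one)

lemma cube_vertex_compl: "v \<in> cube_vertices \<Longrightarrow> 1 - v \<in> cube_vertices"
  by (auto simp: cube_vertices_def)

text \<open>If \<open>c\<close> has no zero on a pair of opposite facets, its sign is constant on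
  each of them. Every pair of opposite vertices has one vertex on either facet, and the product does
  not depend on the order.\<close>

lemma opposite_sign_const:
  fixes c :: "real ^ 'm \<Rightarrow> real"
  assumes cont: "continuous_on (cbox 0 1) c"
    and nz: "(\<forall>t\<in>cbox 0 1. c t \<noteq> 0) \<or> (\<exists>k. \<forall>b\<in>{0, 1}. \<forall>t\<in>cube_facet k b. c t \<noteq> 0)"
    and v: "v \<in> cube_vertices" and w: "w \<in> cube_vertices"
  shows "sgn (c v) * sgn (c (1 - v)) = sgn (c w) * sgn (c (1 - w))"
  using nz
proof
  assume nz: "\<forall>t\<in>cbox 0 1. c t \<noteq> 0"
  have box: "x \<in> cbox 0 1" if "x \<in> cube_vertices" for x :: "real ^ 'm"
    using cube_vertex_in_facet[OF that] by (auto simp: cube_facet_def)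
  have "sgn (c x) = sgn (c y)" if "x \<in> cube_vertices" "y \<in> cube_vertices" for x y
    by (rule sgn_const_on_connected[OF _ cont]) (use nz box that in \<open>auto simp: convex_connected\<close>)
  then show ?thesis using v w cube_vertex_compl by metis
next
  assume "\<exists>k. \<forall>b\<in>{0, 1}. \<forall>t\<in>cube_facet k b. c t \<noteq> 0"
  then obtain k where nz: "\<And>b t. b \<in> {0, 1} \<Longrightarrow> t \<in> cube_facet k b \<Longrightarrow> c t \<noteq> 0" by blast
  have eq: "sgn (c x) = sgn (c y)" if "x \<in> cube_vertices" "y \<in> cube_vertices" "x $ k = y $ k" for x y
  proof (rule sgn_const_on_connected[of "cube_facet k (x $ k)"])
    show "connected (cube_facet k (x $ k))" by (intro convex_connected convex_cube_facet)
    show "continuous_on (cube_facet k (x $ k)) c"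
      using cont by (rule continuous_on_subset) (auto simp: cube_facet_def)
    have "x $ k \<in> {0, 1}" using that(1) by (auto simp: cube_vertices_def)
    then show "c t \<noteq> 0" if "t \<in> cube_facet k (x $ k)" for t using nz that by blast
  qed (use that cube_vertex_in_facet[of x k] cube_vertex_in_facet[of y k] in auto)
  show ?thesis
  proof (cases "v $ k = w $ k")
    case True
    then show ?thesis using eq[of v w] eq[of "1 - v" "1 - w"] v w by (simp add: cube_vertex_compl)
  next
    case False
    then have "v $ k = 1 - w $ k" using v w unfolding cube_vertices_def
      by (smt (verit, best) mem_Collect_eq)
    then show ?thesis using eq[of v "1 - w"] eq[of "1 - v" w] v w by (simp add: cube_vertex_compl)
  qed
qed

context confocal
begin

lemma type_interval_not_axis: "t \<in> type_interval a j \<Longrightarrow> j \<noteq> top_index \<Longrightarrow> a $ i \<noteq> t"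
  using axes_mono[of i j] axes_mono[OF next_index_le, of j i]
  by (cases "i \<le> j") (auto simp: type_interval_eq not_le)

text \<open>Up to a positive factor, \<open>x\<^sub>i\<close> is the product of a square root of \<open>a\<^sub>i - \<lambda>\<^sub>i\<close> and a square
  root of \<open>\<lambda>\<^sub>p - a\<^sub>i\<close>, where \<open>p\<close> precedes \<open>i\<close>. Both can be chosen continuously: they are the
  imaginary and the real part of a continuous square root of a complex function that vanishes only
  at focal points.\<close>

lemma sign_factorization:
  fixes f :: "'b::real_normed_vector \<Rightarrow> (real, 'n) vec"
  assumes f: "continuous_on K f" "f ` K \<subseteq> E" and K: "contractible K"
    and nonfocal: "\<And>t j. t \<in> K \<Longrightarrow> f t \<notin> focal_quadric a j"
  shows "\<exists>c s p. continuous_on K c \<and> continuous_on K s \<and>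
     (\<forall>t\<in>K. sgn (f t $ i) = sgn (c t) * sgn (s t) \<and>
        (c t = 0 \<longrightarrow> i \<noteq> top_index \<and> coords (f t) $ i = a $ i) \<and>
        (s t = (0::real) \<longrightarrow> p \<noteq> top_index \<and> coords (f t) $ p = a $ i))"
proof -
  have fE: "f t \<in> E" if "t \<in> K" for t using f(2) that by blast
  have box: "coords (f t) \<in> coord_box" if "t \<in> K" for t by (rule coords_in_box[OF fE[OF that]])
  have zero: "\<exists>j. coords (f t) $ j = a $ i \<and> j \<le> i \<and> j \<noteq> top_index" if t: "t \<in> K" "f t $ i = 0" for t
  proof -
    have "coord_sq (coords (f t)) i = 0" using coords_square[OF fE[OF t(1)], of i] t(2) by simp
    then obtain j where j: "coords (f t) $ j = a $ i" by (auto simp: coord_sq_eq_0)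
    have "j \<le> i" using coord_box_less[OF box[OF t(1)], of i j] j by (metis less_irrefl not_le)
    moreover have "j \<noteq> top_index" using j box[OF t(1)] axes_pos[of i] by (auto simp: mem_coord_box)
    ultimately show ?thesis using j by blast
  qed
  have fi: "continuous_on K (\<lambda>t. f t $ i)" using f(1) by (intro continuous_intros)
  show ?thesis
  proof (cases "\<exists>j. j < i")
    case False
    \<comment> \<open>Without a preceding index, \<open>f t $ i\<close> can vanish only where
      coordinate \<open>i\<close> equals \<open>a $ i\<close>, so it is itself the first
      factor.\<close>
    then have min: "j = i" if "j \<le> i" for j using that by (auto simp: le_less)
    show ?thesis
      by (rule exI[of _ "\<lambda>t. f t $ i"], rule exI[of _ "\<lambda>t. 1"], rule exI[of _ i])
        (use fi zero min in auto)
  next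
    case True
    define p where "p = Max {j. j < i}"
    have pi: "p < i" using Max_in[of "{j. j < i}"] True unfolding p_def by auto
    have below: "j < p" if "j < i" "j \<noteq> p" for j
      using Max_ge[of "{j. j < i}" j] that unfolding p_def by (auto simp: le_less)
    have ptop: "p \<noteq> top_index" using pi le_top_index[of i] by (metis leD)
    have lp: "a $ i \<le> coords (f t) $ p" and lj: "j < p \<Longrightarrow> a $ i < coords (f t) $ j" if "t \<in> K" for t j
      using coord_box_ge[OF box[OF that] pi] coord_box_ge[OF box[OF that], of j p] axes_decreasing[OF pi] by auto
    show ?thesis
    proof (cases "i = top_index")
      case True
      \<comment> \<open>The top coordinate is constantly 0, so only coordinate \<open>p\<close> can
        reach \<open>a $ i\<close>, and \<open>f t $ i\<close> itself is the second factor.\<close>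
      have "coords (f t) $ p = a $ i" if t: "t \<in> K" "f t $ i = 0" for t
      proof -
        obtain j where j: "coords (f t) $ j = a $ i" "j \<le> i" "j \<noteq> top_index" using zero[OF t] by blast
        then have "j < i" using True by (auto simp: le_less)
        then have "j = p" using lj[OF t(1), of j] below[of j] j(1) by force
        then show ?thesis using j(1) by simp
      qed
      then show ?thesis
        by (intro exI[of _ "\<lambda>t. 1"] exI[of _ "\<lambda>t. f t $ i"] exI[of _ p]) (use fi ptop in auto)
    next
      case itop: False
      \<comment> \<open>The part of the product formula that stays positive: coordinates other than
        \<open>i\<close> and \<open>p\<close> never equal \<open>a $ i\<close>.\<close>
      define r where "r t = (\<Prod>j\<in>UNIV - {i} - {p}. (a $ i - coords (f t) $ j) / (a $ i - a $ j)) / (a $ p - a $ i)" for t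
      define A where "A t = a $ i - coords (f t) $ i" for t
      define B where "B t = coords (f t) $ p - a $ i" for t
      have A0: "0 \<le> A t" and B0: "0 \<le> B t" if "t \<in> K" for t
        using coord_box_le[OF box[OF that], of i i] lp[OF that] by (auto simp: A_def B_def)
      have rpos: "0 < r t" if t: "t \<in> K" for t
        unfolding r_def
      proof (rule divide_pos_pos, rule prod_pos)
        show "0 < a $ p - a $ i" using axes_decreasing[OF pi] by simp
        fix j assume j: "j \<in> UNIV - {i} - {p}"
        show "0 < (a $ i - coords (f t) $ j) / (a $ i - a $ j)"
        proof (cases "j < i")
          case True
          then show ?thesis using lj[OF t, of j] below[of j] j axes_decreasing[OF True]
            by (intro divide_neg_neg) auto
        next
          case False
          then have "i < j" using j by auto
          then show ?thesis using coord_box_less[OF box[OF t]] axes_decreasing by (intro divide_pos_pos) auto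
        qed
      qed
      have sq: "f t $ i * f t $ i = A t * B t * r t" if t: "t \<in> K" for t
      proof -
        have "(\<Prod>j\<in>UNIV - {i}. (a $ i - coords (f t) $ j) / (a $ i - a $ j)) =
          (a $ i - coords (f t) $ p) / (a $ i - a $ p) * (\<Prod>j\<in>UNIV - {i} - {p}. (a $ i - coords (f t) $ j) / (a $ i - a $ j))"
          using pi by (intro prod.remove) auto
        moreover have "(a $ i - coords (f t) $ p) / (a $ i - a $ p) = B t / (a $ p - a $ i)"
          unfolding B_def by (metis minus_diff_eq minus_divide_divide)
        ultimately show ?thesis
          unfolding coords_square[OF fE[OF t]] coord_sq_eq r_def A_def by simp
      qed
      have Lf: "continuous_on K (\<lambda>t. coords (f t))"
        by (rule continuous_on_compose2[OF continuous_on_coords f])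
      have rc: "continuous_on K r" unfolding r_def
        using axes_decreasing[OF pi] by (intro continuous_intros Lf) auto
      \<comment> \<open>By \<open>sq\<close> the imaginary part squares to
        \<open>4 * A t * B t\<close>, so \<open>W t\<close> is the square of a number with squared
        real part \<open>B t\<close> and squared imaginary part \<open>A t\<close>. It vanishes only
        where \<open>A t = B t = 0\<close>, which means coinciding coordinates.\<close>
      define W where "W t = Complex (B t - A t) (2 * f t $ i / sqrt (r t))" for t
      have "continuous_on K W"
        unfolding W_def A_def B_def Complex_eq
        using rpos by (intro continuous_intros Lf rc f(1)) force+
      moreover have "W t \<noteq> 0" if t: "t \<in> K" for t
      proof
        assume "W t = 0"
        then have "B t = A t" "f t $ i = 0" using rpos[OF t] by (auto simp: W_def complex_eq_iff)
        then have "A t = 0" "B t = 0" using sq[OF t] rpos[OF t] by auto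
        then have "f t \<in> focal_quadric a i"
          using pi by (intro coords_focal[OF fE[OF t], of i p]) (auto simp: A_def B_def)
        then show False using nonfocal[OF t] by blast
      qed
      ultimately obtain g where g: "continuous_on K g" "\<And>t. t \<in> K \<Longrightarrow> W t = (g t)\<^sup>2"
        using continuous_sqrt_on_contractible[OF _ K] by blast
      have key: "(Re (g t))\<^sup>2 = B t" "(Im (g t))\<^sup>2 = A t" "f t $ i = sqrt (r t) * (Im (g t) * Re (g t))"
        if t: "t \<in> K" for t
      proof -
        define x where "x = Re (g t)"
        define y where "y = Im (g t)"
        have xy: "x\<^sup>2 - y\<^sup>2 = B t - A t" "2 * f t $ i / sqrt (r t) = 2 * x * y"
          using g(2)[OF t] by (auto simp: complex_eq_iff W_def x_def y_def power2_eq_square)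
        then show fxy: "f t $ i = sqrt (r t) * (Im (g t) * Re (g t))"
          using rpos[OF t] by (simp add: field_simps x_def y_def)
        have "r t * (x * y)\<^sup>2 = A t * B t * r t"
          using sq[OF t] rpos[OF t] unfolding fxy x_def[symmetric] y_def[symmetric]
          by (simp add: power2_eq_square mult_ac)
        then have xy2: "x\<^sup>2 * y\<^sup>2 = A t * B t" using rpos[OF t] by (simp add: power_mult_distrib)
        \<comment> \<open>The squared modulus of the root is the modulus \<open>A t + B t\<close> of
          \<open>W t\<close>; together with the known difference this separates the two
          squares.\<close>
        have "(x\<^sup>2 + y\<^sup>2)\<^sup>2 = (x\<^sup>2 - y\<^sup>2)\<^sup>2 + 4 * (x\<^sup>2 * y\<^sup>2)" by (simp add: power2_eq_square algebra_simps)
        also have "\<dots> = (A t + B t)\<^sup>2" unfolding xy xy2 by (simp add: power2_eq_square algebra_simps)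
        finally have "x\<^sup>2 + y\<^sup>2 = A t + B t"
          using A0[OF t] B0[OF t] by (simp add: power2_eq_iff_nonneg)
        with xy(1) show "(Re (g t))\<^sup>2 = B t" "(Im (g t))\<^sup>2 = A t"
          by (auto simp: x_def y_def)
      qed
      show ?thesis
      proof (rule exI[of _ "\<lambda>t. Im (g t)"], rule exI[of _ "\<lambda>t. Re (g t)"], rule exI[of _ p], intro conjI ballI)
        show "continuous_on K (\<lambda>t. Im (g t))" "continuous_on K (\<lambda>t. Re (g t))"
          using g(1) by (auto intro!: continuous_intros)
        fix t assume t: "t \<in> K"
        show "sgn (f t $ i) = sgn (Im (g t)) * sgn (Re (g t))"
          using rpos[OF t] unfolding key(3)[OF t] by (simp add: sgn_mult)
        show "Im (g t) = 0 \<longrightarrow> i \<noteq> top_index \<and> coords (f t) $ i = a $ i"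
          using key(2)[OF t] itop by (auto simp: A_def)
        show "Re (g t) = 0 \<longrightarrow> p \<noteq> top_index \<and> coords (f t) $ p = a $ i"
          using key(1)[OF t] ptop by (auto simp: B_def)
      qed
    qed
  qed
qed

lemma eq_reflect_point:
  assumes "p \<in> E" "\<And>i. p $ i \<noteq> 0"
  shows "(\<chi> i. sgn (p $ i)) \<in> signs" "p = reflect (\<chi> i. sgn (p $ i)) (point (coords p))"
proof -
  show "(\<chi> i. sgn (p $ i)) \<in> signs" using assms(2) by (simp add: signs_def abs_sgn_eq)
  show "p = reflect (\<chi> i. sgn (p $ i)) (point (coords p))"
    by (simp only: point_coords[OF assms(1)] vec_eq_iff reflect_nth vec_lambda_beta absv_nth sgn_mult_abs) simp
qed

end

context confocal_proper
begin

lemma gd_eq_coords: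
  assumes p: "p \<in> E" "\<And>i. p $ i \<noteq> 0" and q: "q \<in> E" "\<And>i. q $ i \<noteq> 0"
  shows "gd p q = gd (point (coords p)) (reflect (\<chi> i. sgn (p $ i) * sgn (q $ i)) (point (coords q)))"
    and "(\<chi> i. sgn (p $ i) * sgn (q $ i)) \<in> signs"
proof -
  let ?e = "\<chi> i. sgn (p $ i)" and ?f = "\<chi> i. sgn (q $ i)"
  note P = eq_reflect_point[OF p] and R = eq_reflect_point[OF q]
  show "(\<chi> i. sgn (p $ i) * sgn (q $ i)) \<in> signs"
    using P(1) R(1) by (simp add: signs_def abs_mult)
  have "gd p q = gd (reflect ?e p) (reflect ?e q)" by (rule gd_reflect[OF P(1), symmetric])
  also have "reflect ?e p = point (coords p)"
    using reflect_reflect[OF P(1), of "point (coords p)"] P(2) by metis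
  also have "reflect ?e q = reflect (\<chi> i. sgn (p $ i) * sgn (q $ i)) (point (coords q))"
    by (subst R(2)) (simp add: vec_eq_iff mult.assoc del: point_nth)
  finally show "gd p q = gd (point (coords p)) (reflect (\<chi> i. sgn (p $ i) * sgn (q $ i)) (point (coords q)))" .
qed

end

theorem theorem6:
  fixes a :: "real ^ 'n::{finite,linorder}"
    and h :: "real ^ 'm \<Rightarrow> real ^ 'n::{finite,linorder}"
    and P :: "(real ^ 'n::{finite,linorder}) set"
  assumes "\<And>i j. i < j \<Longrightarrow> a $ j < a $ i"
    and "\<And>i. 0 < a $ i"
    and "confocal_parallelepiped a h P"
  shows "\<forall>v\<in>cube_vertices. \<forall>w\<in>cube_vertices.
           geodesic_dist (ellipsoid a) (h v) (h (1 - v)) =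
           geodesic_dist (ellipsoid a) (h w) (h (1 - w))"
proof -
  note par = assms(3)[unfolded confocal_parallelepiped_def]
  have PE: "P \<subseteq> ellipsoid a" and focal: "\<And>j. P \<inter> focal_quadric a j = {}"
    using par by simp_all
  obtain g where hom: "homeomorphism (cbox 0 1) P h g" using par by blast
  obtain \<sigma> where \<sigma>: "bij_betw \<sigma> (UNIV :: 'm set) type_indices"
    and facets': "\<forall>k. \<forall>c\<in>{0, 1}. \<exists>\<mu>\<in>type_interval a (\<sigma> k). h ` cube_facet k c \<subseteq> confocal_quadric a \<mu>"
    using par by blast
  have facets: "\<exists>\<mu>\<in>type_interval a (\<sigma> k). h ` cube_facet k c \<subseteq> confocal_quadric a \<mu>" if "c \<in> {0, 1}" for k c
    using facets' that by (rule_tac bspec) (rule spec)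
  have \<sigma>_type: "\<sigma> k \<in> type_indices" for k using \<sigma> by (auto simp: bij_betw_def)
  \<comment> \<open>An index type is nonempty, so the cube has a direction; its type is a
    non-maximal index, which gives a second axis.\<close>
  interpret confocal_proper a
  proof unfold_locales
    obtain k :: 'm where True by simp
    from \<sigma>_type[of k] obtain j where "\<sigma> k < j" by (auto simp: type_indices_def)
    then have "\<sigma> k \<noteq> j" by auto
    then show "\<exists>i j. (i :: 'n) \<noteq> j" by blast
  qed (use assms(1,2) in auto)
  have \<sigma>_top: "\<sigma> k \<noteq> top_index" for k using \<sigma>_type[of k] by (simp add: type_indices_eq)
  have \<sigma>_ex: "\<exists>k. \<sigma> k = i" if "i \<noteq> top_index" for i
  proof -
    have "i \<in> range \<sigma>" using \<sigma> that by (simp add: bij_betw_def type_indices_eq)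
    then show ?thesis by auto
  qed
  define \<mu> where "\<mu> k c = (SOME \<mu>. \<mu> \<in> type_interval a (\<sigma> k) \<and> h ` cube_facet k c \<subseteq> confocal_quadric a \<mu>)" for k c
  have "\<mu> k c \<in> type_interval a (\<sigma> k) \<and> h ` cube_facet k c \<subseteq> confocal_quadric a (\<mu> k c)" if "c \<in> {0, 1}" for k c
    unfolding \<mu>_def by (rule someI_ex) (use facets[OF that, of k] in blast)
  then have \<mu>: "\<And>k c. c \<in> {0, 1} \<Longrightarrow> \<mu> k c \<in> type_interval a (\<sigma> k)"
    "\<And>k c. c \<in> {0, 1} \<Longrightarrow> h ` cube_facet k c \<subseteq> confocal_quadric a (\<mu> k c)"
    by blast+
  have cont: "continuous_on (cbox 0 1) h" and img: "h ` cbox 0 1 = P"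
    using hom by (auto simp: homeomorphism_def)
  have hE: "h t \<in> E" if "t \<in> cbox 0 1" for t using img PE that by blast
  have facet_L: "coords (h t) $ \<sigma> k = \<mu> k c" if "c \<in> {0, 1}" "t \<in> cube_facet k c" for t k c
  proof (rule coords_facet[OF _ \<mu>(1)[OF that(1)] \<sigma>_top])
    show "h t \<in> E" using that(2) by (intro hE) (simp add: cube_facet_def)
    show "Q (\<mu> k c) (h t) (h t) = 1"
      using \<mu>(2)[OF that(1), of k] that(2) by (auto simp: confocal_quadric_iff[symmetric])
  qed
  have facet_axis: "coords (h t) $ \<sigma> k \<noteq> a $ i" if "c \<in> {0, 1}" "t \<in> cube_facet k c" for t k c i
    using facet_L[OF that] type_interval_not_axis[OF \<mu>(1)[OF that(1)] \<sigma>_top, of i k] by simp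
  have vbox: "v \<in> cbox 0 1" if "v \<in> cube_vertices" for v :: "real ^ 'm"
    using cube_vertex_in_facet[OF that] by (auto simp: cube_facet_def)
  have v01: "v $ k \<in> {0, 1}" if "v \<in> cube_vertices" for v :: "real ^ 'm" and k
    using that by (auto simp: cube_vertices_def)
  have vL: "coords (h v) $ \<sigma> k = \<mu> k (v $ k)" if "v \<in> cube_vertices" for v k
    by (rule facet_L[OF v01[OF that] cube_vertex_in_facet[OF that]])
  have Ltop: "coords (h v) $ top_index = 0" if "v \<in> cube_vertices" for v
    using coords_in_box[OF hE[OF vbox[OF that]]] by (simp add: mem_coord_box)
  have vint: "coords (h v) \<in> coord_interior" if "v \<in> cube_vertices" for v
  proof -
    have "a $ next_index i < coords (h v) $ i \<and> coords (h v) $ i < a $ i" if i: "i \<noteq> top_index" for i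
    proof -
      obtain k where k: "\<sigma> k = i" using \<sigma>_ex[OF i] by blast
      show ?thesis
        using \<mu>(1)[OF v01[OF \<open>v \<in> cube_vertices\<close>, of k], of k] vL[OF \<open>v \<in> cube_vertices\<close>, of k]
        by (simp add: k type_interval_eq)
    qed
    then show ?thesis using Ltop[OF that] by (simp add: coord_interior_def)
  qed
  have nz: "h v $ i \<noteq> 0" if "v \<in> cube_vertices" for v i
    using coords_square[OF hE[OF vbox[OF that]], of i] coord_sq_pos[OF vint[OF that], of i] by auto
  have signs_eq: "sgn (h v $ i) * sgn (h (1 - v) $ i) = sgn (h w $ i) * sgn (h (1 - w) $ i)"
    if v: "v \<in> cube_vertices" and w: "w \<in> cube_vertices" for v w i
  proof -
    have "\<exists>c s p. continuous_on (cbox 0 1) c \<and> continuous_on (cbox 0 1) s \<and>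
     (\<forall>t\<in>cbox 0 1. sgn (h t $ i) = sgn (c t) * sgn (s t) \<and>
        (c t = 0 \<longrightarrow> i \<noteq> top_index \<and> coords (h t) $ i = a $ i) \<and>
        (s t = (0::real) \<longrightarrow> p \<noteq> top_index \<and> coords (h t) $ p = a $ i))"
    proof (rule sign_factorization[OF cont])
      show "h ` cbox 0 1 \<subseteq> E" using hE by blast
      show "contractible (cbox 0 1 :: (real ^ 'm) set)" by (intro convex_imp_contractible convex_box)
      show "h t \<notin> focal_quadric a j" if "t \<in> cbox 0 1" for t j using focal[of j] img that by blast
    qed
    then obtain c s p where c: "continuous_on (cbox 0 1) c" and s: "continuous_on (cbox 0 1) s"
      and sg: "\<And>t. t \<in> cbox 0 1 \<Longrightarrow> sgn (h t $ i) = sgn (c t) * sgn (s t)"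
      and c0: "\<And>t. t \<in> cbox 0 1 \<Longrightarrow> c t = 0 \<Longrightarrow> i \<noteq> top_index \<and> coords (h t) $ i = a $ i"
      and s0: "\<And>t. t \<in> cbox 0 1 \<Longrightarrow> s t = 0 \<Longrightarrow> p \<noteq> top_index \<and> coords (h t) $ p = a $ i"
      by blast
    \<comment> \<open>A zero of the factor puts coordinate \<open>q\<close> at \<open>a $ i\<close>.
      On the two facets of type \<open>q\<close> this coordinate is a constant in the open type
      interval, so the factor does not vanish there.\<close>
    have inv: "sgn (f v) * sgn (f (1 - v)) = sgn (f w) * sgn (f (1 - w))"
      if f: "continuous_on (cbox 0 1) f"
        and f0: "\<And>t. t \<in> cbox 0 1 \<Longrightarrow> f t = 0 \<Longrightarrow> q \<noteq> top_index \<and> coords (h t) $ q = a $ i"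
      for f :: "real ^ 'm \<Rightarrow> real" and q
    proof (rule opposite_sign_const[OF f _ v w])
      show "(\<forall>t\<in>cbox 0 1. f t \<noteq> 0) \<or> (\<exists>k. \<forall>b\<in>{0, 1}. \<forall>t\<in>cube_facet k b. f t \<noteq> 0)"
      proof (cases "q = top_index")
        case True then show ?thesis using f0 by blast
      next
        case False
        then obtain k where k: "\<sigma> k = q" using \<sigma>_ex by blast
        have "f t \<noteq> 0" if "b \<in> {0, 1}" "t \<in> cube_facet k b" for b t
          using facet_axis[OF that, of i] f0[of t] that(2) by (auto simp: k cube_facet_def)
        then show ?thesis by blast
      qed
    qed
    have split: "sgn (h x $ i) * sgn (h (1 - x) $ i) = (sgn (c x) * sgn (c (1 - x))) * (sgn (s x) * sgn (s (1 - x)))"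
      if "x \<in> cube_vertices" for x
      unfolding sg[OF vbox[OF that]] sg[OF vbox[OF cube_vertex_compl[OF that]]] by (simp only: mult_ac)
    have "sgn (c v) * sgn (c (1 - v)) = sgn (c w) * sgn (c (1 - w))" by (rule inv[OF c c0])
    moreover have "sgn (s v) * sgn (s (1 - v)) = sgn (s w) * sgn (s (1 - w))" by (rule inv[OF s s0])
    ultimately show ?thesis by (simp only: split[OF v] split[OF w])
  qed
  have le: "gd (h w) (h (1 - w)) \<le> gd (h v) (h (1 - v))"
    if v: "v \<in> cube_vertices" and w: "w \<in> cube_vertices" for v w
  proof -
    note v' = cube_vertex_compl[OF v] and w' = cube_vertex_compl[OF w]
    \<comment> \<open>Passing from the pair of \<open>v\<close> to that of \<open>w\<close> moves to
      the opposite facet in exactly these directions, that is, swaps the coordinates in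
      \<open>S\<close>.\<close>
    define S where "S = {\<sigma> k | k. v $ k \<noteq> w $ k}"
    have topS: "top_index \<notin> S" by (auto simp: S_def \<sigma>_top[symmetric])
    have inS: "\<sigma> k \<in> S \<longleftrightarrow> v $ k \<noteq> w $ k" for k
      using \<sigma> by (auto simp: S_def bij_betw_def inj_eq)
    have flip: "w $ k = 1 - v $ k" if "v $ k \<noteq> w $ k" for k
      using v01[OF v, of k] v01[OF w, of k] that by auto
    have sw: "coords (h w) = swap S (coords (h v)) (coords (h (1 - v)))" "coords (h (1 - w)) = swap S (coords (h (1 - v))) (coords (h v))"
    proof -
      have "coords (h w) $ i = swap S (coords (h v)) (coords (h (1 - v))) $ i \<and>
          coords (h (1 - w)) $ i = swap S (coords (h (1 - v))) (coords (h v)) $ i" for i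
      proof (cases "i = top_index")
        case True then show ?thesis using v w v' w' by (simp add: swap_nth Ltop)
      next
        case False
        then obtain k where k: "\<sigma> k = i" using \<sigma>_ex by blast
        show ?thesis
          using inS[of k] flip[of k] vL[OF v, of k] vL[OF w, of k] vL[OF v', of k] vL[OF w', of k]
          by (auto simp: k swap_nth)
      qed
      then show "coords (h w) = swap S (coords (h v)) (coords (h (1 - v)))" "coords (h (1 - w)) = swap S (coords (h (1 - v))) (coords (h v))"
        by (auto simp: vec_eq_iff)
    qed
    let ?s = "\<chi> i. sgn (h v $ i) * sgn (h (1 - v) $ i)"
    have s_eq: "(\<chi> i. sgn (h w $ i) * sgn (h (1 - w) $ i)) = ?s" by (simp add: signs_eq[OF w v])
    have "gd (h w) (h (1 - w)) = gd (point (coords (h w))) (reflect ?s (point (coords (h (1 - w)))))"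
      using gd_eq_coords(1)[OF hE[OF vbox[OF w]] nz[OF w] hE[OF vbox[OF w']] nz[OF w']]
      unfolding s_eq .
    also have "\<dots> \<le> gd (point (coords (h v))) (reflect ?s (point (coords (h (1 - v)))))"
      unfolding sw
      by (intro swapped_dist_le vint v v' topS gd_eq_coords(2) hE vbox nz)
    also have "\<dots> = gd (h v) (h (1 - v))"
      by (rule gd_eq_coords(1)[OF hE[OF vbox[OF v]] nz[OF v] hE[OF vbox[OF v']] nz[OF v'], symmetric])
    finally show ?thesis .
  qed
  show ?thesis using le by (intro ballI order_antisym)
qed

end
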